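(* Let $h>0$ and consider the equation $$x'(t)=\lambda(t)\,x(t)\,f(t,\mathcal{L}(t,x_t)),\qquad t\ge 0,\ x\ge 0,$$ where $x_t(s)=x(t+s)$ for $s\in[-h,0]$. Assume: (1) $\lambda:[-h,\infty)\to(0,\infty)$ is measurable, $\int_0^\infty\lambda(s)\,ds=\infty$ and $\sup_{t\ge 0}\int_{t-h}^t\lambda(s)\,ds<\infty$; (2) $f:\mathbb{R}_+\times\mathbb{R}\to\mathbb{R}$ and $\mathcal{L}:\mathbb{R}_+\times C([-h,0],\mathbb{R})\to\mathbb{R}$ are Carathéodory functions, and $\min\phi\le\mathcal{L}(t,\phi)\le\max\phi$ for every $\phi\in C([-h,0],\mathbb{R})$ and $t\ge 0$; (3) $f(t,1)=0$ for all $t\ge 0$; (4) the integral $\int_0^{+\infty}\lambda(s)f(s,w(s))\,ds$ diverges for every continuous function $w$ converging at $+\infty$ to some positive number different from $1$; (5) $x\,f(t,1+x)<0$ for all $t\ge0$ and all $x>-1$, $x\ne 0$; (6) there are $a<0$ and $b\ge 0$ such that, with $r(x)=\dfrac{ax}{1+bx}$, $$x\,\bigl(f(t,x+1)-r(x)\bigr)\ge 0\quad\text{for all } t\ge 0\text{ and all }x>\max\{-1,-b^{-1}\},$$ where $-b^{-1}=-\infty$ if $b=0$. For $T>0$ let $\Lambda=\sup_{t\ge T}\int_{t-h}^t\lambda(s)\,ds$. If $b\ne 1/2$ and, for some $T>0$, $|a|\Lambda\le 3/2$, then $\lim_{t\to+\infty}x(t)=1$ for every nontrivial solution $x$ of the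 equation. If $b=1/2$, then the same conclusion holds when, for some $T>0$, $|a|\Lambda<3/2$.
   Context: A Carathéodory function $g(t,\phi)$ is one that is measurable in $t$ for each fixed $\phi$, continuous in $\phi$ for each fixed $t$, and such that for any $(t,\phi)$ there are a neighbourhood $V(t,\phi)$ and a Lebesgue integrable function $m$ with $|g(s,\psi)|\le m(s)$ for all $(s,\psi)\in V(t,\phi)$. Solutions are understood in the Carathéodory sense (continuous, locally absolutely continuous for $t\ge0$, equation satisfied for almost every $t$), nonnegative ($x\ge 0$), and defined on the maximal interval of existence. A solution is nontrivial if it is not identically zero for $t\ge 0$; such solutions are eventually positive. *)

theory Defs
  imports "HOL-Analysis.Analysis"
begin

(* C([-h,0], R) with the sup metric. Its points are extensional functions, so segments of a
   function on the line have to be cut down with "restrict". *)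
definition hist_space :: "real \<Rightarrow> (real \<Rightarrow> real) metric" where
  "hist_space h = cfunspace (top_of_set {-h..0}) euclidean_metric"

lemma mspace_hist_space:
  "mspace (hist_space h) = {\<phi>. continuous_on {-h..0} \<phi> \<and> \<phi> \<in> extensional {-h..0}}"
proof -
  have "Metric_space.mbounded UNIV dist (\<phi> ` {-h..0})" if "continuous_on {-h..0} \<phi>"
    for \<phi> :: "real \<Rightarrow> real"
    using compact_imp_bounded[OF compact_continuous_image[OF that compact_Icc]] by simp
  then show ?thesis
    by (auto simp: hist_space_def)
qed

definition segment :: "real \<Rightarrow> (real \<Rightarrow> real) \<Rightarrow> real \<Rightarrow> real \<Rightarrow> real" where
  "segment h x t = restrict (\<lambda>s. x (t + s)) {-h..0}"

lemma segment_in_hist_space: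
  assumes "continuous_on {t-h..t} x"
  shows "segment h x t \<in> mspace (hist_space h)"
proof -
  have "continuous_on {-h..0} (\<lambda>s. x (t + s))"
    by (rule continuous_on_compose2[OF assms]) (auto intro!: continuous_intros)
  then have "continuous_on {-h..0} (segment h x t)"
    by (rule continuous_on_eq) (auto simp: segment_def)
  then show ?thesis
    by (simp add: mspace_hist_space segment_def)
qed

definition caratheodory :: "'p topology \<Rightarrow> (real \<Rightarrow> 'p \<Rightarrow> real) \<Rightarrow> bool" where
  "caratheodory X g \<longleftrightarrow>
     (\<forall>\<phi>\<in>topspace X. (\<lambda>t. g t \<phi>) \<in> borel_measurable (lebesgue_on {0..})) \<and>
     (\<forall>t\<ge>0. continuous_map X euclideanreal (g t)) \<and>
     (\<forall>t\<ge>0. \<forall>\<phi>\<in>topspace X. \<exists>V m.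
        openin (prod_topology (top_of_set {0..}) X) V \<and> (t, \<phi>) \<in> V \<and>
        integrable (lebesgue_on {0..}) m \<and>
        (\<forall>(s, \<psi>)\<in>V. \<bar>g s \<psi>\<bar> \<le> m s))"

definition abs_continuous_on :: "real set \<Rightarrow> (real \<Rightarrow> real) \<Rightarrow> bool" where
  "abs_continuous_on S F \<longleftrightarrow>
     (\<forall>\<epsilon>>0. \<exists>\<delta>>0. \<forall>(n::nat) u v.
        (\<forall>i<n. u i \<le> v i \<and> {u i..v i} \<subseteq> S) \<and>
        disjoint_family_on (\<lambda>i. {u i<..<v i}) {..<n} \<and>
        (\<Sum>i<n. v i - u i) < \<delta> \<longrightarrow>
        (\<Sum>i<n. \<bar>F (v i) - F (u i)\<bar>) < \<epsilon>)"

(* As for any improper integral over [0,oo), the proper integrals over [0,T] exist and are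
   finite; divergence means that they have no finite limit as T tends to infinity. *)
definition improper_integral_diverges :: "(real \<Rightarrow> real) \<Rightarrow> bool" where
  "improper_integral_diverges g \<longleftrightarrow>
     (\<forall>T\<ge>0. integrable (lebesgue_on {0..T}) g) \<and>
     \<not> (\<exists>I. ((\<lambda>T. LINT s|lebesgue_on {0..T}. g s) \<longlongrightarrow> I) at_top)"

(* sup {integral of lam over [t-h,t] | t >= T} *)
definition Lambda_sup :: "real \<Rightarrow> (real \<Rightarrow> real) \<Rightarrow> real \<Rightarrow> ennreal" where
  "Lambda_sup h lam T = (SUP t\<in>{T..}. \<integral>\<^sup>+ s. ennreal (lam s) \<partial>lebesgue_on {t-h..t})"

(* x is a nonnegative Caratheodory solution of x'(t) = lam(t) x(t) f(t, L(t, x_t)) on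
   [-h,\<omega>) with 0 < \<omega> \<le> \<infinity>; values of x outside [-h,\<omega>) are irrelevant. *)
definition solution_on ::
  "real \<Rightarrow> (real \<Rightarrow> real) \<Rightarrow> (real \<Rightarrow> real \<Rightarrow> real) \<Rightarrow> (real \<Rightarrow> (real \<Rightarrow> real) \<Rightarrow> real)
    \<Rightarrow> ereal \<Rightarrow> (real \<Rightarrow> real) \<Rightarrow> bool" where
  "solution_on h lam f L \<omega> x \<longleftrightarrow>
     0 < \<omega> \<and>
     continuous_on {t. -h \<le> t \<and> ereal t < \<omega>} x \<and>
     (\<forall>t. -h \<le> t \<and> ereal t < \<omega> \<longrightarrow> 0 \<le> x t) \<and>
     (\<forall>T\<ge>0. ereal T < \<omega> \<longrightarrow> abs_continuous_on {0..T} x) \<and>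
     (AE t in lebesgue. 0 \<le> t \<and> ereal t < \<omega> \<longrightarrow>
        (x has_real_derivative lam t * x t * f t (L t (segment h x t))) (at t))"

definition maximal_solution ::
  "real \<Rightarrow> (real \<Rightarrow> real) \<Rightarrow> (real \<Rightarrow> real \<Rightarrow> real) \<Rightarrow> (real \<Rightarrow> (real \<Rightarrow> real) \<Rightarrow> real)
    \<Rightarrow> ereal \<Rightarrow> (real \<Rightarrow> real) \<Rightarrow> bool" where
  "maximal_solution h lam f L \<omega> x \<longleftrightarrow>
     solution_on h lam f L \<omega> x \<and>
     \<not> (\<exists>\<omega>' y. \<omega> < \<omega>' \<and> solution_on h lam f L \<omega>' y \<and>
           (\<forall>t. -h \<le> t \<and> ereal t < \<omega> \<longrightarrow> y t = x t))"

definition nontrivial_on :: "ereal \<Rightarrow> (real \<Rightarrow> real) \<Rightarrow> bool" where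
  "nontrivial_on \<omega> x \<longleftrightarrow> (\<exists>t\<ge>0. ereal t < \<omega> \<and> x t \<noteq> 0)"

(* The limit at infinity only makes sense for a global solution, hence \<omega> = \<infinity>. *)
definition nontrivial_solutions_tend_to_1 ::
  "real \<Rightarrow> (real \<Rightarrow> real) \<Rightarrow> (real \<Rightarrow> real \<Rightarrow> real) \<Rightarrow> (real \<Rightarrow> (real \<Rightarrow> real) \<Rightarrow> real) \<Rightarrow> bool" where
  "nontrivial_solutions_tend_to_1 h lam f L \<longleftrightarrow>
     (\<forall>\<omega> x. maximal_solution h lam f L \<omega> x \<and> nontrivial_on \<omega> x \<longrightarrow>
        \<omega> = \<infinity> \<and> (x \<longlongrightarrow> 1) at_top)"

end

theory Submission
  imports Defs "HOL-Complex_Analysis.Great_Picard"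
begin

text \<open>
  A superposition operator that maps continuous functions to locally integrable ones is automatically
  dominated by integrable functions on compact sets. By condition (4) this applies to
  \<open>\<lambda>(t) f(t, u)\<close>, so a solution stays positive and bounded on bounded intervals, and Tonelli's scheme
  continues it past every finite time. A nonoscillating solution is eventually monotone; if its limit
  differed from 1, the measurable function \<open>L(t, x_t)\<close> could be replaced, up to an integrable
  error, by a continuous one, contradicting (4).

  For an oscillating solution put \<open>y = ln x\<close>, \<open>\<beta> = b - 1/2\<close> and measure time by
  \<open>\<tau>(t) = |a| \<integral> \<lambda>\<close>. The Pade inequality \<open>e^c (2 - c) \<le> 2 + c\<close> turns the bound (6) into the
  bound \<open>y / (1 + \<beta> y)\<close> for \<open>y\<close>, which after scaling by \<open>\<beta>\<close> no longer depends on
  \<open>b\<close>. Integrating over one excursion of length at most 3/2 in \<open>\<tau>\<close> bounds the minima in terms of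
  the maxima and conversely; the composition of the two bounds maps every \<open>M > 0\<close> strictly below
  itself, so the oscillation dies out. For \<open>b = 1/2\<close> the comparison is linear, and the strict
  inequality on the length provides the contraction.
\<close>

text \<open>The Caratheodory condition supplies majorants for \<open>f\<close> but none for its
  product with \<open>lam\<close>, so limit passages would lack a dominating function; this is why
  domination is extracted from the integrability built into condition (4). As \<open>lam\<close> is
  only measurable, neither \<open>ln x\<close> nor the clock need be differentiable everywhere, and
  all delay inequalities are stated for increments. The value 3/2 is critical. A history bounded by
  M comes down to a zero during the last clock unit before it, to first order, so an excursion in a
  window of length \<Lambda> has size M/2 + (\<Lambda> - 1) M. At \<Lambda> = 3/2 this equals M, and
  convergence has to come from the nonlinearity. The second-order effects of the two rates c/(1 + c)
  and c/(1 - c) cancel in the composition; the gain is only of third order, so the logarithm must be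
  estimated to that order and no uniform contraction factor exists near 0. The linear comparison
  used for b = 1/2 has no such gain.\<close>

section \<open>Absolute continuity and differentiation of integrals\<close>

text \<open>The gauge separates two kinds of tags. Tags in the null set \<open>N\<close> get an open
  set of measure below \<open>\<delta>\<close>, so absolute continuity bounds the increments of
  \<open>F\<close> over their cells; the other tags are controlled by differentiability.
  Integrability of \<open>F'\<close> is part of the conclusion.\<close>

lemma has_integral_abs_continuous:
  fixes F F' :: "real \<Rightarrow> real"
  assumes ac: "abs_continuous_on {a..b} F" and ab: "a \<le> b"
    and N: "negligible N"
    and D: "\<And>t. t \<in> {a..b} - N \<Longrightarrow> (F has_real_derivative F' t) (at t within {a..b})"
  shows "(F' has_integral (F b - F a)) {a..b}"
proof -
  define G where "G t = (if t \<in> N then 0 else F' t)" for t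
  have "(G has_integral (F b - F a)) (cbox a b)"
    unfolding has_integral
  proof (intro allI impI)
    fix e :: real assume "e > 0"
    \<comment> \<open>The summand 1 covers \<open>a = b\<close>; the cells tagged outside
      \<open>N\<close> then contribute at most \<open>e1 * (b - a) < e / 2\<close>.\<close>
    define e1 where "e1 = e / 2 / (b - a + 1)"
    have "e1 > 0" using \<open>e>0\<close> ab by (simp add: e1_def)
    have "\<exists>\<delta>>0. \<forall>(n::nat) u v. (\<forall>i<n. u i \<le> v i \<and> {u i..v i} \<subseteq> {a..b}) \<and>
        disjoint_family_on (\<lambda>i. {u i<..<v i}) {..<n} \<and> (\<Sum>i<n. v i - u i) < \<delta> \<longrightarrow>
        (\<Sum>i<n. \<bar>F (v i) - F (u i)\<bar>) < e / 2"
      using ac[unfolded abs_continuous_on_def, THEN spec, of "e / 2"] \<open>e > 0\<close> by simp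
    then obtain \<delta> where "\<delta> > 0" and \<delta>: "\<forall>(n::nat) u v. (\<forall>i<n. u i \<le> v i \<and> {u i..v i} \<subseteq> {a..b}) \<and>
        disjoint_family_on (\<lambda>i. {u i<..<v i}) {..<n} \<and> (\<Sum>i<n. v i - u i) < \<delta> \<longrightarrow>
        (\<Sum>i<n. \<bar>F (v i) - F (u i)\<bar>) < e / 2"
      by (elim exE conjE) (rule that)
    have Nl: "N \<in> null_sets lebesgue" "N \<in> lmeasurable"
      using N negligible_iff_null_sets negligible_imp_measurable by auto
    obtain U where U: "open U" "N \<subseteq> U" "U - N \<in> lmeasurable" "emeasure lebesgue (U - N) < ennreal \<delta>"
      using sets_lebesgue_outer_open[of N \<delta>] Nl \<open>\<delta> > 0\<close> by blast
    have "(U - N) \<union> N = U" using U by blast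
    then have Um: "U \<in> lmeasurable" using fmeasurable.Un[OF U(3) Nl(2)] by simp
    have "measure lebesgue U = measure lebesgue (U - N)"
      using Nl(1) Um by (simp add: measure_Diff_null_set fmeasurableD)
    also have "\<dots> < \<delta>"
      using U(3,4) \<open>\<delta> > 0\<close> by (simp add: emeasure_eq_measure2 ennreal_less_iff)
    finally have Ud: "measure lebesgue U < \<delta>" .
    have ex: "\<exists>d>0. \<forall>s\<in>{a..b}. \<bar>s - t\<bar> < d \<longrightarrow> \<bar>F s - F t - F' t * (s - t)\<bar> \<le> e1 * \<bar>s - t\<bar>"
      if "t \<in> {a..b} - N" for t
      using D[OF that] \<open>e1 > 0\<close>
      unfolding has_field_derivative_def has_derivative_within_alt by force
    define dd where "dd t = (SOME d. d > 0 \<and> (\<forall>s\<in>{a..b}. \<bar>s - t\<bar> < d \<longrightarrow> \<bar>F s - F t - F' t * (s - t)\<bar> \<le> e1 * \<bar>s - t\<bar>))" for t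
    have dd: "dd t > 0" "\<And>s. s \<in> {a..b} \<Longrightarrow> \<bar>s - t\<bar> < dd t \<Longrightarrow> \<bar>F s - F t - F' t * (s - t)\<bar> \<le> e1 * \<bar>s - t\<bar>"
      if "t \<in> {a..b} - N" for t
      using someI_ex[OF ex[OF that]] unfolding dd_def by blast+
    define \<gamma> where "\<gamma> t = (if t \<in> N then U else if t \<in> {a..b} then ball t (dd t) else ball t 1)" for t
    have gauge: "gauge \<gamma>"
      unfolding gauge_def \<gamma>_def using U dd by auto
    have main: "norm ((\<Sum>(x,k)\<in>\<D>. measure lborel k *\<^sub>R G x) - (F b - F a)) < e"
      if \<D>: "\<D> tagged_division_of (cbox a b)" and fine: "\<gamma> fine \<D>" for \<D>
    proof -
      have fin: "finite \<D>" using \<D> by blast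
      have K: "\<exists>u v. k = {u..v} \<and> u \<le> v \<and> a \<le> u \<and> v \<le> b \<and> x \<in> {u..v} \<and> k \<subseteq> \<gamma> x" if "(x,k) \<in> \<D>" for x k
      proof -
        have ex: "\<exists>u v. k = cbox u v" using tagged_division_ofD(4)[OF \<D>] that by auto
        then obtain u v where uv: "k = cbox u v" by blast
        have "x \<in> k" "k \<subseteq> cbox a b" "k \<subseteq> \<gamma> x"
          using tagged_division_ofD(2,3)[OF \<D> that] fine that unfolding fine_def by auto
        with uv show ?thesis by auto
      qed
      define H where "H k = F (Sup k) - F (Inf k)" for k
      have tele: "(\<Sum>(x,k)\<in>\<D>. H k) = F b - F a"
        using additive_tagged_division_1[OF ab, of \<D> F] \<D> by (simp add: H_def)
      let ?A = "{p \<in> \<D>. fst p \<in> N}" and ?B = "{p \<in> \<D>. fst p \<notin> N}"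
      have split: "\<D> = ?A \<union> ?B" "?A \<inter> ?B = {}" by auto
      have "(\<Sum>(x,k)\<in>\<D>. measure lborel k *\<^sub>R G x) - (F b - F a) = (\<Sum>(x,k)\<in>\<D>. measure lborel k *\<^sub>R G x - H k)"
        by (simp add: tele[symmetric] sum_subtractf case_prod_unfold)
      also have "\<dots> = (\<Sum>(x,k)\<in>?A. measure lborel k *\<^sub>R G x - H k) + (\<Sum>(x,k)\<in>?B. measure lborel k *\<^sub>R G x - H k)"
        by (subst split(1), rule sum.union_disjoint) (use fin in auto)
      finally have eq: "(\<Sum>(x,k)\<in>\<D>. measure lborel k *\<^sub>R G x) - (F b - F a)
         = (\<Sum>(x,k)\<in>?A. measure lborel k *\<^sub>R G x - H k) + (\<Sum>(x,k)\<in>?B. measure lborel k *\<^sub>R G x - H k)" .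
      have "\<bar>\<Sum>(x,k)\<in>?B. measure lborel k *\<^sub>R G x - H k\<bar> \<le> (\<Sum>(x,k)\<in>?B. \<bar>measure lborel k *\<^sub>R G x - H k\<bar>)"
        by (simp add: case_prod_unfold sum_abs)
      also have "\<dots> \<le> (\<Sum>(x,k)\<in>?B. e1 * measure lborel k)"
      proof (rule sum_mono, clarsimp)
        fix x k assume xk: "(x,k) \<in> \<D>" "x \<notin> N"
        obtain u v where uv: "k = {u..v}" "u \<le> v" "a \<le> u" "v \<le> b" "x \<in> {u..v}" "k \<subseteq> \<gamma> x"
          using K[OF xk(1)] by blast
        have xin: "x \<in> {a..b} - N" using uv xk by auto
        have "u \<in> k" "v \<in> k" "k \<subseteq> ball x (dd x)" using uv xin by (auto simp: \<gamma>_def)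
        then have "u \<in> ball x (dd x)" "v \<in> ball x (dd x)" by blast+
        then have 1: "\<bar>F u - F x - F' x * (u - x)\<bar> \<le> e1 * \<bar>u - x\<bar>" "\<bar>F v - F x - F' x * (v - x)\<bar> \<le> e1 * \<bar>v - x\<bar>"
          using dd(2)[OF xin, of u] dd(2)[OF xin, of v] uv by (auto simp: dist_real_def abs_minus_commute)
        \<comment> \<open>Straddling: both endpoints are compared with the tag, and their distances
          to it add up to the length of the cell.\<close>
        have "measure lborel k * G x - H k = (F u - F x - F' x * (u - x)) - (F v - F x - F' x * (v - x))"
          using uv xk by (simp add: H_def G_def algebra_simps)
        moreover have "e1 * measure lborel k = e1 * \<bar>u - x\<bar> + e1 * \<bar>v - x\<bar>"
          using uv by (simp add: algebra_simps)
        ultimately show "\<bar>measure lborel k * G x - H k\<bar> \<le> e1 * measure lborel k" using 1 by linarith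
      qed
      also have "\<dots> \<le> (\<Sum>(x,k)\<in>\<D>. e1 * measure lborel k)"
        by (rule sum_mono2) (use fin \<open>e1 > 0\<close> in \<open>auto intro!: mult_nonneg_nonneg\<close>)
      also have "\<dots> = e1 * (b - a)"
        using additive_content_tagged_division[OF \<D>] ab by (simp add: sum_distrib_left[symmetric] case_prod_unfold)
      also have "\<dots> < e / 2"
      proof -
        have "e1 * (b - a) < e1 * (b - a + 1)" using \<open>e1 > 0\<close> by simp
        also have "\<dots> = e / 2" using nonzero_eq_divide_eq[of "b - a + 1" e1 "e / 2"] ab e1_def by simp
        finally show ?thesis .
      qed
      finally have B: "\<bar>\<Sum>(x,k)\<in>?B. measure lborel k *\<^sub>R G x - H k\<bar> < e / 2" .
      have "\<bar>\<Sum>(x,k)\<in>?A. measure lborel k *\<^sub>R G x - H k\<bar> \<le> (\<Sum>(x,k)\<in>?A. \<bar>measure lborel k *\<^sub>R G x - H k\<bar>)"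
        by (simp add: case_prod_unfold sum_abs)
      also have "\<dots> = (\<Sum>p\<in>?A. \<bar>H (snd p)\<bar>)"
        by (rule sum.cong) (auto simp: G_def)
      also have "\<dots> < e / 2"
      proof -
        \<comment> \<open>Absolute continuity is defined for families indexed by an initial segment
          of the naturals, so the cells tagged in \<open>N\<close> are enumerated.\<close>
        obtain en where en: "bij_betw en {..<card ?A} ?A"
          using ex_bij_betw_nat_finite[of ?A] fin by (auto simp: atLeast0LessThan)
        define u where "u i = Inf (snd (en i))" for i
        define v where "v i = Sup (snd (en i))" for i
        have enA: "en i \<in> ?A" if "i < card ?A" for i using en that by (auto simp: bij_betw_def)
        have uv: "snd (en i) = {u i..v i}" "u i \<le> v i" "a \<le> u i" "v i \<le> b" "{u i..v i} \<subseteq> U" if "i < card ?A" for i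
        proof -
          obtain x k where xk: "en i = (x,k)" by force
          have "(x,k) \<in> \<D>" "x \<in> N" using enA[OF that] xk by auto
          with K[of x k] obtain p q where "k = {p..q}" "p \<le> q" "a \<le> p" "q \<le> b" "k \<subseteq> U"
            by (auto simp: \<gamma>_def)
          with xk show "snd (en i) = {u i..v i}" "u i \<le> v i" "a \<le> u i" "v i \<le> b" "{u i..v i} \<subseteq> U"
            by (auto simp: u_def v_def)
        qed
        have disj: "disjoint_family_on (\<lambda>i. {u i<..<v i}) {..<card ?A}"
          unfolding disjoint_family_on_def
        proof (intro ballI impI)
          fix i j assume ij: "i \<in> {..<card ?A}" "j \<in> {..<card ?A}" "i \<noteq> j"
          have "en i \<noteq> en j" using ij en by (auto simp: bij_betw_def inj_on_def)
          then have "interior (snd (en i)) \<inter> interior (snd (en j)) = {}"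
            using tagged_division_ofD(5)[OF \<D>, of "fst (en i)" "snd (en i)" "fst (en j)" "snd (en j)"] enA ij
            by (auto simp: prod_eq_iff)
          then show "{u i<..<v i} \<inter> {u j<..<v j} = {}" using uv ij by (simp add: interior_atLeastAtMost_real)
        qed
        have "(\<Sum>i<card ?A. v i - u i) = (\<Sum>i<card ?A. measure lebesgue {u i<..<v i})"
          by (rule sum.cong) (use uv in auto)
        also have "\<dots> = measure lebesgue (\<Union>i<card ?A. {u i<..<v i})"

        proof (rule measure_finite_Union[symmetric])
          show "emeasure lebesgue {u i<..<v i} \<noteq> \<infinity>" for i
            using fmeasurableD2[OF lmeasurable_box[of "u i" "v i"]] by (simp add: box_real)
        qed (use disj in auto)
        also have "\<dots> \<le> measure lebesgue U"
          by (rule measure_mono_fmeasurable) (use uv Um in \<open>auto simp: subset_eq\<close>)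
        finally have "(\<Sum>i<card ?A. v i - u i) < \<delta>" using Ud by simp
        then have "(\<Sum>i<card ?A. \<bar>F (v i) - F (u i)\<bar>) < e / 2"
          by (intro \<delta>[rule_format] conjI disj) (use uv in auto)
        also have "(\<Sum>i<card ?A. \<bar>F (v i) - F (u i)\<bar>) = (\<Sum>i<card ?A. \<bar>H (snd (en i))\<bar>)"
          by (simp add: H_def u_def v_def)
        also have "\<dots> = (\<Sum>p\<in>?A. \<bar>H (snd p)\<bar>)"
          by (rule sum.reindex_bij_betw[OF en])
        finally show ?thesis .
      qed
      finally have A: "\<bar>\<Sum>(x,k)\<in>?A. measure lborel k *\<^sub>R G x - H k\<bar> < e / 2" .
      show ?thesis unfolding eq real_norm_def using A B by linarith
    qed
    show "\<exists>\<gamma>. gauge \<gamma> \<and> (\<forall>\<D>. \<D> tagged_division_of (cbox a b) \<and> \<gamma> fine \<D> \<longrightarrow>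
        norm ((\<Sum>(x,k)\<in>\<D>. measure lborel k *\<^sub>R G x) - (F b - F a)) < e)"
      by (intro exI[of _ \<gamma>] conjI allI impI gauge, elim conjE, rule main)
  qed
  then have "(G has_integral (F b - F a)) {a..b}" by simp
  then show ?thesis
    by (rule has_integral_spike[OF N, rotated]) (simp add: G_def)
qed

text \<open>Since \<open>k \<le> n + max 0 (k - n)\<close>, the increments split in two: the excess
  over a large \<open>n\<close> has small integral by dominated convergence, and the bounded part
  contributes at most \<open>n\<close> times the total length.\<close>

lemma abs_continuous_on_integral_bound:
  fixes F k :: "real \<Rightarrow> real"
  assumes k: "k absolutely_integrable_on {a..b}" and k0: "\<And>t. t \<in> {a..b} \<Longrightarrow> 0 \<le> k t"
    and F: "\<And>s t. \<lbrakk>a \<le> s; s \<le> t; t \<le> b\<rbrakk> \<Longrightarrow> \<bar>F t - F s\<bar> \<le> integral {s..t} k"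
  shows "abs_continuous_on {a..b} F"
  unfolding abs_continuous_on_def
proof (intro allI impI)
  fix e :: real assume "e > 0"
  define kB where "kB n t = max 0 (k t - real n)" for n t
  have ki: "k integrable_on {a..b}" using k by (rule set_lebesgue_integral_eq_integral)
  have kBa: "kB n absolutely_integrable_on {a..b}" for n
    unfolding kB_def
    by (intro absolutely_integrable_max_1 set_integral_diff(1) k) (auto simp: set_integrable_def lmeasurable_iff_integrable[symmetric])
  have kBi: "kB n integrable_on {a..b}" for n
    using kBa by (rule set_lebesgue_integral_eq_integral)
  have "(\<lambda>n. integral {a..b} (kB n)) \<longlonglongrightarrow> integral {a..b} (\<lambda>t. 0)"
  proof (rule dominated_convergence(2)[OF kBi ki])
    show "norm (kB n t) \<le> k t" if "t \<in> {a..b}" for n t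
      using k0[OF that] by (auto simp: kB_def)
    fix t assume "t \<in> {a..b}"
    obtain N where "k t \<le> real N" using real_arch_simple by blast
    then have "\<forall>\<^sub>F n in sequentially. kB n t = 0"
      unfolding eventually_sequentially kB_def by (intro exI[of _ N]) auto
    then show "(\<lambda>n. kB n t) \<longlonglongrightarrow> 0" by (rule tendsto_eventually)
  qed
  then have "\<forall>\<^sub>F n in sequentially. integral {a..b} (kB n) < e/2"
    using \<open>e > 0\<close> by (intro order_tendstoD) auto
  then obtain m where m: "integral {a..b} (kB m) < e/2" by (auto simp: eventually_sequentially)
  define \<delta> where "\<delta> = e / 2 / (real m + 1)"
  have "\<delta> > 0" using \<open>e > 0\<close> by (simp add: \<delta>_def)
  have "(\<Sum>i<n. \<bar>F (v i) - F (u i)\<bar>) < e"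
    if uv: "\<forall>i<n. u i \<le> v i \<and> {u i..v i} \<subseteq> {a..b}" and disj: "disjoint_family_on (\<lambda>i. {u i<..<v i}) {..<n}"
      and len: "(\<Sum>i<n. v i - u i) < \<delta>" for n :: nat and u v
  proof -
    have ab: "a \<le> u i" "u i \<le> v i" "v i \<le> b" if "i < n" for i using uv that by auto
    have sub: "g integrable_on {u i..v i}" if "i < n" "g integrable_on {a..b}" for g :: "real \<Rightarrow> real" and i
      using that uv by (meson integrable_on_subinterval)
    have "(\<Sum>i<n. \<bar>F (v i) - F (u i)\<bar>) \<le> (\<Sum>i<n. real m * (v i - u i) + integral {u i<..<v i} (kB m))"
    proof (rule sum_mono)
      fix i assume "i \<in> {..<n}"
      then have i: "i < n" by simp
      have "\<bar>F (v i) - F (u i)\<bar> \<le> integral {u i..v i} k" using F ab[OF i] by simp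
      also have "\<dots> \<le> integral {u i..v i} (\<lambda>t. real m + kB m t)"
        by (intro integral_le sub[OF i] ki integrable_add kBi) (auto simp: kB_def)
      also have "\<dots> = real m * (v i - u i) + integral {u i..v i} (kB m)"
        using ab[OF i] by (subst integral_add) (auto intro!: sub[OF i] kBi)
      also have "integral {u i..v i} (kB m) = integral {u i<..<v i} (kB m)"
        by (metis integral_open_interval_real box_real(1))
      finally show "\<bar>F (v i) - F (u i)\<bar> \<le> real m * (v i - u i) + integral {u i<..<v i} (kB m)" .
    qed
    also have "\<dots> = real m * (\<Sum>i<n. v i - u i) + (\<Sum>i<n. integral {u i<..<v i} (kB m))"
      by (simp add: sum.distrib sum_distrib_left)
    also have "(\<Sum>i<n. integral {u i<..<v i} (kB m)) = integral (\<Union>i<n. {u i<..<v i}) (kB m)"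
    proof (rule integral_unique[symmetric], rule has_integral_UN)
      show "finite {..<n}" by simp
    next
      show "(kB m has_integral integral {u i<..<v i} (kB m)) {u i<..<v i}" if "i \<in> {..<n}" for i
        using sub[of i "kB m"] kBi[of m] that integrable_on_open_interval_real[of "kB m" "u i" "v i"]
        by (auto intro!: integrable_integral)
      show "pairwise (\<lambda>i i'. negligible ({u i<..<v i} \<inter> {u i'<..<v i'})) {..<n}"
        using disj by (auto simp: disjoint_family_on_def pairwise_def)
    qed
    also have "\<dots> \<le> integral {a..b} (kB m)"
    proof (rule integral_subset_le)
      show "(\<Union>i<n. {u i<..<v i}) \<subseteq> {a..b}" using ab by fastforce
      show "kB m integrable_on (\<Union>i<n. {u i<..<v i})"
        by (rule set_lebesgue_integral_eq_integral(1), rule set_integrable_subset[OF kBa])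
           (use ab in \<open>fastforce+\<close>)
    qed (auto simp: kBi kB_def)
    also have "real m * (\<Sum>i<n. v i - u i) \<le> (real m + 1) * \<delta>"
      using len \<open>\<delta> > 0\<close> uv by (intro mult_mono) (auto intro!: sum_nonneg)
    also have "(real m + 1) * \<delta> = e / 2" by (simp add: \<delta>_def add_eq_0_iff field_simps)
    finally show ?thesis using m by linarith
  qed
  then show "\<exists>\<delta>>0. \<forall>n u v. (\<forall>i<(n::nat). u i \<le> v i \<and> {u i..v i} \<subseteq> {a..b}) \<and>
      disjoint_family_on (\<lambda>i. {u i<..<v i}) {..<n} \<and> (\<Sum>i<n. v i - u i) < \<delta> \<longrightarrow>
      (\<Sum>i<n. \<bar>F (v i) - F (u i)\<bar>) < e"
    using \<open>\<delta> > 0\<close> by blast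
qed

lemma AE_integral_has_right_derivative:
  fixes f :: "real \<Rightarrow> real"
  assumes "\<And>a b. f integrable_on {a..b}"
  obtains N where "negligible N"
    "\<And>x e. \<lbrakk>x \<notin> N; 0 < e\<rbrakk> \<Longrightarrow> \<exists>d>0. \<forall>h. 0 < h \<and> h < d \<longrightarrow> \<bar>integral {x..x+h} f - h * f x\<bar> \<le> e * h"
proof -
  obtain N where N: "negligible N" "\<And>x e. \<lbrakk>x \<notin> N; 0 < e\<rbrakk> \<Longrightarrow>
     \<exists>d>0. \<forall>h. 0 < h \<and> h < d \<longrightarrow> norm(integral (cbox x (x + h *\<^sub>R One)) f /\<^sub>R h ^ DIM(real) - f x) < e"
    using integrable_ccontinuous_explicit[of f] assms by (metis box_real(2))
  show ?thesis
  proof (rule that[OF N(1)])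
    fix x e :: real assume xe: "x \<notin> N" "0 < e"
    then obtain d where d: "d > 0" "\<And>h. 0 < h \<Longrightarrow> h < d \<Longrightarrow> \<bar>integral {x..x+h} f / h - f x\<bar> < e"
      using N(2)[OF xe] by (auto simp: divide_inverse mult.commute)
    have "\<bar>integral {x..x+h} f - h * f x\<bar> \<le> e * h" if "0 < h" "h < d" for h
    proof -
      have "integral {x..x+h} f - h * f x = h * (integral {x..x+h} f / h - f x)"
        using that by (simp add: field_simps)
      then have "\<bar>integral {x..x+h} f - h * f x\<bar> = h * \<bar>integral {x..x+h} f / h - f x\<bar>"
        using that by (simp add: abs_mult)
      then show ?thesis using d(2)[OF that] that by (simp add: mult.commute)
    qed
    then show "\<exists>d>0. \<forall>h. 0 < h \<and> h < d \<longrightarrow> \<bar>integral {x..x+h} f - h * f x\<bar> \<le> e * h"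
      using d(1) by blast
  qed
qed

text \<open>The one-sided theorem applied to \<open>g\<close> and to its reflection gives the right
  and the left derivative; the exceptional set of the reflected function has to be reflected
  back.\<close>

lemma AE_integral_has_derivative:
  fixes f :: "real \<Rightarrow> real"
  assumes f: "f absolutely_integrable_on {a..b}"
  obtains N where "negligible N"
    "\<And>x. x \<in> {a<..<b} - N \<Longrightarrow> ((\<lambda>t. integral {a..t} f) has_real_derivative f x) (at x)"
proof -
  define g where "g t = (if t \<in> {a..b} then f t else 0)" for t
  have fi: "f integrable_on {a..b}" using f by (rule set_lebesgue_integral_eq_integral)
  have "g integrable_on UNIV" unfolding g_def using fi integrable_restrict_UNIV by blast
  then have gi: "g integrable_on {p..q}" for p q
    using integrable_on_subcbox[of g UNIV p q] by simp
  have gi': "(\<lambda>t. g (- t)) integrable_on {p..q}" for p q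
    using Henstock_Kurzweil_Integration.integrable_reflect_real[where f = g and a = "-q" and b = "-p", THEN iffD2, OF gi] by simp
  obtain N1 where N1: "negligible N1" "\<And>x e. \<lbrakk>x \<notin> N1; 0 < e\<rbrakk> \<Longrightarrow>
      \<exists>d>0. \<forall>h. 0 < h \<and> h < d \<longrightarrow> \<bar>integral {x..x+h} g - h * g x\<bar> \<le> e * h"
    using AE_integral_has_right_derivative[OF gi] by blast
  obtain N2 where N2: "negligible N2" "\<And>x e. \<lbrakk>x \<notin> N2; 0 < e\<rbrakk> \<Longrightarrow>
      \<exists>d>0. \<forall>h. 0 < h \<and> h < d \<longrightarrow> \<bar>integral {x..x+h} (\<lambda>t. g (- t)) - h * g (- x)\<bar> \<le> e * h"
    using AE_integral_has_right_derivative[OF gi'] by metis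
  show ?thesis
  proof (rule that)
    show "negligible (N1 \<union> uminus ` N2)"
      using N1 N2
      by (auto intro!: negligible_Un negligible_differentiable_image_negligible derivative_intros)
    fix x assume x: "x \<in> {a<..<b} - (N1 \<union> uminus ` N2)"
    then have "x \<notin> N1" "- x \<notin> N2" by (auto simp: image_iff)
    have "((\<lambda>t. integral {a..t} g) has_derivative (\<lambda>h. g x * h)) (at x)"
      unfolding has_derivative_at_alt
    proof (intro conjI allI impI)
      show "bounded_linear (\<lambda>h. g x * h)" by (rule bounded_linear_mult_right)
      fix e :: real assume "e > 0"
      obtain d1 where d1: "d1 > 0" "\<And>h. 0 < h \<Longrightarrow> h < d1 \<Longrightarrow> \<bar>integral {x..x+h} g - h * g x\<bar> \<le> e * h"
        using N1(2)[OF \<open>x \<notin> N1\<close> \<open>e > 0\<close>] by blast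
      obtain d2 where d2: "d2 > 0" "\<And>h. 0 < h \<Longrightarrow> h < d2 \<Longrightarrow> \<bar>integral {-x..-x+h} (\<lambda>t. g (- t)) - h * g x\<bar> \<le> e * h"
        using N2(2)[OF \<open>- x \<notin> N2\<close> \<open>e > 0\<close>] by auto
      have 3: "integral {-x..-x+h} (\<lambda>t. g (- t)) = integral {x-h..x} g" for h
        using Henstock_Kurzweil_Integration.integral_reflect_real[where f = g and a = "x-h" and b = x] by simp
      define d where "d = min (min d1 d2) (min (x - a) (b - x))"
      have "d > 0" using d1 d2 x by (auto simp: d_def)
      moreover have "norm (integral {a..y} g - integral {a..x} g - g x * (y - x)) \<le> e * norm (y - x)"
        if y: "norm (y - x) < d" for y
      proof (cases "x = y")
        case False
        then consider "x < y" | "y < x" by linarith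
        then show ?thesis
        proof cases
          case 1
          have "integral {a..x} g + integral {x..y} g = integral {a..y} g"
            by (rule Henstock_Kurzweil_Integration.integral_combine) (use 1 x gi in auto)
          with d1(2)[of "y - x"] 1 y show ?thesis by (simp add: d_def algebra_simps)
        next
          case 2
          have "a < y" using y 2 by (simp add: d_def)
          have "integral {a..y} g + integral {y..x} g = integral {a..x} g"
            by (rule Henstock_Kurzweil_Integration.integral_combine) (use 2 \<open>a < y\<close> gi in auto)
          moreover have "\<bar>integral {y..x} g - (x - y) * g x\<bar> \<le> e * (x - y)"
            using d2(2)[of "x - y"] 2 y unfolding 3 by (simp add: d_def)
          ultimately show ?thesis using 2 by (simp add: abs_le_iff algebra_simps)
        qed
      qed simp
      ultimately show "\<exists>d>0. \<forall>y. norm (y - x) < d \<longrightarrow>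
          norm (integral {a..y} g - integral {a..x} g - g x * (y - x)) \<le> e * norm (y - x)"
        by blast
    qed
    then have "((\<lambda>t. integral {a..t} g) has_real_derivative f x) (at x)"
      using x by (auto simp: has_field_derivative_def g_def)
    then show "((\<lambda>t. integral {a..t} f) has_real_derivative f x) (at x)"
    proof (rule DERIV_cong_ev[THEN iffD1, rotated -1, OF _ refl _ refl])
      have "\<forall>\<^sub>F t in nhds x. t < b"
        using x by (auto intro!: order_tendstoD(2)[OF filterlim_ident])
      then show "\<forall>\<^sub>F t in nhds x. integral {a..t} g = integral {a..t} f"
        by eventually_elim (auto simp: g_def intro!: integral_cong)
    qed
  qed
qed

section \<open>Superposition operators acting on continuous functions\<close>

text \<open>Rounding to a grid makes a function countably valued. Superpositions are handled by
  rounding values, the delayed feedback by rounding time.\<close>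

lemma floor_grid_tendsto:
  fixes t :: real
  shows "(\<lambda>k. of_int \<lfloor>real (Suc k) * t\<rfloor> / real (Suc k)) \<longlonglongrightarrow> t"
proof (rule real_tendsto_sandwich)
  let ?t = "\<lambda>k. of_int \<lfloor>real (Suc k) * t\<rfloor> / real (Suc k)"
  have "t - 1 / real (Suc k) \<le> ?t k \<and> ?t k \<le> t" for k
  proof -
    have "t - 1 / real (Suc k) = (real (Suc k) * t - 1) / real (Suc k)"
      by (simp add: diff_divide_distrib del: of_nat_Suc)
    moreover have "t = real (Suc k) * t / real (Suc k)" by (simp del: of_nat_Suc)
    moreover have "real (Suc k) * t - 1 \<le> of_int \<lfloor>real (Suc k) * t\<rfloor>"
      "of_int \<lfloor>real (Suc k) * t\<rfloor> \<le> real (Suc k) * t" by linarith+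
    ultimately show ?thesis by (metis divide_right_mono of_nat_0_le_iff)
  qed
  then show "\<forall>\<^sub>F k in sequentially. t - 1 / real (Suc k) \<le> ?t k"
    "\<forall>\<^sub>F k in sequentially. ?t k \<le> t" by auto
  have "(\<lambda>k. 1 / real (Suc k)) \<longlonglongrightarrow> 0" using LIMSEQ_inverse_real_of_nat by (simp add: inverse_eq_divide)
  then show "(\<lambda>k. t - 1 / real (Suc k)) \<longlonglongrightarrow> t" by (auto intro: tendsto_eq_intros)
qed simp

text \<open>After rounding \<open>u\<close>, each of its countably many values is a fixed second
  argument of \<open>g\<close>; continuity in that argument recovers \<open>u\<close> in the
  limit.\<close>

lemma borel_measurable_superposition:
  fixes g :: "real \<Rightarrow> real \<Rightarrow> real"
  assumes g: "\<And>u. (\<lambda>s. g s u) \<in> borel_measurable M" and cont: "\<And>s. continuous_on UNIV (g s)"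
    and u: "u \<in> borel_measurable M"
  shows "(\<lambda>s. g s (u s)) \<in> borel_measurable M"
proof (rule borel_measurable_LIMSEQ_real)
  let ?u = "\<lambda>k s. of_int \<lfloor>real (Suc k) * u s\<rfloor> / real (Suc k)"
  have lim: "(\<lambda>k. ?u k s) \<longlonglongrightarrow> u s" for s by (rule floor_grid_tendsto)
  show "(\<lambda>k. g s (?u k s)) \<longlonglongrightarrow> g s (u s)" for s
    using cont[of s] lim[of s] by (auto simp: continuous_on_eq_continuous_at intro: isCont_tendsto_compose)
  show "(\<lambda>s. g s (?u k s)) \<in> borel_measurable M" for k
    by (rule measurable_compose_countable[where f = "\<lambda>i s. g s (of_int i / real (Suc k))" and g = "\<lambda>s. \<lfloor>real (Suc k) * u s\<rfloor>"])
       (use g u in measurable)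
qed

section \<open>Continuous approximation and gluing\<close>

lemma continuous_imp_lebesgue: "continuous_on UNIV w \<Longrightarrow> w \<in> borel_measurable lebesgue"
  for w :: "real \<Rightarrow> real"
  by (simp add: borel_measurable_continuous_onI measurable_completion)

text \<open>Continuous functions converging almost everywhere to \<open>u - c\<close> are clamped to
  \<open>[-d, d]\<close> and multiplied by a cutoff that tends to 1 inside \<open>J\<close>. The
  condition \<open>J \<noteq> UNIV\<close> matters: \<open>infdist\<close> to the empty set is 0,
  and the cutoff would vanish identically.\<close>

lemma continuous_approximation:
  fixes u :: "real \<Rightarrow> real"
  assumes J: "open J" "J \<noteq> UNIV" and u: "u \<in> borel_measurable lebesgue"
    and d: "0 \<le> d" and uc: "\<And>s. s \<in> J \<Longrightarrow> \<bar>u s - c\<bar> \<le> d"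
  obtains v :: "nat \<Rightarrow> real \<Rightarrow> real" and N where "negligible N" "\<And>n. continuous_on UNIV (v n)"
    "\<And>n s. \<bar>v n s\<bar> \<le> d" "\<And>n s. s \<notin> J \<Longrightarrow> v n s = 0"
    "\<And>s. s \<in> J - N \<Longrightarrow> (\<lambda>n. c + v n s) \<longlonglongrightarrow> u s"
proof -
  have "(\<lambda>s. u s - c) measurable_on UNIV"
    using u by (simp add: measurable_on_iff_borel_measurable)
  then obtain N G where N: "negligible N" and G: "\<And>n. continuous_on UNIV (G n)"
    and lim: "\<And>s. s \<notin> N \<Longrightarrow> (\<lambda>n. G n s) \<longlonglongrightarrow> u s - c"
    unfolding measurable_on_def by auto
  define v where "v n s = min 1 (real n * infdist s (- J)) * max (- d) (min d (G n s))" for n :: nat and s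
  have clamp: "\<bar>max (- d) (min d x)\<bar> \<le> d" for x using d by auto
  show thesis
  proof (rule that[OF N, of v])
    show "continuous_on UNIV (v n)" for n
      unfolding v_def by (intro continuous_intros G)
    show "\<bar>v n s\<bar> \<le> d" for n s
    proof -
      have "\<bar>v n s\<bar> = min 1 (real n * infdist s (- J)) * \<bar>max (- d) (min d (G n s))\<bar>"
        by (simp add: v_def abs_mult infdist_nonneg)
      also have "\<dots> \<le> 1 * d" by (intro mult_mono clamp) (auto simp: infdist_nonneg)
      finally show ?thesis by simp
    qed
    show "v n s = 0" if "s \<notin> J" for n s using that by (simp add: v_def)
    show "(\<lambda>n. c + v n s) \<longlonglongrightarrow> u s" if s: "s \<in> J - N" for s
    proof -
      have "infdist s (- J) > 0"
        using J s by (intro infdist_pos_not_in_closed) auto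
      then obtain n0 where n0: "1 < real n0 * infdist s (- J)" using reals_Archimedean3 by blast
      have "\<forall>\<^sub>F n in sequentially. min 1 (real n * infdist s (- J)) = 1"
        unfolding eventually_sequentially
      proof (intro exI[of _ n0] allI impI)
        fix n assume "n0 \<le> n"
        then have "real n0 * infdist s (- J) \<le> real n * infdist s (- J)"
          by (intro mult_right_mono) (auto simp: infdist_nonneg)
        then show "min 1 (real n * infdist s (- J)) = 1" using n0 by simp
      qed
      then have "(\<lambda>n. min 1 (real n * infdist s (- J))) \<longlonglongrightarrow> 1" by (rule tendsto_eventually)
      then have "(\<lambda>n. c + v n s) \<longlonglongrightarrow> c + 1 * max (- d) (min d (u s - c))"
        unfolding v_def using s by (intro tendsto_intros lim) auto
      moreover have "max (- d) (min d (u s - c)) = u s - c" using uc[of s] s by (auto simp: abs_le_iff)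
      ultimately show ?thesis by simp
    qed
  qed
qed

text \<open>At each point at most one \<open>v k\<close> is nonzero, and it is bounded by
  \<open>d k\<close>. The partial sums therefore converge uniformly, which gives continuity even
  where the sets \<open>J k\<close> accumulate.\<close>

lemma continuous_glue_disjoint:
  fixes v :: "nat \<Rightarrow> real \<Rightarrow> real"
  assumes cont: "\<And>k. continuous_on UNIV (v k)" and supp: "\<And>k s. s \<notin> J k \<Longrightarrow> v k s = 0"
    and disj: "\<And>j k s. s \<in> J j \<Longrightarrow> s \<in> J k \<Longrightarrow> j = k"
    and bound: "\<And>k s. \<bar>v k s\<bar> \<le> d k" and d: "d \<longlonglongrightarrow> 0"
  obtains V where "continuous_on UNIV V" "\<And>k s. s \<in> J k \<Longrightarrow> V s = v k s"
    "\<And>s. (\<And>k. s \<notin> J k) \<Longrightarrow> V s = 0"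
proof -
  define V where "V s = (if \<exists>k. s \<in> J k then v (THE k. s \<in> J k) s else 0)" for s
  have V: "V s = v k s" if "s \<in> J k" for s k
  proof -
    have "(THE k. s \<in> J k) = k" by (rule the_equality) (use that disj in blast)+
    then show ?thesis using that by (auto simp: V_def)
  qed
  have "uniform_limit UNIV (\<lambda>n s. \<Sum>k<n. v k s) V sequentially"
    unfolding uniform_limit_iff
  proof (intro allI impI)
    fix e :: real assume "e > 0"
    then obtain N where N: "\<And>k. k \<ge> N \<Longrightarrow> d k < e"
      using order_tendstoD(2)[OF d \<open>e > 0\<close>] by (auto simp: eventually_sequentially)
    have "dist (\<Sum>k<n. v k s) (V s) < e" if "n \<ge> N" for n s
    proof (cases "\<exists>k. s \<in> J k")
      case False
      then show ?thesis using supp \<open>e > 0\<close> by (simp add: V_def)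
    next
      case True
      then obtain k where k: "s \<in> J k" by blast
      have z: "v j s = 0" if "j \<noteq> k" for j using supp disj k that by blast
      have "(\<Sum>j<n. v j s) = (\<Sum>j<n. if j = k then v k s else 0)"
        using z by (intro sum.cong) auto
      then have "(\<Sum>j<n. v j s) = (if k < n then v k s else 0)" by simp
      then show ?thesis
        using V[OF k] bound[of k s] N[of k] \<open>e > 0\<close> that by (auto simp: dist_real_def)
    qed
    then show "\<forall>\<^sub>F n in sequentially. \<forall>s\<in>UNIV. dist (\<Sum>k<n. v k s) (V s) < e"
      by (auto simp: eventually_sequentially)
  qed
  then have "continuous_on UNIV V"
    by (rule uniform_limit_theorem[rotated]) (auto intro!: always_eventually continuous_intros cont)
  then show thesis by (rule that) (simp_all add: V, simp add: V_def)
qed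

text \<open>\<open>g\<close> maps continuous functions to locally integrable ones. Such a superposition operator is
  automatically dominated, locally in both variables, by an integrable function.\<close>

locale integrable_superposition =
  fixes g :: "real \<Rightarrow> real \<Rightarrow> real"
  assumes g_meas: "\<And>u. (\<lambda>s. g s u) \<in> borel_measurable lebesgue"
    and g_cont: "\<And>s. continuous_on UNIV (g s)"
    and g_int: "\<And>w T. continuous_on UNIV w \<Longrightarrow>
      (\<integral>\<^sup>+ s. ennreal \<bar>g s (w s)\<bar> * indicator {-T..T} s \<partial>lebesgue) < \<infinity>"
begin

section \<open>Local majorants of a superposition operator\<close>

lemma g_isCont: "isCont (g s) u"
  using g_cont[of s] by (simp add: continuous_on_eq_continuous_at)

lemma g_tendsto: "(\<lambda>n. x n) \<longlonglongrightarrow> u \<Longrightarrow> (\<lambda>n. g s (x n)) \<longlonglongrightarrow> g s u"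
  using g_isCont by (rule isCont_tendsto_compose)

lemma g_superposition: "u \<in> borel_measurable lebesgue \<Longrightarrow> (\<lambda>s. g s (u s)) \<in> borel_measurable lebesgue"
  by (rule borel_measurable_superposition[OF g_meas g_cont])

text \<open>The restriction to rational arguments makes this a countable, hence measurable,
  supremum; by continuity of \<open>g s\<close> it still dominates all real arguments in the open
  ball.\<close>

definition local_sup :: "real \<Rightarrow> real \<Rightarrow> real \<Rightarrow> ennreal" where
  "local_sup u \<delta> s = (SUP r\<in>{r \<in> \<rat>. \<bar>r - u\<bar> < \<delta>}. ennreal \<bar>g s r\<bar>)"

lemma local_sup_measurable: "local_sup u \<delta> \<in> borel_measurable lebesgue"
  unfolding local_sup_def using g_meas
  by (intro borel_measurable_SUP countable_subset[OF _ countable_rat]) auto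

lemma local_sup_ge:
  assumes "\<bar>v - u\<bar> < \<delta>"
  shows "ennreal \<bar>g s v\<bar> \<le> local_sup u \<delta> s"
proof (rule ccontr)
  assume "\<not> ennreal \<bar>g s v\<bar> \<le> local_sup u \<delta> s"
  then have lt: "local_sup u \<delta> s < ennreal \<bar>g s v\<bar>" by simp
  have "((\<lambda>r. ennreal \<bar>g s r\<bar>) \<longlongrightarrow> ennreal \<bar>g s v\<bar>) (at v)"
    using g_isCont[where s = s and u = v] unfolding isCont_def by (intro tendsto_ennrealI tendsto_rabs)
  then have "\<forall>\<^sub>F r in at v. local_sup u \<delta> s < ennreal \<bar>g s r\<bar>"
    using lt by (rule order_tendstoD)
  then obtain e where e: "e > 0" "\<And>r. r \<noteq> v \<Longrightarrow> dist r v < e \<Longrightarrow> local_sup u \<delta> s < ennreal \<bar>g s r\<bar>"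
    by (auto simp: eventually_at)
  have "v < min (v + e) (u + \<delta>)" using e assms by auto
  then obtain r where r: "r \<in> \<rat>" "v < r" "r < min (v + e) (u + \<delta>)" using Rats_dense_in_real by blast
  then have "\<bar>r - u\<bar> < \<delta>" using assms by auto
  then have "ennreal \<bar>g s r\<bar> \<le> local_sup u \<delta> s"
    unfolding local_sup_def using r by (intro SUP_upper) auto
  moreover have "local_sup u \<delta> s < ennreal \<bar>g s r\<bar>" using r by (intro e(2)) (auto simp: dist_real_def)
  ultimately show False by simp
qed

lemma local_sup_finite: "local_sup u \<delta> s < \<infinity>"
proof -
  have "compact ((\<lambda>v. g s v) ` {u-\<delta>..u+\<delta>})"
    by (intro compact_continuous_image continuous_on_subset[OF g_cont]) auto
  then obtain B where B: "\<And>v. v \<in> {u-\<delta>..u+\<delta>} \<Longrightarrow> \<bar>g s v\<bar> \<le> B"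
    using compact_imp_bounded by (force simp: bounded_iff)
  have "local_sup u \<delta> s \<le> ennreal B"
    unfolding local_sup_def by (intro SUP_least ennreal_leI B) (auto simp: abs_if split: if_splits)
  then show ?thesis by (simp add: le_less_trans)
qed

text \<open>A measurable selector: among \<open>q 0\<close>, ..., \<open>q n\<close> it picks an
  argument where the absolute value of \<open>g s\<close> is largest, so along an enumeration its
  values exhaust the local supremum.\<close>

primrec greedy :: "(nat \<Rightarrow> real) \<Rightarrow> nat \<Rightarrow> real \<Rightarrow> real" where
  "greedy q 0 s = q 0"
| "greedy q (Suc n) s = (if \<bar>g s (greedy q n s)\<bar> < \<bar>g s (q (Suc n))\<bar> then q (Suc n) else greedy q n s)"

lemma greedy_measurable: "greedy q n \<in> borel_measurable lebesgue"
proof (induction n)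
  case (Suc n)
  have "{s \<in> space lebesgue. \<bar>g s (greedy q n s)\<bar> < \<bar>g s (q (Suc n))\<bar>} \<in> sets lebesgue"
    using g_superposition[OF Suc] g_meas[of "q (Suc n)"] by measurable
  then show ?case
    unfolding greedy.simps using Suc by (intro measurable_If) auto
qed simp

lemma greedy_in: "greedy q n s \<in> range q"
  by (induction n) auto

lemma greedy_ge: "i \<le> n \<Longrightarrow> \<bar>g s (q i)\<bar> \<le> \<bar>g s (greedy q n s)\<bar>"
  by (induction n) (auto simp: le_Suc_eq)

lemma greedy_mono: "m \<le> n \<Longrightarrow> \<bar>g s (greedy q m s)\<bar> \<le> \<bar>g s (greedy q n s)\<bar>"
  by (induction n) (auto simp: le_Suc_eq)

text \<open>The annulus stays at distance \<open>\<zeta>\<close> from \<open>s0\<close>, which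
  leaves room for the next, smaller hump. The height is at most the outer radius, so humps on
  shrinking annuli tend to 0 uniformly.\<close>

definition hump :: "real \<Rightarrow> real \<Rightarrow> real \<times> real \<times> (real \<Rightarrow> real) \<Rightarrow> bool" where
  "hump s0 u0 = (\<lambda>(\<eta>, \<zeta>, v). 0 < \<zeta> \<and> \<zeta> < \<eta> \<and> continuous_on UNIV v \<and> (\<forall>s. \<bar>v s\<bar> \<le> \<eta>) \<and>
     (\<forall>s. \<not> (\<zeta> < \<bar>s - s0\<bar> \<and> \<bar>s - s0\<bar> < \<eta>) \<longrightarrow> v s = 0) \<and>
     1 \<le> (\<integral>\<^sup>+ s. ennreal \<bar>g s (u0 + v s)\<bar> * indicator {s. \<zeta> < \<bar>s - s0\<bar> \<and> \<bar>s - s0\<bar> < \<eta>} s \<partial>lebesgue))"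

text \<open>By monotone convergence the infinite mass of the local supremum is exhausted by greedy
  selectors on growing annuli, so one of them has mass above 1. Continuous approximations of this
  selector eventually keep the mass above 1 by Fatou; dominated convergence is out of reach, since
  the majorant is what is being sought.\<close>

lemma ex_hump:
  assumes bad: "\<And>\<delta>. \<delta> > 0 \<Longrightarrow> (\<integral>\<^sup>+ s. local_sup u0 \<delta> s * indicator {s0-\<delta>..s0+\<delta>} s \<partial>lebesgue) = \<infinity>"
    and \<eta>: "0 < \<eta>"
  shows "\<exists>\<zeta> v. hump s0 u0 (\<eta>, \<zeta>, v)"
proof -
  \<comment> \<open>Half of the radius keeps the selected arguments within \<open>\<eta>\<close> of
    \<open>u0\<close> and the closed interval around \<open>s0\<close> inside the outer
    radius.\<close>
  define \<delta> where "\<delta> = \<eta> / 2"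
  define R where "R = {r \<in> \<rat>. \<bar>r - u0\<bar> < \<delta>}"
  have "R \<noteq> {}" "countable R"
    using Rats_dense_in_real[of u0 "u0 + \<delta>"] \<eta> countable_subset[OF _ countable_rat, of R]
    by (force simp: R_def \<delta>_def)+
  then obtain q :: "nat \<Rightarrow> real" where q: "range q = R" by (metis range_from_nat_into)
  \<comment> \<open>Inner radii decreasing to 0; the summand 2 keeps already \<open>a 0\<close>
    below \<open>\<eta>\<close>. The annuli exhaust the punctured interval, and the missing point
    \<open>s0\<close> is a null set.\<close>
  define a where "a n = \<eta> / (real n + 2)" for n
  have a: "0 < a n" "a n < \<eta>" for n using \<eta> by (auto simp: a_def pos_divide_less_eq algebra_simps add_pos_nonneg)
  have adec: "a n \<le> a m" if "m \<le> n" for m n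
    unfolding a_def using \<eta> that by (intro divide_left_mono) auto
  define J where "J n = {s. a n < \<bar>s - s0\<bar> \<and> \<bar>s - s0\<bar> < \<eta>}" for n
  have Jop: "open (J n)" for n unfolding J_def by (intro open_Collect_conj open_Collect_less continuous_intros)
  then have Jm: "J n \<in> sets lebesgue" for n by simp
  define H where "H n s = ennreal \<bar>g s (greedy q n s)\<bar> * indicator (J n) s" for n s
  have Hm: "H n \<in> borel_measurable lebesgue" for n
    unfolding H_def using g_superposition[OF greedy_measurable[of q n]] Jm by measurable
  have Hinc: "incseq H"
    unfolding H_def
  proof (intro incseq_SucI le_funI mult_mono ennreal_leI greedy_mono)
    show "indicator (J n) s \<le> (indicator (J (Suc n)) s :: ennreal)" for n s
      using adec[of n "Suc n"] by (auto simp: J_def indicator_def)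
  qed auto
  have "(\<integral>\<^sup>+ s. local_sup u0 \<delta> s * indicator {s0-\<delta>..s0+\<delta>} s \<partial>lebesgue) \<le> (\<integral>\<^sup>+ s. (SUP n. H n s) \<partial>lebesgue)"
  proof (rule nn_integral_mono_AE)
    have "AE s in lebesgue. s \<noteq> s0" by (rule AE_completion[OF AE_lborel_singleton])
    then show "AE s in lebesgue. local_sup u0 \<delta> s * indicator {s0-\<delta>..s0+\<delta>} s \<le> (SUP n. H n s)"
    proof (eventually_elim)
      fix s assume s: "s \<noteq> s0"
      show "local_sup u0 \<delta> s * indicator {s0-\<delta>..s0+\<delta>} s \<le> (SUP n. H n s)"
      proof (cases "s \<in> {s0-\<delta>..s0+\<delta>}")
        case True
        have "\<eta> > 0" "\<bar>s - s0\<bar> < \<eta>" "0 < \<bar>s - s0\<bar>" using True \<eta> s by (auto simp: \<delta>_def)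
        obtain k where k: "\<eta> < real k * \<bar>s - s0\<bar>" using reals_Archimedean3 \<open>0 < \<bar>s - s0\<bar>\<close> by blast
        have "a k < \<bar>s - s0\<bar>"
        proof -
          have "real k * \<bar>s - s0\<bar> \<le> (real k + 2) * \<bar>s - s0\<bar>" by (intro mult_right_mono) auto
          then have "\<eta> < (real k + 2) * \<bar>s - s0\<bar>" using k by linarith
          then show ?thesis by (simp add: a_def pos_divide_less_eq mult.commute)
        qed
        have "ennreal \<bar>g s r\<bar> \<le> (SUP n. H n s)" if "r \<in> R" for r
        proof -
          have "r \<in> range q" using that q by simp
          then obtain i where i: "r = q i" by blast
          have "s \<in> J (max i k)"
            using \<open>a k < \<bar>s - s0\<bar>\<close> adec[of k "max i k"] \<open>\<bar>s - s0\<bar> < \<eta>\<close> by (auto simp: J_def)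
          then have "ennreal \<bar>g s r\<bar> \<le> H (max i k) s"
            unfolding H_def i using greedy_ge[of i "max i k" s q] by (auto intro: ennreal_leI)
          also have "\<dots> \<le> (SUP n. H n s)" by (rule SUP_upper) simp
          finally show ?thesis .
        qed
        then have "local_sup u0 \<delta> s \<le> (SUP n. H n s)"
          unfolding local_sup_def R_def[symmetric] by (rule SUP_least)
        then show ?thesis using True by simp
      qed simp
    qed
  qed
  then have "(\<integral>\<^sup>+ s. (SUP n. H n s) \<partial>lebesgue) = \<infinity>"
    using bad[of \<delta>] \<eta> by (simp add: \<delta>_def top_unique)
  then have "(SUP n. integral\<^sup>N lebesgue (H n)) = \<infinity>"
    using nn_integral_monotone_convergence_SUP[OF Hinc Hm] by simp
  then have "1 < (SUP n. integral\<^sup>N lebesgue (H n))"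
    using ennreal_one_less_top by (simp only: infinity_ennreal_def)
  then obtain n where n: "1 < integral\<^sup>N lebesgue (H n)" by (auto simp: less_SUP_iff)
  have gr: "\<bar>greedy q n s - u0\<bar> \<le> \<eta>" for s
    using greedy_in[of q n s] q \<eta> by (force simp: R_def \<delta>_def)
  have JU: "J n \<noteq> UNIV"
  proof
    assume "J n = UNIV"
    then have "s0 \<in> J n" by simp
    then show False using a[of n] by (simp add: J_def)
  qed
  have "0 \<le> \<eta>" using \<eta> by simp
  obtain v N where v: "negligible N" "\<And>j. continuous_on UNIV (v j)" "\<And>j s. \<bar>v j s\<bar> \<le> \<eta>" "\<And>j s. s \<notin> J n \<Longrightarrow> v j s = 0"
    "\<And>s. s \<in> J n - N \<Longrightarrow> (\<lambda>j. u0 + v j s) \<longlonglongrightarrow> greedy q n s"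
    by (rule continuous_approximation[OF Jop JU greedy_measurable \<open>0 \<le> \<eta>\<close> gr], rule that, assumption+)
  define K where "K j s = ennreal \<bar>g s (u0 + v j s)\<bar> * indicator (J n) s" for j :: nat and s
  have Km: "K j \<in> borel_measurable lebesgue" for j
  proof -
    have "(\<lambda>s. g s (u0 + v j s)) \<in> borel_measurable lebesgue"
      by (intro g_superposition continuous_imp_lebesgue continuous_intros v)
    then show ?thesis unfolding K_def using Jm[of n] by measurable
  qed
  have "AE s in lebesgue. s \<notin> N" using v(1) by (simp add: AE_not_in negligible_iff_null_sets)
  then have "AE s in lebesgue. H n s = liminf (\<lambda>j. K j s)"
  proof (eventually_elim)
    fix s assume "s \<notin> N"
    have "(\<lambda>j. K j s) \<longlonglongrightarrow> H n s"
    proof (cases "s \<in> J n")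
      case True
      then have "(\<lambda>j. g s (u0 + v j s)) \<longlonglongrightarrow> g s (greedy q n s)" using \<open>s \<notin> N\<close> by (intro g_tendsto v) auto
      then show ?thesis using True by (auto simp: K_def H_def intro!: tendsto_ennrealI tendsto_rabs)
    qed (simp add: K_def H_def)
    then show "H n s = liminf (\<lambda>j. K j s)" by (simp add: lim_imp_Liminf)
  qed
  then have "integral\<^sup>N lebesgue (H n) = (\<integral>\<^sup>+ s. liminf (\<lambda>j. K j s) \<partial>lebesgue)"
    by (rule nn_integral_cong_AE)
  also have "\<dots> \<le> liminf (\<lambda>j. integral\<^sup>N lebesgue (K j))" by (rule nn_integral_liminf[OF Km])
  finally have "\<forall>\<^sub>F j in sequentially. 1 < integral\<^sup>N lebesgue (K j)"
    using n by (intro less_LiminfD) simp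
  then obtain j where j: "1 < integral\<^sup>N lebesgue (K j)" by (auto simp: eventually_sequentially)
  have "hump s0 u0 (\<eta>, a n, v j)"
    unfolding hump_def prod.case J_def[symmetric]
    using a[of n] v(2,3) v(4)[unfolded J_def] less_imp_le[OF j, unfolded K_def] by blast
  then show ?thesis by blast
qed

text \<open>Gliding hump: otherwise humps of mass at least 1 on disjoint annuli shrinking to \<open>s0\<close> would add up
  to a continuous function whose image under \<open>g\<close> is not integrable.\<close>

lemma ex_local_bound:
  "\<exists>\<delta>>0. (\<integral>\<^sup>+ s. local_sup u0 \<delta> s * indicator {s0-\<delta>..s0+\<delta>} s \<partial>lebesgue) < \<infinity>"
proof (rule ccontr)
  assume "\<not> ?thesis"
  then have bad: "\<And>\<delta>. \<delta> > 0 \<Longrightarrow> (\<integral>\<^sup>+ s. local_sup u0 \<delta> s * indicator {s0-\<delta>..s0+\<delta>} s \<partial>lebesgue) = \<infinity>"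
    by (metis infinity_ennreal_def top.not_eq_extremum)
  \<comment> \<open>The powers of 1/2 force the heights to tend to 0, as the continuity of the glued
    function at \<open>s0\<close> requires. Each outer radius is chosen below the previous inner
    one, so the annuli are disjoint.\<close>
  define P where "P n x \<longleftrightarrow> hump s0 u0 x \<and> fst x \<le> (1/2) ^ n" for n :: nat and x
  have "\<exists>F. \<forall>n. P n (F n) \<and> fst (F (Suc n)) \<le> fst (snd (F n))"
  proof (rule dependent_nat_choice)
    show "\<exists>x. P 0 x" using ex_hump[OF bad, of 1] unfolding P_def by auto
    fix x n assume "P n x"
    then obtain \<eta> \<zeta> v where x: "x = (\<eta>, \<zeta>, v)" "0 < \<zeta>" by (auto simp: P_def hump_def split: prod.splits)
    define \<eta>' where "\<eta>' = min \<zeta> ((1/2) ^ Suc n)"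
    have "0 < \<eta>'" using x by (simp add: \<eta>'_def)
    from ex_hump[OF bad this] obtain \<zeta>' v' where "hump s0 u0 (\<eta>', \<zeta>', v')" by blast
    then show "\<exists>y. P (Suc n) y \<and> fst y \<le> fst (snd x)"
      by (intro exI[of _ "(\<eta>', \<zeta>', v')"]) (auto simp: P_def x \<eta>'_def)
  qed
  then obtain F where F: "\<And>n. P n (F n)" "\<And>n. fst (F (Suc n)) \<le> fst (snd (F n))" by blast
  define \<eta> where "\<eta> n = fst (F n)" for n
  define \<zeta> where "\<zeta> n = fst (snd (F n))" for n
  define v where "v n = snd (snd (F n))" for n
  define J where "J n = {s. \<zeta> n < \<bar>s - s0\<bar> \<and> \<bar>s - s0\<bar> < \<eta> n}" for n
  have "F n = (\<eta> n, \<zeta> n, v n)" for n by (simp add: \<eta>_def \<zeta>_def v_def)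
  then have h: "0 < \<zeta> n" "\<zeta> n < \<eta> n" "continuous_on UNIV (v n)" "\<bar>v n s\<bar> \<le> \<eta> n" "s \<notin> J n \<Longrightarrow> v n s = 0"
     "1 \<le> (\<integral>\<^sup>+ s. ennreal \<bar>g s (u0 + v n s)\<bar> * indicator (J n) s \<partial>lebesgue)" "\<eta> n \<le> (1/2) ^ n" for n s
    using F(1)[of n] by (auto simp: P_def hump_def J_def)
  have step: "\<eta> (Suc n) \<le> \<zeta> n" for n using F(2) by (simp add: \<eta>_def \<zeta>_def)
  have \<eta>dec: "\<eta> n \<le> \<eta> m" if "m \<le> n" for m n
    using that by (rule lift_Suc_antimono_le[rotated]) (meson step h(2) less_imp_le order_trans)
  have disj: "j = k" if "s \<in> J j" "s \<in> J k" for j k s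
  proof (rule ccontr)
    assume "j \<noteq> k"
    have *: False if "j < k" "s \<in> J j" "s \<in> J k" for j k
      using \<eta>dec[of "Suc j" k] step[of j] that by (auto simp: J_def)
    show False using *[of j k] *[of k j] that \<open>j \<noteq> k\<close> by (meson nat_neq_iff)
  qed
  have b: "\<bar>v k s\<bar> \<le> (1/2) ^ k" for k s using h(4)[of k s] h(7)[of k] by linarith
  obtain V where V: "continuous_on UNIV V" "\<And>k s. s \<in> J k \<Longrightarrow> V s = v k s"
    by (rule continuous_glue_disjoint[OF h(3) h(5) disj b]) (auto intro: LIMSEQ_realpow_zero)
  \<comment> \<open>All outer radii are at most 1, so \<open>{-T..T}\<close> contains every
    annulus.\<close>
  define T where "T = \<bar>s0\<bar> + 1"
  define I where "I = (\<integral>\<^sup>+ s. ennreal \<bar>g s (u0 + V s)\<bar> * indicator {-T..T} s \<partial>lebesgue)"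
  have "of_nat n \<le> I" for n
  proof -
    have Jm: "J k \<in> sets lebesgue" for k
    proof -
      have "open (J k)" unfolding J_def by (intro open_Collect_conj open_Collect_less continuous_intros)
      then show ?thesis by simp
    qed
    have gm: "(\<lambda>s. g s (u0 + v k s)) \<in> borel_measurable lebesgue" for k
      by (intro g_superposition continuous_imp_lebesgue continuous_intros h)
    have "of_nat n = (\<Sum>k<n. 1 :: ennreal)" by simp
    also have "\<dots> \<le> (\<Sum>k<n. \<integral>\<^sup>+ s. ennreal \<bar>g s (u0 + v k s)\<bar> * indicator (J k) s \<partial>lebesgue)"
      by (intro sum_mono h)
    also have "\<dots> = (\<integral>\<^sup>+ s. (\<Sum>k<n. ennreal \<bar>g s (u0 + v k s)\<bar> * indicator (J k) s) \<partial>lebesgue)"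
      by (rule nn_integral_sum[symmetric]) (use gm Jm in measurable)
    also have "\<dots> \<le> I"
      unfolding I_def
    proof (rule nn_integral_mono)
      fix s
      show "(\<Sum>k<n. ennreal \<bar>g s (u0 + v k s)\<bar> * indicator (J k) s) \<le> ennreal \<bar>g s (u0 + V s)\<bar> * indicator {-T..T} s"
      proof (cases "\<exists>k<n. s \<in> J k")
        case True
        then obtain k where k: "k < n" "s \<in> J k" by blast
        have "(\<Sum>j<n. ennreal \<bar>g s (u0 + v j s)\<bar> * indicator (J j) s) = (\<Sum>j<n. if j = k then ennreal \<bar>g s (u0 + v k s)\<bar> else 0)"
          using disj k by (intro sum.cong) (auto simp: indicator_def)
        also have "\<dots> = ennreal \<bar>g s (u0 + V s)\<bar>" using k V(2) by simp
        also have "s \<in> {-T..T}"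
        proof -
          have "(1/2::real) ^ k \<le> 1" by (rule power_le_one) auto
          then have "\<bar>s - s0\<bar> < 1" using k h(7)[of k] by (simp add: J_def)
          then show ?thesis by (auto simp: T_def abs_if split: if_splits)
        qed
        ultimately show ?thesis by simp
      next
        case False
        then show ?thesis by (simp add: indicator_def)
      qed
    qed
    finally show ?thesis .
  qed
  moreover have "I < \<infinity>" unfolding I_def by (intro g_int continuous_intros V)
  ultimately show False
    using ennreal_Ex_less_of_nat[of I] by (metis infinity_ennreal_def leD)
qed

text \<open>Compactness of the rectangle reduces the majorant to a finite sum of local suprema with
  finite integrals. Each of them is finite everywhere, so the sum can be taken back to the reals
  without an exceptional set.\<close>

proposition integrable_domination:
  obtains m where "integrable lebesgue m" "\<And>s. 0 \<le> m s"
    "\<And>s u. s \<in> {a..b} \<Longrightarrow> u \<in> {p..q} \<Longrightarrow> \<bar>g s u\<bar> \<le> m s"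
proof -
  have "\<exists>\<delta>. \<forall>z. \<delta> z > 0 \<and> (\<integral>\<^sup>+ s. local_sup (snd z) (\<delta> z) s * indicator {fst z - \<delta> z..fst z + \<delta> z} s \<partial>lebesgue) < \<infinity>"
    using ex_local_bound by (intro choice) blast
  then obtain \<delta> where \<delta>: "\<And>z. \<delta> z > 0"
    "\<And>z. (\<integral>\<^sup>+ s. local_sup (snd z) (\<delta> z) s * indicator {fst z - \<delta> z..fst z + \<delta> z} s \<partial>lebesgue) < \<infinity>" by blast
  define U where "U z = {fst z - \<delta> z<..<fst z + \<delta> z} \<times> {snd z - \<delta> z<..<snd z + \<delta> z}" for z
  have "compact ({a..b} \<times> {p..q})" by (intro compact_Times compact_Icc)
  then obtain D where D: "finite D" "{a..b} \<times> {p..q} \<subseteq> (\<Union>z\<in>D. U z)"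
  proof (rule compactE_image)
    show "open (U z)" for z unfolding U_def by (intro open_Times) auto
    show "{a..b} \<times> {p..q} \<subseteq> (\<Union>z\<in>{a..b} \<times> {p..q}. U z)"
      using \<delta>(1) by (force simp: U_def)
  qed (use that in blast)
  define M where "M s = (\<Sum>z\<in>D. local_sup (snd z) (\<delta> z) s * indicator {fst z - \<delta> z..fst z + \<delta> z} s)" for s
  have lm: "(\<lambda>s. local_sup u \<delta> s * indicator {p..q} s) \<in> borel_measurable lebesgue" for u \<delta> p q
    by (intro borel_measurable_times_ennreal borel_measurable_indicator local_sup_measurable) simp
  have Mm: "M \<in> borel_measurable lebesgue"
    unfolding M_def by (intro borel_measurable_sum lm)
  have Mfin: "M s < \<infinity>" for s
    unfolding M_def using local_sup_finite D(1)
    by (simp add: indicator_def)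
  have "(\<integral>\<^sup>+ s. M s \<partial>lebesgue) = (\<Sum>z\<in>D. \<integral>\<^sup>+ s. local_sup (snd z) (\<delta> z) s * indicator {fst z - \<delta> z..fst z + \<delta> z} s \<partial>lebesgue)"
    unfolding M_def by (rule nn_integral_sum) (rule lm)
  also have "\<dots> < \<infinity>" using \<delta>(2) D(1) by simp
  finally have MI: "(\<integral>\<^sup>+ s. M s \<partial>lebesgue) < \<infinity>" .
  show thesis
  proof (rule that[of "\<lambda>s. enn2real (M s)"])
    show "integrable lebesgue (\<lambda>s. enn2real (M s))"
      using Mm MI Mfin by (intro integrableI_nonneg) (auto simp: ennreal_enn2real)
    fix s u assume "s \<in> {a..b}" "u \<in> {p..q}"
    then have "(s, u) \<in> (\<Union>z\<in>D. U z)" using D(2) by blast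
    then obtain z where z: "z \<in> D" "(s, u) \<in> U z" by blast
    have "ennreal \<bar>g s u\<bar> \<le> local_sup (snd z) (\<delta> z) s"
      by (rule local_sup_ge) (use z(2) in \<open>auto simp: U_def\<close>)
    also have "\<dots> = local_sup (snd z) (\<delta> z) s * indicator {fst z - \<delta> z..fst z + \<delta> z} s"
      using z(2) by (simp add: U_def)
    also have "\<dots> \<le> M s" unfolding M_def using z(1) D(1) by (intro member_le_sum) auto
    finally have "enn2real (ennreal \<bar>g s u\<bar>) \<le> enn2real (M s)" using Mfin[of s] by (intro enn2real_mono) auto
    then show "\<bar>g s u\<bar> \<le> enn2real (M s)" by simp
  qed simp
qed

text \<open>On each \<open>(k, k + 1)\<close> the function \<open>u\<close> is replaced by a
  continuous one that stays within \<open>d k\<close> of \<open>c\<close>, equals \<open>c\<close>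
  outside the interval, and moves \<open>g\<close> by at most \<open>(1/2) ^ k\<close> in the
  integral norm. These errors add up to at most 2.\<close>

proposition continuous_perturbation:
  fixes u :: "real \<Rightarrow> real"
  assumes u: "u \<in> borel_measurable lebesgue" and d: "d \<longlonglongrightarrow> 0"
    and uc: "\<And>k s. s \<in> {real k<..<real k + 1} \<Longrightarrow> \<bar>u s - c\<bar> \<le> d k"
    and C: "\<And>n. (\<integral>\<^sup>+ s. ennreal \<bar>g s (u s)\<bar> * indicator {0..real n} s \<partial>lebesgue) \<le> ennreal C"
  obtains w where "continuous_on UNIV w" "(w \<longlongrightarrow> c) at_top" "set_integrable lebesgue {0..} (\<lambda>s. g s (w s))"
proof -
  define J where "J k = {real k<..<real k + 1}" for k
  have d0: "0 \<le> d k" for k using uc[of "real k + 1/2" k] by auto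
  define good where "good k v \<longleftrightarrow> continuous_on UNIV v \<and> (\<forall>s. \<bar>v s\<bar> \<le> d k) \<and> (\<forall>s. s \<notin> J k \<longrightarrow> v s = 0) \<and>
      (\<integral>\<^sup>+ s. ennreal \<bar>g s (c + v s) - g s (u s)\<bar> * indicator (J k) s \<partial>lebesgue) \<le> ennreal ((1/2) ^ k)" for k v
  have "\<exists>v. good k v" for k
  proof -
    have JU: "open (J k)" "J k \<noteq> UNIV" unfolding J_def by (auto simp: set_eq_iff intro: exI[of _ "real k"])
    have uk: "\<bar>u s - c\<bar> \<le> d k" if "s \<in> J k" for s using uc that by (simp add: J_def)
    obtain v N where v: "negligible N" "\<And>j. continuous_on UNIV (v j)" "\<And>j s. \<bar>v j s\<bar> \<le> d k" "\<And>j s. s \<notin> J k \<Longrightarrow> v j s = 0"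
      "\<And>s. s \<in> J k - N \<Longrightarrow> (\<lambda>j. c + v j s) \<longlonglongrightarrow> u s"
    proof (rule continuous_approximation[OF JU u d0[of k] uk], assumption)
    qed (rule that, assumption+)
    \<comment> \<open>The majorant on this strip allows dominated convergence along the
      approximations of \<open>u\<close>.\<close>
    obtain m where m: "integrable lebesgue m" "\<And>s. 0 \<le> m s"
        "\<And>s x. s \<in> {real k..real k + 1} \<Longrightarrow> x \<in> {c - d k..c + d k} \<Longrightarrow> \<bar>g s x\<bar> \<le> m s"
      by (rule integrable_domination[of "real k" "real k + 1" "c - d k" "c + d k"], rule that, assumption+)
    define H where "H j s = \<bar>g s (c + v j s) - g s (u s)\<bar> * indicator (J k) s" for j :: nat and s
    have Hm: "H j \<in> borel_measurable lebesgue" for j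
    proof -
      have "(\<lambda>s. g s (c + v j s)) \<in> borel_measurable lebesgue"
        by (intro g_superposition continuous_imp_lebesgue continuous_intros v)
      moreover have "J k \<in> sets lebesgue" by (simp add: J_def)
      ultimately show ?thesis unfolding H_def using g_superposition[OF u] by measurable
    qed
    have Hb: "norm (H j s) \<le> 2 * m s" for j s
    proof (cases "s \<in> J k")
      case True
      have "\<bar>g s (c + v j s)\<bar> \<le> m s" "\<bar>g s (u s)\<bar> \<le> m s"
        using True v(3)[of j s] uc[of s k] by (intro m(3); simp add: J_def abs_le_iff)+
      then show ?thesis using True by (simp add: H_def)
    qed (use m in \<open>simp add: H_def\<close>)
    have "(\<lambda>j. LINT s|lebesgue. H j s) \<longlonglongrightarrow> (LINT s|(lebesgue :: real measure). 0)"
    proof (rule integral_dominated_convergence[where w = "\<lambda>s. 2 * m s"])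
      have "AE s in lebesgue. s \<notin> N" using v(1) by (simp add: AE_not_in negligible_iff_null_sets)
      then show "AE s in lebesgue. (\<lambda>j. H j s) \<longlonglongrightarrow> 0"
      proof eventually_elim
        fix s assume "s \<notin> N"
        show "(\<lambda>j. H j s) \<longlonglongrightarrow> 0"
        proof (cases "s \<in> J k")
          case True
          then have "(\<lambda>j. g s (c + v j s)) \<longlonglongrightarrow> g s (u s)" using \<open>s \<notin> N\<close> by (intro g_tendsto v) auto
          then have "(\<lambda>j. \<bar>g s (c + v j s) - g s (u s)\<bar>) \<longlonglongrightarrow> \<bar>g s (u s) - g s (u s)\<bar>"
            by (intro tendsto_intros)
          then show ?thesis using True by (simp add: H_def)
        qed (simp add: H_def)
      qed
    qed (use Hm Hb m in auto)
    then have "\<forall>\<^sub>F j in sequentially. (LINT s|lebesgue. H j s) < (1/2) ^ k"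
      by (intro order_tendstoD) auto
    then obtain j where j: "(LINT s|lebesgue. H j s) < (1/2) ^ k" by (auto simp: eventually_sequentially)
    have Hi: "integrable lebesgue (H j)"
      by (rule Bochner_Integration.integrable_bound[where f = "\<lambda>s. 2 * m s"]) (use Hm Hb m in \<open>auto intro!: AE_I2\<close>)
    have "(\<integral>\<^sup>+ s. ennreal \<bar>g s (c + v j s) - g s (u s)\<bar> * indicator (J k) s \<partial>lebesgue) = (\<integral>\<^sup>+ s. ennreal (H j s) \<partial>lebesgue)"
      by (intro nn_integral_cong) (auto simp: H_def indicator_def)
    also have "\<dots> = ennreal (LINT s|lebesgue. H j s)"
      by (rule nn_integral_eq_integral[OF Hi]) (auto simp: H_def)
    also have "\<dots> \<le> ennreal ((1/2) ^ k)" using j by (intro ennreal_leI) simp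
    finally have "good k (v j)" unfolding good_def using v by blast
    then show ?thesis by (rule exI[of "good k"])
  qed
  then obtain v where "\<And>k. good k (v k)" by metis
  then have v: "continuous_on UNIV (v k)" "\<bar>v k s\<bar> \<le> d k" "s \<notin> J k \<Longrightarrow> v k s = 0"
      "(\<integral>\<^sup>+ s. ennreal \<bar>g s (c + v k s) - g s (u s)\<bar> * indicator (J k) s \<partial>lebesgue) \<le> ennreal ((1/2) ^ k)" for k s
    unfolding good_def by blast+
  have disj: "j = k" if "s \<in> J j" "s \<in> J k" for j k s
    using that by (auto simp: J_def)
  obtain V where V: "continuous_on UNIV V" "\<And>k s. s \<in> J k \<Longrightarrow> V s = v k s" "\<And>s. (\<And>k. s \<notin> J k) \<Longrightarrow> V s = 0"
    by (rule continuous_glue_disjoint[OF v(1) v(3) disj v(2) d]) auto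
  define w where "w s = c + V s" for s
  have wc: "continuous_on UNIV w" unfolding w_def by (intro continuous_intros V)
  have wm: "(\<lambda>s. g s (w s)) \<in> borel_measurable lebesgue"
    by (intro g_superposition continuous_imp_lebesgue wc)
  have "(w \<longlongrightarrow> c) at_top"
    unfolding tendsto_iff
  proof (intro allI impI)
    fix e :: real assume "e > 0"
    then obtain n where n: "\<And>k. k \<ge> n \<Longrightarrow> d k < e"
      using order_tendstoD(2)[OF d \<open>e > 0\<close>] by (auto simp: eventually_sequentially)
    have "dist (w s) c < e" if "s \<ge> real n" for s
    proof (cases "\<exists>k. s \<in> J k")
      case True
      then obtain k where k: "s \<in> J k" by blast
      then have "n \<le> k" using that by (auto simp: J_def)
      then show ?thesis using n[of k] v(2)[of k s] V(2)[OF k] by (simp add: w_def dist_real_def)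
    qed (use V(3) \<open>e > 0\<close> in \<open>simp add: w_def\<close>)
    then show "\<forall>\<^sub>F s in at_top. dist (w s) c < e" by (auto simp: eventually_at_top_linorder)
  qed
  moreover have "set_integrable lebesgue {0..} (\<lambda>s. g s (w s))"
    unfolding set_integrable_def
  proof (rule integrableI_bounded)
    show "(\<lambda>s. indicator {0..} s *\<^sub>R g s (w s)) \<in> borel_measurable lebesgue"
      by (intro borel_measurable_scaleR borel_measurable_indicator wm) simp
    define H where "H n s = ennreal \<bar>g s (w s)\<bar> * indicator {0..real n} s" for n s
    have Hm: "H n \<in> borel_measurable lebesgue" for n
    proof -
      have "(\<lambda>s. ennreal \<bar>g s (w s)\<bar> * indicator A s) \<in> borel_measurable lebesgue" if "A \<in> sets lebesgue" for A
        using wm that by measurable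
      then show ?thesis unfolding H_def by simp
    qed
    have "(\<integral>\<^sup>+ s. ennreal (norm (indicator {0..} s *\<^sub>R g s (w s))) \<partial>lebesgue) \<le> (\<integral>\<^sup>+ s. (SUP n. H n s) \<partial>lebesgue)"
    proof (rule nn_integral_mono)
      fix s
      show "ennreal (norm (indicator {0..} s *\<^sub>R g s (w s))) \<le> (SUP n. H n s)"
      proof (cases "0 \<le> s")
        case True
        obtain n where "s \<le> real n" using real_arch_simple by blast
        then have "ennreal (norm (indicator {0..} s *\<^sub>R g s (w s))) = H n s" using True by (simp add: H_def)
        also have "\<dots> \<le> (SUP n. H n s)" by (rule SUP_upper) simp
        finally show ?thesis .
      qed simp
    qed
    also have "\<dots> = (SUP n. integral\<^sup>N lebesgue (H n))"
    proof (rule nn_integral_monotone_convergence_SUP[OF _ Hm])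
      show "incseq H" unfolding H_def by (intro incseq_SucI le_funI) (auto simp: indicator_def)
    qed
    also have "\<dots> \<le> ennreal C + ennreal 2"
    proof (rule SUP_least)
      fix n
      have Jm: "J k \<in> sets lebesgue" for k by (simp add: J_def)
      have dm: "(\<lambda>s. ennreal \<bar>g s (c + v k s) - g s (u s)\<bar> * indicator (J k) s) \<in> borel_measurable lebesgue" for k
      proof -
        have "(\<lambda>s. g s (c + v k s)) \<in> borel_measurable lebesgue"
          by (intro g_superposition continuous_imp_lebesgue continuous_intros v)
        then show ?thesis using g_superposition[OF u] Jm[of k] by measurable
      qed
      have um: "(\<lambda>s. ennreal \<bar>g s (u s)\<bar> * indicator {0..real n} s) \<in> borel_measurable lebesgue"
      proof -
        have "(\<lambda>s. ennreal \<bar>g s (u s)\<bar> * indicator A s) \<in> borel_measurable lebesgue" if "A \<in> sets lebesgue" for A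
          using g_superposition[OF u] that by measurable
        then show ?thesis by simp
      qed
      have "integral\<^sup>N lebesgue (H n) \<le> (\<integral>\<^sup>+ s. ennreal \<bar>g s (u s)\<bar> * indicator {0..real n} s
          + (\<Sum>k<n. ennreal \<bar>g s (c + v k s) - g s (u s)\<bar> * indicator (J k) s) \<partial>lebesgue)"
      proof (rule nn_integral_mono_AE)
        \<comment> \<open>At the integers \<open>w\<close> takes the value \<open>c\<close> and need
          not be close to \<open>u\<close>; they form a null set.\<close>
        have "range real \<in> null_sets lebesgue"
          by (intro null_sets_completionI countable_imp_null_set_lborel) auto
        then have "AE s in lebesgue. s \<notin> range real" by (rule AE_not_in)
        then show "AE s in lebesgue. H n s \<le> ennreal \<bar>g s (u s)\<bar> * indicator {0..real n} s
            + (\<Sum>k<n. ennreal \<bar>g s (c + v k s) - g s (u s)\<bar> * indicator (J k) s)"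
        proof eventually_elim
          fix s assume s: "s \<notin> range real"
          show "H n s \<le> ennreal \<bar>g s (u s)\<bar> * indicator {0..real n} s
            + (\<Sum>k<n. ennreal \<bar>g s (c + v k s) - g s (u s)\<bar> * indicator (J k) s)"
          proof (cases "s \<in> {0..real n}")
            case True
            define k where "k = nat \<lfloor>s\<rfloor>"
            have "real k \<le> s" "s < real k + 1" using True by (auto simp: k_def)
            moreover have "s \<noteq> real k" "s \<noteq> real n" using s by blast+
            moreover have "s \<le> real n" using True by simp
            ultimately have "real k < s" "s < real k + 1" "real k < real n" by linarith+
            then have sk: "s \<in> J k" "k < n" by (simp_all add: J_def)
            have "\<bar>g s (w s)\<bar> \<le> \<bar>g s (u s)\<bar> + \<bar>g s (c + v k s) - g s (u s)\<bar>"
              using V(2)[OF sk(1)] by (simp add: w_def)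
            then have "ennreal \<bar>g s (w s)\<bar> \<le> ennreal \<bar>g s (u s)\<bar> + ennreal \<bar>g s (c + v k s) - g s (u s)\<bar>"
              by (simp flip: ennreal_plus)
            also have "ennreal \<bar>g s (c + v k s) - g s (u s)\<bar> = ennreal \<bar>g s (c + v k s) - g s (u s)\<bar> * indicator (J k) s"
              using sk by simp
            also have "\<dots> \<le> (\<Sum>k<n. ennreal \<bar>g s (c + v k s) - g s (u s)\<bar> * indicator (J k) s)"
              using sk by (intro member_le_sum) auto
            finally show ?thesis using True by (simp add: H_def add_left_mono)
          qed (simp add: H_def)
        qed
      qed
      also have "\<dots> = (\<integral>\<^sup>+ s. ennreal \<bar>g s (u s)\<bar> * indicator {0..real n} s \<partial>lebesgue)
          + (\<Sum>k<n. \<integral>\<^sup>+ s. ennreal \<bar>g s (c + v k s) - g s (u s)\<bar> * indicator (J k) s \<partial>lebesgue)"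
        by (subst nn_integral_add[OF um borel_measurable_sum[OF dm]], subst nn_integral_sum[OF dm], rule refl)
      also have "\<dots> \<le> ennreal C + (\<Sum>k<n. ennreal ((1/2) ^ k))"
        by (intro add_mono sum_mono C v)
      also have "(\<Sum>k<n. ennreal ((1/2) ^ k)) = ennreal (\<Sum>k<n. (1/2) ^ k)"
        by (rule sum_ennreal) simp
      also have "\<dots> \<le> ennreal 2"
      proof (rule ennreal_leI)
        show "(\<Sum>k<n. (1/2) ^ k) \<le> (2::real)" by (subst sum_gp_strict) auto
      qed
      finally show "integral\<^sup>N lebesgue (H n) \<le> ennreal C + ennreal 2" by (simp add: add_left_mono)
    qed
    also have "\<dots> < \<infinity>" by simp
    finally show "(\<integral>\<^sup>+ s. ennreal (norm (indicator {0..} s *\<^sub>R g s (w s))) \<partial>lebesgue) < \<infinity>" .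
  qed
  ultimately show thesis using wc by (intro that)
qed

end

section \<open>The delay equation\<close>

lemma abs_exp_diff_le:
  fixes x y B :: real
  assumes "exp x \<le> B" "exp y \<le> B"
  shows "\<bar>exp x - exp y\<bar> \<le> B * \<bar>x - y\<bar>"
proof -
  have *: "exp x - exp y \<le> B * \<bar>x - y\<bar>" if "exp x \<le> B" "y \<le> x" for x y
  proof -
    have "1 + (y - x) \<le> exp (y - x)" by (rule exp_ge_add_one_self)
    then have "exp x * (1 + (y - x)) \<le> exp x * exp (y - x)" by (intro mult_left_mono) auto
    then have "exp x - exp y \<le> exp x * (x - y)" by (simp flip: exp_add add: algebra_simps)
    also have "\<dots> \<le> B * (x - y)" using that by (intro mult_right_mono) auto
    finally show ?thesis using that by simp
  qed
  show ?thesis using *[of x y] *[of y x] assms by (cases "y \<le> x") (auto simp: abs_if)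
qed

lemma abs_continuous_on_mono:
  assumes "abs_continuous_on S F" "T \<subseteq> S"
    and le: "\<And>u v. u \<in> T \<Longrightarrow> v \<in> T \<Longrightarrow> \<bar>G v - G u\<bar> \<le> K * \<bar>F v - F u\<bar>" and "0 < K"
  shows "abs_continuous_on T G"
  unfolding abs_continuous_on_def
proof (intro allI impI)
  fix e :: real assume "e > 0"
  then have "0 < e / K" using \<open>0 < K\<close> by simp
  then obtain \<delta> where \<delta>: "\<delta> > 0" "\<forall>(n::nat) u v. (\<forall>i<n. u i \<le> v i \<and> {u i..v i} \<subseteq> S) \<and>
        disjoint_family_on (\<lambda>i. {u i<..<v i}) {..<n} \<and> (\<Sum>i<n. v i - u i) < \<delta> \<longrightarrow>
        (\<Sum>i<n. \<bar>F (v i) - F (u i)\<bar>) < e / K"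
    using assms(1)[unfolded abs_continuous_on_def, THEN spec, of "e / K"] by (elim impE exE conjE)
  have main: "(\<Sum>i<n. \<bar>G (v i) - G (u i)\<bar>) < e"
    if *: "\<forall>i<n. u i \<le> v i \<and> {u i..v i} \<subseteq> T" "disjoint_family_on (\<lambda>i. {u i<..<v i}) {..<n}" "(\<Sum>i<n. v i - u i) < \<delta>"
    for n :: nat and u v
  proof -
    have "(\<Sum>i<n. \<bar>G (v i) - G (u i)\<bar>) \<le> (\<Sum>i<n. K * \<bar>F (v i) - F (u i)\<bar>)"
    proof (rule sum_mono)
      fix i assume "i \<in> {..<n}"
      then have "u i \<le> v i" "{u i..v i} \<subseteq> T" using *(1) by auto
      then have "u i \<in> T" "v i \<in> T" by auto
      then show "\<bar>G (v i) - G (u i)\<bar> \<le> K * \<bar>F (v i) - F (u i)\<bar>" by (rule le)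
    qed
    also have "\<dots> = K * (\<Sum>i<n. \<bar>F (v i) - F (u i)\<bar>)" by (simp add: sum_distrib_left)
    also have "\<dots> < K * (e / K)"
    proof (rule mult_strict_left_mono[OF _ \<open>0 < K\<close>])
      show "(\<Sum>i<n. \<bar>F (v i) - F (u i)\<bar>) < e / K"
        using * assms(2) by (intro \<delta>(2)[rule_format] conjI) (auto intro: order_trans)
    qed
    also have "\<dots> = e" using \<open>0 < K\<close> by simp
    finally show ?thesis .
  qed
  show "\<exists>\<delta>>0. \<forall>n u v. (\<forall>i<(n::nat). u i \<le> v i \<and> {u i..v i} \<subseteq> T) \<and>
      disjoint_family_on (\<lambda>i. {u i<..<v i}) {..<n} \<and> (\<Sum>i<n. v i - u i) < \<delta> \<longrightarrow>
      (\<Sum>i<n. \<bar>G (v i) - G (u i)\<bar>) < e"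
    by (intro exI[of _ \<delta>] conjI allI impI \<delta>(1), elim conjE, rule main)
qed

text \<open>A bound that holds as long as \<open>x\<close> is positive becomes unconditional: to the
  right of the last point \<open>z\<close> with \<open>x z \<le> 0\<close> the values are at least
  \<open>\<epsilon>\<close>, which contradicts continuity at \<open>z\<close>.\<close>

lemma positive_backwards:
  fixes x :: "real \<Rightarrow> real"
  assumes x: "continuous_on {a..b} x" and pos: "0 < x b" "0 < \<epsilon>" and s: "s \<in> {a..b}"
    and lb: "\<And>s. s \<in> {a..b} \<Longrightarrow> (\<And>u. u \<in> {s..b} \<Longrightarrow> 0 < x u) \<Longrightarrow> \<epsilon> \<le> x s"
  shows "0 < x s"
proof (rule ccontr)
  let ?Z = "{s \<in> {a..b}. x s \<le> 0}"
  assume "\<not> 0 < x s"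
  then have "?Z \<noteq> {}" using s by auto
  moreover have "closed ?Z" by (intro continuous_on_closed_Collect_le x continuous_intros closed_atLeastAtMost)
  then have "compact ?Z" by (simp add: compact_eq_bounded_closed) (rule bounded_subset[of "{a..b}"], auto)
  ultimately obtain z where z: "z \<in> ?Z" "\<And>s. s \<in> ?Z \<Longrightarrow> s \<le> z" using compact_attains_sup[of ?Z] by blast
  have "z < b" using z(1) pos by (auto simp: less_le)
  have gt: "\<epsilon> \<le> x s" if "s \<in> {z<..b}" for s
  proof (rule lb)
    show "s \<in> {a..b}" using that z(1) by auto
    show "0 < x u" if "u \<in> {s..b}" for u
    proof (rule ccontr)
      assume "\<not> 0 < x u"
      then have "u \<le> z" using that \<open>s \<in> {z<..b}\<close> z(1) by (intro z(2)) auto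
      then show False using that \<open>s \<in> {z<..b}\<close> by auto
    qed
  qed
  have cl: "closure {z<..b} = {z..b}" using \<open>z < b\<close> by simp
  have "\<epsilon> \<le> x z"
    by (rule continuous_ge_on_closure[of "{z<..b}" x]) (use cl gt \<open>z < b\<close> z(1) in \<open>auto intro: continuous_on_subset[OF x]\<close>)
  then show False using z(1) pos by auto
qed

locale delay_equation =
  fixes h :: real and lam :: "real \<Rightarrow> real"
    and f :: "real \<Rightarrow> real \<Rightarrow> real"
    and L :: "real \<Rightarrow> (real \<Rightarrow> real) \<Rightarrow> real"
  assumes h_pos: "h > 0"
    and lam_pos: "\<And>t. t \<ge> -h \<Longrightarrow> lam t > 0"
    and lam_meas: "lam \<in> borel_measurable (lebesgue_on {-h..})"
    and f_car: "caratheodory euclideanreal f"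
    and L_car: "caratheodory (mtopology_of (hist_space h)) L"
    and L_between: "\<And>t \<phi>. t \<ge> 0 \<Longrightarrow> \<phi> \<in> mspace (hist_space h) \<Longrightarrow>
          Inf (\<phi> ` {-h..0}) \<le> L t \<phi> \<and> L t \<phi> \<le> Sup (\<phi> ` {-h..0})"
    and f_one: "\<And>t. t \<ge> 0 \<Longrightarrow> f t 1 = 0"
    and f_div: "\<And>w c. continuous_on {0..} w \<Longrightarrow> (w \<longlongrightarrow> c) at_top \<Longrightarrow> c > 0 \<Longrightarrow> c \<noteq> 1 \<Longrightarrow>
          improper_integral_diverges (\<lambda>s. lam s * f s (w s))"
    and f_sign: "\<And>t x. t \<ge> 0 \<Longrightarrow> x > -1 \<Longrightarrow> x \<noteq> 0 \<Longrightarrow> x * f t (1 + x) < 0"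
begin

text \<open>Extended by 0 to negative times, because superposition operators were treated on the
  whole line.\<close>

definition rhs :: "real \<Rightarrow> real \<Rightarrow> real" where
  "rhs s u = (if 0 \<le> s then lam s * f s u else 0)"

lemma rhs_meas: "(\<lambda>s. rhs s u) \<in> borel_measurable lebesgue"
proof -
  have "lam \<in> borel_measurable (lebesgue_on {0..})"
    by (rule measurable_restrict_mono[OF lam_meas]) (use h_pos in auto)
  moreover have "(\<lambda>s. f s u) \<in> borel_measurable (lebesgue_on {0..})"
    using f_car by (simp add: caratheodory_def)
  ultimately have "(\<lambda>s. lam s * f s u) \<in> borel_measurable (lebesgue_on {0..})"
    by (rule borel_measurable_times)
  then have "(\<lambda>s. if s \<in> {0..} then lam s * f s u else 0) \<in> borel_measurable lebesgue"
    by (subst borel_measurable_if) auto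
  then show ?thesis by (simp add: rhs_def)
qed

lemma rhs_cont: "continuous_on UNIV (rhs s)"
proof (cases "0 \<le> s")
  case True
  then have "continuous_on UNIV (f s)" using f_car by (simp add: caratheodory_def)
  then show ?thesis using True unfolding rhs_def by (simp add: continuous_intros)
qed (simp add: rhs_def)

lemma rhs_int:
  assumes w: "continuous_on UNIV w"
  shows "(\<integral>\<^sup>+ s. ennreal \<bar>rhs s (w s)\<bar> * indicator {-T..T} s \<partial>lebesgue) < \<infinity>"
proof (cases "0 \<le> T")
  case True
  \<comment> \<open>\<open>w\<close> is kept up to \<open>T\<close> and then led linearly to the
    constant 2, an admissible limit in the divergence condition, which thereby supplies
    integrability on \<open>{0..T}\<close>.\<close>
  define w' where "w' s = w (min s T) + (2 - w T) * min 1 (max 0 (s - T))" for s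
  have c: "continuous_on UNIV w'"
    unfolding w'_def by (intro continuous_intros continuous_on_compose2[OF w]) auto
  have "\<forall>\<^sub>F s in at_top. w' s = 2"
    unfolding eventually_at_top_linorder by (intro exI[of _ "T + 1"]) (auto simp: w'_def)
  then have "(w' \<longlongrightarrow> 2) at_top" by (rule tendsto_eventually)
  then have "improper_integral_diverges (\<lambda>s. lam s * f s (w' s))"
    using c by (intro f_div[of w' 2]) (auto intro: continuous_on_subset)
  then have "integrable (lebesgue_on {0..T}) (\<lambda>s. lam s * f s (w' s))"
    using True by (simp add: improper_integral_diverges_def)
  then have "(\<integral>\<^sup>+ s. ennreal (norm (lam s * f s (w' s))) \<partial>lebesgue_on {0..T}) < \<infinity>"
    by (simp add: integrable_iff_bounded)
  also have "(\<integral>\<^sup>+ s. ennreal (norm (lam s * f s (w' s))) \<partial>lebesgue_on {0..T})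
      = (\<integral>\<^sup>+ s. ennreal (norm (lam s * f s (w' s))) * indicator {0..T} s \<partial>lebesgue)"
    by (subst nn_integral_restrict_space) auto
  also have "\<dots> = (\<integral>\<^sup>+ s. ennreal \<bar>rhs s (w s)\<bar> * indicator {-T..T} s \<partial>lebesgue)"
    by (rule nn_integral_cong) (auto simp: rhs_def w'_def indicator_def)
  finally show ?thesis .
qed (simp add: indicator_def)

sublocale integrable_superposition rhs
  by unfold_locales (fact rhs_meas rhs_cont rhs_int)+

lemma rhs_sign: "u > 1 \<Longrightarrow> rhs s u \<le> 0" "0 < u \<Longrightarrow> u \<le> 1 \<Longrightarrow> 0 \<le> rhs s u"
proof -
  assume "u > 1"
  then have "f s u \<le> 0" if "0 \<le> s" using f_sign[OF that, of "u - 1"] by (simp add: mult_less_0_iff)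
  then show "rhs s u \<le> 0"
    using lam_pos[of s] h_pos by (auto simp: rhs_def mult_le_0_iff intro: less_imp_le)
next
  assume "0 < u" "u \<le> 1"
  then have "0 \<le> f s u" if "0 \<le> s"
    using f_sign[OF that, of "u - 1"] f_one[OF that] by (cases "u = 1") (auto simp: mult_less_0_iff)
  then show "0 \<le> rhs s u"
    using lam_pos[of s] h_pos by (simp add: rhs_def less_imp_le)
qed

section \<open>Dependence of the delayed feedback on time and history\<close>

lemma segment_mem: "continuous_on UNIV z \<Longrightarrow> segment h z s \<in> mspace (hist_space h)"
  by (rule segment_in_hist_space) (rule continuous_on_subset, auto)

lemma segment_cong: "(\<And>u. u \<in> {s-h..s} \<Longrightarrow> z u = z' u) \<Longrightarrow> segment h z s = segment h z' s"
  unfolding segment_def by (rule restrict_ext) auto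

lemma L_bounds:
  assumes "0 \<le> t" "continuous_on {s-h..s} z" "\<And>u. u \<in> {s-h..s} \<Longrightarrow> p \<le> z u \<and> z u \<le> q"
  shows "p \<le> L t (segment h z s)" "L t (segment h z s) \<le> q"
proof -
  have B: "p \<le> y \<and> y \<le> q" if "y \<in> segment h z s ` {-h..0}" for y
    using that assms(3) by (auto simp: segment_def)
  have ne: "segment h z s ` {-h..0} \<noteq> {}" using h_pos by auto
  have "p \<le> Inf (segment h z s ` {-h..0})" using B ne by (intro cInf_greatest) auto
  moreover have "Sup (segment h z s ` {-h..0}) \<le> q" using B ne by (intro cSup_least) auto
  ultimately show "p \<le> L t (segment h z s)" "L t (segment h z s) \<le> q"
    using L_between[OF assms(1) segment_in_hist_space[OF assms(2)]] by auto
qed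

text \<open>\<open>L t\<close> is continuous for the sup metric, so uniform closeness over the
  window is enough. Functions and base points vary simultaneously, as they do when the lag of the
  approximate solutions tends to 0.\<close>

lemma L_segment_tendsto:
  assumes t: "0 \<le> t" and z: "continuous_on UNIV z" "\<And>n. continuous_on UNIV (zn n)"
    and lim: "\<And>e. e > 0 \<Longrightarrow> \<forall>\<^sub>F n in sequentially. \<forall>\<theta>\<in>{-h..0}. \<bar>zn n (sn n + \<theta>) - z (s + \<theta>)\<bar> \<le> e"
  shows "(\<lambda>n. L t (segment h (zn n) (sn n))) \<longlonglongrightarrow> L t (segment h z s)"
proof -
  interpret H: Metric_space "mspace (hist_space h)" "mdist (hist_space h)" by simp
  have "limitin H.mtopology (\<lambda>n. segment h (zn n) (sn n)) (segment h z s) sequentially"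
    unfolding H.limitin_metric
  proof (intro conjI allI impI)
    show "segment h z s \<in> mspace (hist_space h)" by (rule segment_mem[OF z(1)])
    fix e :: real assume "e > 0"
    then have "e / 2 > 0" by simp
    from lim[OF this]
    show "\<forall>\<^sub>F n in sequentially. segment h (zn n) (sn n) \<in> mspace (hist_space h) \<and>
        mdist (hist_space h) (segment h (zn n) (sn n)) (segment h z s) < e"
    proof eventually_elim
      case (elim n)
      have "mdist (hist_space h) (segment h (zn n) (sn n)) (segment h z s) \<le> e / 2"
        unfolding hist_space_def
        by (rule mdist_cfunspace_le) (use elim \<open>e > 0\<close> in \<open>auto simp: segment_def dist_real_def\<close>)
      then show ?case using segment_mem[OF z(2)] \<open>e > 0\<close> by auto
    qed
  qed
  moreover have "continuous_map (mtopology_of (hist_space h)) euclideanreal (L t)"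
    using L_car t by (simp add: caratheodory_def)
  ultimately have "limitin euclideanreal (L t \<circ> (\<lambda>n. segment h (zn n) (sn n))) (L t (segment h z s)) sequentially"
    by (intro continuous_map_limit[of "mtopology_of (hist_space h)"]) (simp_all add: mtopology_of_def)
  then show ?thesis by (simp add: o_def)
qed

lemma continuous_shift_close:
  fixes z :: "real \<Rightarrow> real"
  assumes z: "continuous_on UNIV z" and s: "sn \<longlonglongrightarrow> s" and "e > 0"
  shows "\<forall>\<^sub>F n in sequentially. \<forall>\<theta>\<in>{-h..0}. \<bar>z (sn n + \<theta>) - z (s + \<theta>)\<bar> \<le> e"
proof -
  have "uniformly_continuous_on {s-h-1..s+1} z"
    by (intro compact_uniformly_continuous continuous_on_subset[OF z]) auto
  then obtain d where d: "d > 0" "\<And>u v. u \<in> {s-h-1..s+1} \<Longrightarrow> v \<in> {s-h-1..s+1} \<Longrightarrow> dist v u < d \<Longrightarrow> dist (z v) (z u) < e"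
    unfolding uniformly_continuous_on_def using \<open>e > 0\<close> by metis
  have "\<forall>\<^sub>F n in sequentially. dist (sn n) s < min d 1"
    using s d(1) unfolding tendsto_iff by (metis min_less_iff_conj zero_less_one)
  then show ?thesis
  proof eventually_elim
    case (elim n)
    show ?case
    proof
      fix \<theta> assume "\<theta> \<in> {-h..0}"
      then have "dist (z (sn n + \<theta>)) (z (s + \<theta>)) < e"
        using elim h_pos by (intro d(2)) (auto simp: dist_real_def abs_if split: if_splits)
      then show "\<bar>z (sn n + \<theta>) - z (s + \<theta>)\<bar> \<le> e" by (simp add: dist_real_def)
    qed
  qed
qed

text \<open>The lag \<open>\<delta>\<close> shifts only the history and leaves the explicit time
  argument of \<open>L\<close> alone.\<close>

definition feedback :: "(real \<Rightarrow> real) \<Rightarrow> real \<Rightarrow> real \<Rightarrow> real" where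
  "feedback z \<delta> t = (if 0 \<le> t then L t (segment h z (t - \<delta>)) else 0)"

text \<open>Only the position of the segment is rounded to the grid. For each grid point the history
  is then fixed, and \<open>L\<close> is measurable in its time argument.\<close>

lemma feedback_meas:
  assumes z: "continuous_on UNIV z"
  shows "feedback z \<delta> \<in> borel_measurable lebesgue"
proof (rule borel_measurable_LIMSEQ_real)
  let ?t = "\<lambda>k t. of_int \<lfloor>real (Suc k) * t\<rfloor> / real (Suc k) :: real"
  let ?F = "\<lambda>k t. if 0 \<le> t then L t (segment h z (?t k t - \<delta>)) else 0"
  have lim: "(\<lambda>k. ?t k t) \<longlonglongrightarrow> t" for t by (rule floor_grid_tendsto)
  show "(\<lambda>k. ?F k t) \<longlonglongrightarrow> feedback z \<delta> t" for t
  proof (cases "0 \<le> t")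
    case True
    have "(\<lambda>k. L t (segment h z (?t k t - \<delta>))) \<longlonglongrightarrow> L t (segment h z (t - \<delta>))"
      by (intro L_segment_tendsto[OF True z z] continuous_shift_close[OF z] tendsto_intros lim)
    then show ?thesis using True by (simp add: feedback_def)
  qed (simp add: feedback_def)
  show "?F k \<in> borel_measurable lebesgue" for k
  proof (rule measurable_compose_countable[where f = "\<lambda>i t. if 0 \<le> t then L t (segment h z (of_int i / real (Suc k) - \<delta>)) else 0"
        and g = "\<lambda>t. \<lfloor>real (Suc k) * t\<rfloor>"])
    fix i :: int
    have "(\<lambda>t. L t (segment h z (of_int i / real (Suc k) - \<delta>))) \<in> borel_measurable (lebesgue_on {0..})"
      using L_car segment_mem[OF z] by (simp add: caratheodory_def)
    then have "(\<lambda>t. if t \<in> {0..} then L t (segment h z (of_int i / real (Suc k) - \<delta>)) else 0) \<in> borel_measurable lebesgue"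
      by (subst borel_measurable_if) auto
    then show "(\<lambda>t. if 0 \<le> t then L t (segment h z (of_int i / real (Suc k) - \<delta>)) else 0) \<in> borel_measurable lebesgue" by simp
  next
    have "(\<lambda>t::real. real (Suc k) * t) \<in> borel_measurable lebesgue"
      by (intro continuous_imp_lebesgue continuous_intros)
    then show "(\<lambda>t. \<lfloor>real (Suc k) * t\<rfloor>) \<in> lebesgue \<rightarrow>\<^sub>M count_space UNIV" by measurable
  qed
qed

end

section \<open>Local existence\<close>

context delay_equation
begin

text \<open>Confines the argument of \<open>rhs\<close> to a range with an integrable majorant;
  where the function is known to lie in \<open>{0..U}\<close>, the clamp has no effect.\<close>

definition clamp :: "real \<Rightarrow> real \<Rightarrow> real" where
  "clamp U u = max 0 (min U u)"

lemma clamp_in: "0 \<le> U \<Longrightarrow> clamp U u \<in> {0..U}"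
  by (auto simp: clamp_def)

lemma clamp_id: "0 \<le> u \<Longrightarrow> u \<le> U \<Longrightarrow> clamp U u = u"
  by (auto simp: clamp_def)

text \<open>Tonelli's scheme: with the segment taken at \<open>t - \<delta>\<close> the equation can be solved step by step.\<close>

definition field :: "real \<Rightarrow> (real \<Rightarrow> real) \<Rightarrow> real \<Rightarrow> real \<Rightarrow> real" where
  "field U z \<delta> t = rhs t (clamp U (feedback z \<delta> t))"

text \<open>For a given feedback the equation is linear in the unknown, hence the exponential
  factor. The truncations of time reproduce \<open>X\<close> up to \<open>W\<close> and freeze the
  function after \<open>W + 1\<close>, so that one always works with functions on the whole
  line.\<close>

definition tonelli :: "real \<Rightarrow> real \<Rightarrow> (real \<Rightarrow> real) \<Rightarrow> real \<Rightarrow> (real \<Rightarrow> real) \<Rightarrow> real \<Rightarrow> real" where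
  "tonelli U W X \<delta> z t = X (min t W) * exp (integral {W..max W (min t (W + 1))} (field U z \<delta>))"

lemma field_meas: "continuous_on UNIV z \<Longrightarrow> field U z \<delta> \<in> borel_measurable lebesgue"
  unfolding field_def clamp_def
  by (intro g_superposition borel_measurable_max borel_measurable_min feedback_meas) auto

lemma field_cong:
  assumes "\<And>u. u \<in> {t-\<delta>-h..t-\<delta>} \<Longrightarrow> z u = z' u"
  shows "field U z \<delta> t = field U z' \<delta> t"
  using segment_cong[of "t-\<delta>" z z'] assms by (simp add: field_def feedback_def)

lemma field_eq:
  assumes "0 \<le> t" "continuous_on {t-h..t} z" "\<And>u. u \<in> {t-h..t} \<Longrightarrow> 0 \<le> z u \<and> z u \<le> U"
  shows "field U z 0 t = rhs t (L t (segment h z t))"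
  using L_bounds[OF assms] assms(1) by (simp add: field_def feedback_def clamp_id)

context
  fixes U W :: real and X m :: "real \<Rightarrow> real"
  assumes U: "0 \<le> U" and W: "0 \<le> W" and X: "continuous_on UNIV X"
    and m_int: "integrable lebesgue m" and m_nonneg: "\<And>s. 0 \<le> m s"
    and m: "\<And>s u. s \<in> {0..W+1} \<Longrightarrow> u \<in> {0..U} \<Longrightarrow> \<bar>rhs s u\<bar> \<le> m s"
begin

lemma m_abs_int: "m absolutely_integrable_on S" if "S \<in> sets lebesgue"
  unfolding set_integrable_def by (rule integrable_mult_indicator[OF that m_int])

lemma field_bound: "s \<in> {W..W+1} \<Longrightarrow> \<bar>field U z \<delta> s\<bar> \<le> m s"
  unfolding field_def using W by (intro m clamp_in U) auto

lemma field_abs_int: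
  assumes z: "continuous_on UNIV z" and "{p..q} \<subseteq> {W..W+1}"
  shows "field U z \<delta> absolutely_integrable_on {p..q}"
proof (rule measurable_bounded_by_integrable_imp_absolutely_integrable[where g = m])
  show "field U z \<delta> \<in> borel_measurable (lebesgue_on {p..q})"
    using field_meas[OF z] by (rule measurable_restrict_space1)
  show "m integrable_on {p..q}" by (intro set_lebesgue_integral_eq_integral m_abs_int) simp
  show "norm (field U z \<delta> x) \<le> m x" if "x \<in> {p..q}" for x
    using field_bound[of x z \<delta>] that assms(2) by auto
qed simp

lemma field_int: "continuous_on UNIV z \<Longrightarrow> {p..q} \<subseteq> {W..W+1} \<Longrightarrow> field U z \<delta> integrable_on {p..q}"
  using field_abs_int set_lebesgue_integral_eq_integral(1) by blast

lemma tonelli_cont: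
  assumes z: "continuous_on UNIV z"
  shows "continuous_on UNIV (tonelli U W X \<delta> z)"
proof -
  have "continuous_on {W..W+1} (\<lambda>t. integral {W..t} (field U z \<delta>))"
    by (rule indefinite_integral_continuous_1) (rule field_int[OF z order_refl])
  then have "continuous_on UNIV (\<lambda>t. integral {W..max W (min t (W + 1))} (field U z \<delta>))"
    by (rule continuous_on_compose2) (auto intro!: continuous_intros)
  moreover have "continuous_on UNIV (\<lambda>t. X (min t W))"
    by (rule continuous_on_compose2[OF X]) (auto intro!: continuous_intros)
  ultimately show ?thesis unfolding tonelli_def by (intro continuous_intros)
qed

text \<open>The field at time \<open>s\<close> sees the function only up to
  \<open>s - \<delta>\<close>, so each iteration enlarges the interval of agreement by
  \<open>\<delta>\<close>; finitely many iterations cover \<open>[W, W + 1]\<close>.\<close>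

lemma ex_tonelli_solution:
  assumes \<delta>: "\<delta> > 0"
  obtains z where "continuous_on UNIV z" "z = tonelli U W X \<delta> z"
proof -
  define Z where "Z n = (tonelli U W X \<delta> ^^ n) (\<lambda>t. X (min t W))" for n
  have Z_Suc: "Z (Suc n) = tonelli U W X \<delta> (Z n)" for n by (simp add: Z_def)
  have Zc: "continuous_on UNIV (Z n)" for n
  proof (induction n)
    case 0
    show ?case unfolding Z_def by (auto intro!: continuous_on_compose2[OF X] continuous_intros)
  next
    case (Suc n)
    then show ?case unfolding Z_Suc by (rule tonelli_cont)
  qed
  have agree: "Z (Suc n) t = Z n t" if "t \<le> W + real n * \<delta>" for n t
    using that
  proof (induction n arbitrary: t)
    case 0
    then show ?case by (simp add: Z_def tonelli_def)
  next
    case (Suc n)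
    have "integral {W..max W (min t (W + 1))} (field U (Z (Suc n)) \<delta>) = integral {W..max W (min t (W + 1))} (field U (Z n) \<delta>)"
    proof (rule integral_cong)
      fix s assume s: "s \<in> {W..max W (min t (W + 1))}"
      show "field U (Z (Suc n)) \<delta> s = field U (Z n) \<delta> s"
      proof (rule field_cong)
        fix u assume "u \<in> {s-\<delta>-h..s-\<delta>}"
        moreover have "s \<le> W + real (Suc n) * \<delta>" using s Suc.prems \<delta> by (auto simp: max_def min_def split: if_splits)
        ultimately show "Z (Suc n) u = Z n u" by (intro Suc.IH) (auto simp: algebra_simps)
      qed
    qed
    then show ?case unfolding Z_Suc[of "Suc n"] Z_Suc[of n] tonelli_def by simp
  qed
  obtain n where n: "1 < real n * \<delta>" using reals_Archimedean3 \<delta> by blast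
  have "field U (Z (Suc n)) \<delta> s = field U (Z n) \<delta> s" if "s \<in> {W..W+1}" for s
    by (rule field_cong, rule agree) (use that n \<delta> in auto)
  then have "integral {W..max W (min t (W + 1))} (field U (Z (Suc n)) \<delta>) = integral {W..max W (min t (W + 1))} (field U (Z n) \<delta>)" for t
    by (intro integral_cong) (auto simp: max_def min_def split: if_splits)
  then have "tonelli U W X \<delta> (Z (Suc n)) = Z (Suc n)"
    unfolding Z_Suc[of n] by (simp add: tonelli_def fun_eq_iff)
  then show thesis using Zc[of "Suc n"] that by metis
qed

text \<open>Arzela-Ascoli is applied to the exponential factors as the lag tends to 0; the
  increments of the indefinite integral \<open>P\<close> of the common majorant make them
  equicontinuous. The same majorant carries the integral equation to the limit.\<close>

lemma ex_solution:
  assumes Xb: "\<And>t. t \<le> W \<Longrightarrow> 0 \<le> X t \<and> X t \<le> U"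
  obtains z where "continuous_on UNIV z" "z = tonelli U W X 0 z"
proof -
  define \<delta> where "\<delta> n = 1 / real (Suc n)" for n
  have \<delta>0: "\<delta> n > 0" for n by (simp add: \<delta>_def)
  have \<delta>lim: "\<delta> \<longlonglongrightarrow> 0" unfolding \<delta>_def using LIMSEQ_inverse_real_of_nat by (simp add: inverse_eq_divide)
  have "\<exists>z. continuous_on UNIV z \<and> z = tonelli U W X (\<delta> n) z" for n
    using ex_tonelli_solution[OF \<delta>0[of n]] by blast
  then obtain zz where zz: "\<And>n. continuous_on UNIV (zz n)" "\<And>n. zz n = tonelli U W X (\<delta> n) (zz n)" by metis
  define S where "S = {W..W+1}"
  define E where "E n t = exp (integral {W..t} (field U (zz n) (\<delta> n)))" for n t
  define P where "P t = integral {W..t} m" for t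
  have mi: "m integrable_on {p..q}" for p q by (intro set_lebesgue_integral_eq_integral m_abs_int) simp
  have Pcont: "continuous_on S P" unfolding P_def S_def by (intro indefinite_integral_continuous_1 mi)
  define B where "B = P (W + 1)"
  have inc: "\<bar>integral {W..t} (field U (zz n) (\<delta> n)) - integral {W..s} (field U (zz n) (\<delta> n))\<bar> \<le> P t - P s"
    if "W \<le> s" "s \<le> t" "t \<le> W + 1" for n s t
  proof -
    have "integral {W..s} (field U (zz n) (\<delta> n)) + integral {s..t} (field U (zz n) (\<delta> n)) = integral {W..t} (field U (zz n) (\<delta> n))"
      using that by (intro Henstock_Kurzweil_Integration.integral_combine field_int zz) auto
    moreover have "P s + integral {s..t} m = P t"
      unfolding P_def using that by (intro Henstock_Kurzweil_Integration.integral_combine mi) auto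
    moreover have "norm (integral {s..t} (field U (zz n) (\<delta> n))) \<le> integral {s..t} m"
      using that by (intro integral_norm_bound_integral field_int zz mi) (auto intro!: field_bound)
    ultimately show ?thesis by (simp add: algebra_simps)
  qed
  have PB: "P t \<le> B" if "t \<in> S" for t
    using inc[of t "W+1" 0] that by (auto simp: B_def S_def)
  have le: "integral {W..t} (field U (zz n) (\<delta> n)) \<le> B" if "t \<in> S" for n t
    using inc[of W t n] PB[OF that] that by (auto simp: S_def P_def)
  have "\<bar>E n t - E n s\<bar> \<le> exp B * \<bar>P t - P s\<bar>" if "s \<in> S" "t \<in> S" for n s t
  proof -
    have "\<bar>E n t - E n s\<bar> \<le> exp B * \<bar>integral {W..t} (field U (zz n) (\<delta> n)) - integral {W..s} (field U (zz n) (\<delta> n))\<bar>"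
      unfolding E_def using le that by (intro abs_exp_diff_le) auto
    also have "\<dots> \<le> exp B * \<bar>P t - P s\<bar>"
      using inc[of s t n] inc[of t s n] that by (intro mult_left_mono; cases "s \<le> t") (auto simp: S_def)
    finally show ?thesis .
  qed note Einc = this
  obtain g k where g: "continuous_on S g" and k: "strict_mono (k :: nat \<Rightarrow> nat)"
    and lim: "\<And>e. 0 < e \<Longrightarrow> \<exists>N. \<forall>n x. n \<ge> N \<and> x \<in> S \<longrightarrow> norm (E (k n) x - g x) < e"
  proof (rule Arzela_Ascoli[of S E "exp B"])
    show "compact S" by (simp add: S_def)
    show "norm (E n x) \<le> exp B" if "x \<in> S" for n x using le[OF that] by (simp add: E_def)
    fix x e :: real assume x: "x \<in> S" "0 < e"
    have "0 < e / exp B" using x by simp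
    then obtain d where d: "d > 0" "\<And>y. y \<in> S \<Longrightarrow> dist y x < d \<Longrightarrow> dist (P y) (P x) < e / exp B"
      using Pcont x(1) unfolding continuous_on_iff by blast
    have "norm (E n x - E n y) < e" if "y \<in> S" "norm (x - y) < d" for n y
    proof -
      have "\<bar>P x - P y\<bar> < e / exp B" using d(2)[of y] that by (simp add: dist_real_def abs_minus_commute)
      then have "exp B * \<bar>P x - P y\<bar> < e" by (simp add: pos_less_divide_eq mult.commute)
      then show ?thesis using Einc[OF that(1) x(1), of n] by simp
    qed
    then show "\<exists>d>0. \<forall>n y. y \<in> S \<and> norm (x - y) < d \<longrightarrow> norm (E n x - E n y) < e"
      using d(1) by blast
  qed (rule that, assumption+)
  define c where "c t = max W (min t (W + 1))" for t
  have cS: "c t \<in> S" for t by (auto simp: c_def S_def)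
  define z where "z t = X (min t W) * g (c t)" for t
  have zzE: "zz n t = X (min t W) * E n (c t)" for n t
    by (subst zz(2)) (simp add: tonelli_def E_def c_def)
  have zc: "continuous_on UNIV z"
    unfolding z_def using cS
    by (intro continuous_intros continuous_on_compose2[OF X] continuous_on_compose2[OF g])
       (auto simp: c_def intro!: continuous_intros)
  \<comment> \<open>Uniform on the whole line, because time enters the factors only through
    \<open>c t\<close> and \<open>X\<close> is bounded by \<open>U\<close> up to
    \<open>W\<close>.\<close>
  have unif: "\<forall>\<^sub>F n in sequentially. \<forall>t. \<bar>zz (k n) t - z t\<bar> \<le> e" if "e > 0" for e
  proof -
    have "0 < e / (U + 1)" using that U by simp
    from lim[OF this] obtain N where N: "\<And>n x. n \<ge> N \<Longrightarrow> x \<in> S \<Longrightarrow> \<bar>E (k n) x - g x\<bar> < e / (U + 1)" by auto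
    have "\<bar>zz (k n) t - z t\<bar> \<le> e" if "n \<ge> N" for n t
    proof -
      have "\<bar>zz (k n) t - z t\<bar> = \<bar>X (min t W)\<bar> * \<bar>E (k n) (c t) - g (c t)\<bar>"
        by (simp add: zzE z_def abs_mult flip: right_diff_distrib)
      also have "\<dots> \<le> (U + 1) * (e / (U + 1))"
        using Xb[of "min t W"] N[OF that cS, of t] U by (intro mult_mono) auto
      also have "\<dots> = e" using U by simp
      finally show ?thesis .
    qed
    then show ?thesis by (auto simp: eventually_sequentially)
  qed
  have flim: "(\<lambda>n. field U (zz (k n)) (\<delta> (k n)) s) \<longlonglongrightarrow> field U z 0 s" if s: "s \<in> S" for s
  proof -
    have s0: "0 \<le> s" using s W by (auto simp: S_def)
    have sl: "(\<lambda>n. s - \<delta> (k n)) \<longlonglongrightarrow> s"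
      using LIMSEQ_subseq_LIMSEQ[OF \<delta>lim k] by (auto simp: o_def intro!: tendsto_eq_intros)
    have "(\<lambda>n. L s (segment h (zz (k n)) (s - \<delta> (k n)))) \<longlonglongrightarrow> L s (segment h z s)"
    proof (rule L_segment_tendsto[OF s0 zc zz(1)])
      fix e :: real assume "e > 0"
      then have "e / 2 > 0" by simp
      from unif[OF this] continuous_shift_close[OF zc sl this]
      show "\<forall>\<^sub>F n in sequentially. \<forall>\<theta>\<in>{-h..0}. \<bar>zz (k n) (s - \<delta> (k n) + \<theta>) - z (s + \<theta>)\<bar> \<le> e"
      proof eventually_elim
        case (elim n)
        show ?case
        proof
          fix \<theta> assume "\<theta> \<in> {-h..0}"
          then have "\<bar>zz (k n) (s - \<delta> (k n) + \<theta>) - z (s - \<delta> (k n) + \<theta>)\<bar> \<le> e / 2"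
            "\<bar>z (s - \<delta> (k n) + \<theta>) - z (s + \<theta>)\<bar> \<le> e / 2" using elim by blast+
          then show "\<bar>zz (k n) (s - \<delta> (k n) + \<theta>) - z (s + \<theta>)\<bar> \<le> e" by linarith
        qed
      qed
    qed
    then show ?thesis using s0
      unfolding field_def feedback_def clamp_def by (auto intro!: g_tendsto tendsto_intros)
  qed
  have "g t = exp (integral {W..t} (field U z 0))" if t: "t \<in> S" for t
  proof (rule LIMSEQ_unique)
    have sub: "{W..t} \<subseteq> {W..W+1}" using t by (auto simp: S_def)
    have "(\<lambda>n. integral {W..t} (field U (zz (k n)) (\<delta> (k n)))) \<longlonglongrightarrow> integral {W..t} (field U z 0)"
    proof (rule dominated_convergence(2)[where h = m])
      show "field U (zz (k n)) (\<delta> (k n)) integrable_on {W..t}" for n by (rule field_int[OF zz(1) sub])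
      show "m integrable_on {W..t}" by (rule mi)
      show "norm (field U (zz (k n)) (\<delta> (k n)) x) \<le> m x" if "x \<in> {W..t}" for n x
        using field_bound[of x] that sub by auto
      show "(\<lambda>n. field U (zz (k n)) (\<delta> (k n)) x) \<longlonglongrightarrow> field U z 0 x" if "x \<in> {W..t}" for x
        using flim[of x] that sub by (auto simp: S_def)
    qed
    then show "(\<lambda>n. E (k n) t) \<longlonglongrightarrow> exp (integral {W..t} (field U z 0))"
      unfolding E_def by (intro tendsto_intros)
    show "(\<lambda>n. E (k n) t) \<longlonglongrightarrow> g t"
      unfolding LIMSEQ_iff using lim t by blast
  qed
  then have "z = tonelli U W X 0 z"
    using cS by (simp add: fun_eq_iff z_def tonelli_def c_def)
  with zc show thesis by (rule that)
qed

end

end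

section \<open>Global existence\<close>

lemma abs_ln_diff_le:
  fixes x y c :: real
  assumes "0 < c" "c \<le> x" "c \<le> y"
  shows "\<bar>ln x - ln y\<bar> \<le> 1 / c * \<bar>x - y\<bar>"
proof -
  have *: "ln x - ln y \<le> 1 / c * \<bar>x - y\<bar>" if "c \<le> x" "c \<le> y" for x y
  proof (cases "x \<le> y")
    case True
    then have "ln x \<le> ln y" using that assms by simp
    moreover have "0 \<le> 1 / c * \<bar>x - y\<bar>" using assms by simp
    ultimately show ?thesis by linarith
  next
    case False
    have "ln x - ln y = ln (x / y)" using that assms by (simp add: ln_div)
    also have "\<dots> \<le> x / y - 1" using that assms by (intro ln_le_minus_one) auto
    also have "\<dots> = 1 / y * (x - y)" using that assms by (simp add: field_simps)
    also have "\<dots> \<le> 1 / c * (x - y)" using that assms False by (intro mult_right_mono divide_left_mono) auto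
    finally show ?thesis using False by simp
  qed
  show ?thesis using *[OF assms(2,3)] *[OF assms(3,2)] by (auto simp: abs_minus_commute abs_le_iff)
qed

lemma integrable_imp_integrable_on: "integrable lebesgue m \<Longrightarrow> m integrable_on {p..q}"
  for m :: "real \<Rightarrow> real"
  by (rule set_lebesgue_integral_eq_integral(1)) (unfold set_integrable_def, rule integrable_mult_indicator, simp_all)

lemma ereal_less_downward: "ereal t < \<omega> \<Longrightarrow> u \<le> t \<Longrightarrow> ereal u < \<omega>"
  by (rule le_less_trans[of _ "ereal t"]) simp_all

context delay_equation
begin

lemma solution_continuous_on:
  assumes "solution_on h lam f L \<omega> x" "- h \<le> p" "ereal q < \<omega>"
  shows "continuous_on {p..q} x"
proof (rule continuous_on_subset)
  show "continuous_on {t. -h \<le> t \<and> ereal t < \<omega>} x" using assms(1) by (simp add: solution_on_def)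
  show "{p..q} \<subseteq> {t. -h \<le> t \<and> ereal t < \<omega>}" using assms(2,3) by (auto intro: ereal_less_downward)
qed

text \<open>On a compact interval a positive \<open>x\<close> has a positive minimum, so
  \<open>ln\<close> is Lipschitz on its range and \<open>ln x\<close> inherits absolute
  continuity.\<close>

lemma solution_ln_has_integral:
  assumes sol: "solution_on h lam f L \<omega> x" and st: "0 \<le> s" "s \<le> t" "ereal t < \<omega>"
    and pos: "\<And>u. u \<in> {s..t} \<Longrightarrow> 0 < x u"
  shows "((\<lambda>u. rhs u (L u (segment h x u))) has_integral (ln (x t) - ln (x s))) {s..t}"
proof -
  have cont: "continuous_on {s..t} x" using solution_continuous_on[OF sol _ st(3)] st(1) h_pos by simp
  obtain u0 where u0: "u0 \<in> {s..t}" "\<And>u. u \<in> {s..t} \<Longrightarrow> x u0 \<le> x u"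
    using continuous_attains_inf[OF compact_Icc _ cont] st(2) by auto
  have ac: "abs_continuous_on {0..t} x" using sol st by (simp add: solution_on_def)
  have ac_ln: "abs_continuous_on {s..t} (\<lambda>u. ln (x u))"
  proof (rule abs_continuous_on_mono[OF ac])
    show "\<bar>ln (x v) - ln (x u)\<bar> \<le> 1 / x u0 * \<bar>x v - x u\<bar>" if "u \<in> {s..t}" "v \<in> {s..t}" for u v
      using that by (intro abs_ln_diff_le pos u0)
  qed (use st pos[OF u0(1)] in auto)
  have "AE u in lebesgue. 0 \<le> u \<and> ereal u < \<omega> \<longrightarrow>
        (x has_real_derivative lam u * x u * f u (L u (segment h x u))) (at u)"
    using sol by (simp add: solution_on_def)
  then obtain N where N: "N \<in> null_sets lebesgue" "\<And>u. u \<notin> N \<Longrightarrow> 0 \<le> u \<Longrightarrow> ereal u < \<omega> \<Longrightarrow>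
        (x has_real_derivative lam u * x u * f u (L u (segment h x u))) (at u)"
    unfolding eventually_ae_filter by auto
  show ?thesis
  proof (rule has_integral_abs_continuous[OF ac_ln st(2)])
    show "negligible N" using N by (simp add: negligible_iff_null_sets)
    fix u assume u: "u \<in> {s..t} - N"
    have "0 \<le> u" "ereal u < \<omega>" using u st by (auto intro: ereal_less_downward)
    then have "(x has_real_derivative lam u * x u * f u (L u (segment h x u))) (at u within {s..t})"
      using N(2)[of u] u by (blast intro: has_field_derivative_at_within)
    then have "((\<lambda>u. ln (x u)) has_real_derivative inverse (x u) * (lam u * x u * f u (L u (segment h x u)))) (at u within {s..t})"
      using pos[of u] u by (auto intro!: derivative_eq_intros simp: divide_inverse)
    moreover have "inverse (x u) * (lam u * x u * f u (L u (segment h x u))) = rhs u (L u (segment h x u))"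
      using pos[of u] u \<open>0 \<le> u\<close> by (simp add: rhs_def)
    ultimately show "((\<lambda>u. ln (x u)) has_real_derivative rhs u (L u (segment h x u))) (at u within {s..t})"
      by simp
  qed
qed

lemma solution_ln_abs_le:
  assumes "solution_on h lam f L \<omega> x" "0 \<le> s" "s \<le> t" "ereal t < \<omega>"
    and "\<And>u. u \<in> {s..t} \<Longrightarrow> 0 < x u"
    and m: "m integrable_on {s..t}" "\<And>u. u \<in> {s..t} \<Longrightarrow> \<bar>rhs u (L u (segment h x u))\<bar> \<le> m u"
  shows "\<bar>ln (x t) - ln (x s)\<bar> \<le> integral {s..t} m"
proof -
  note I = solution_ln_has_integral[OF assms(1-5)]
  have "norm (integral {s..t} (\<lambda>u. rhs u (L u (segment h x u)))) \<le> integral {s..t} m"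
    using I m by (intro integral_norm_bound_integral) auto
  then show ?thesis using integral_unique[OF I] by simp
qed

lemma solution_L_bounds:
  assumes "solution_on h lam f L \<omega> x" "0 \<le> u" "ereal u < \<omega>"
    and "\<And>v. v \<in> {u-h..u} \<Longrightarrow> x v \<le> q"
  shows "0 \<le> L u (segment h x u)" "L u (segment h x u) \<le> q"
proof -
  have c: "continuous_on {u-h..u} x" using solution_continuous_on[OF assms(1) _ assms(3)] assms(2) by simp
  have "0 \<le> x v" if "v \<in> {u-h..u}" for v
  proof -
    have "- h \<le> v" "ereal v < \<omega>" using ereal_less_downward[OF assms(3), of v] assms(2) that by auto
    then show ?thesis using assms(1) by (simp add: solution_on_def)
  qed
  then show "0 \<le> L u (segment h x u)" "L u (segment h x u) \<le> q"
    using L_bounds[OF assms(2) c, of 0 q] assms(4) by auto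
qed

text \<open>The feedback is bounded on \<open>[0, b]\<close>, so \<open>ln x\<close> changes by at
  most the integral \<open>P\<close> of a majorant while \<open>x\<close> is positive. Positivity
  therefore spreads from a single point \<open>t1\<close> in both directions; the forward direction
  is the backward one with time reversed.\<close>

lemma solution_positive:
  assumes sol: "solution_on h lam f L \<omega> x" and nt: "nontrivial_on \<omega> x" and t: "0 \<le> t" "ereal t < \<omega>"
  shows "0 < x t"
proof -
  obtain t1 where t1: "0 \<le> t1" "ereal t1 < \<omega>" "x t1 \<noteq> 0" using nt by (auto simp: nontrivial_on_def)
  then have x1: "0 < x t1" using sol h_pos by (simp add: solution_on_def less_le)
  define b where "b = max t t1"
  have b: "ereal b < \<omega>" "0 \<le> b" "t \<le> b" "t1 \<le> b" using t t1 by (auto simp: b_def max_def)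
  have cb: "continuous_on {-h..b} x" by (rule solution_continuous_on[OF sol order_refl b(1)])
  obtain B where B: "\<And>v. v \<in> {-h..b} \<Longrightarrow> x v \<le> B"
    using continuous_attains_sup[OF compact_Icc _ cb] b h_pos by fastforce
  obtain m where m: "integrable lebesgue m" "\<And>s. 0 \<le> m s" "\<And>s u. s \<in> {0..b} \<Longrightarrow> u \<in> {0..B} \<Longrightarrow> \<bar>rhs s u\<bar> \<le> m s"
    by (rule integrable_domination[of 0 b 0 B], rule that, assumption+)
  have mi: "m integrable_on {p..q}" for p q by (rule integrable_imp_integrable_on[OF m(1)])
  have bd: "\<bar>rhs u (L u (segment h x u))\<bar> \<le> m u" if "u \<in> {0..b}" for u
  proof (rule m(3)[OF that])
    have "ereal u < \<omega>" using that ereal_less_downward[OF b(1)] by simp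
    then show "L u (segment h x u) \<in> {0..B}"
      using solution_L_bounds[OF sol, of u B] B that by auto
  qed
  define P where "P = integral {0..b} m"
  have inc: "\<bar>ln (x v) - ln (x u)\<bar> \<le> P" if "0 \<le> u" "u \<le> v" "v \<le> b" "\<And>s. s \<in> {u..v} \<Longrightarrow> 0 < x s" for u v
  proof -
    have "\<bar>ln (x v) - ln (x u)\<bar> \<le> integral {u..v} m"
      using that b(1) by (intro solution_ln_abs_le[OF sol] mi bd) (auto intro: ereal_less_downward)
    also have "\<dots> \<le> P" unfolding P_def using that m(2) by (intro integral_subset_le mi) auto
    finally show ?thesis .
  qed
  define \<epsilon> where "\<epsilon> = exp (ln (x t1) - P)"
  have ge: "\<epsilon> \<le> x v" if "ln (x t1) - P \<le> ln (x v)" "0 < x v" for v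
    using that by (simp add: \<epsilon>_def flip: ln_ge_iff)
  show ?thesis
  proof (cases "t \<le> t1")
    case True
    show ?thesis
    proof (rule positive_backwards[of t t1 x \<epsilon>])
      show "continuous_on {t..t1} x" by (rule continuous_on_subset[OF cb]) (use t b h_pos in auto)
      show "\<epsilon> \<le> x s" if s: "s \<in> {t..t1}" "\<And>u. u \<in> {s..t1} \<Longrightarrow> 0 < x u" for s
        using inc[of s t1] s t b by (intro ge) auto
    qed (use True x1 in \<open>auto simp: \<epsilon>_def\<close>)
  next
    case False
    have "0 < x (- (- t))"
    proof (rule positive_backwards[of "-t" "-t1" "\<lambda>s. x (- s)" \<epsilon>])
      show "continuous_on {-t..-t1} (\<lambda>s. x (- s))"
        by (rule continuous_on_compose2[OF cb]) (use t1 b h_pos in \<open>auto intro!: continuous_intros\<close>)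
      show "\<epsilon> \<le> x (- s)" if s: "s \<in> {-t..-t1}" "\<And>u. u \<in> {s..-t1} \<Longrightarrow> 0 < x (- u)" for s
      proof -
        have p: "0 < x u" if "u \<in> {t1..-s}" for u using s(2)[of "- u"] that by auto
        then show ?thesis using inc[of t1 "- s"] s t1 b by (intro ge) auto
      qed
    qed (use False x1 in \<open>auto simp: \<epsilon>_def\<close>)
    then show ?thesis by simp
  qed
qed

lemma maximal_solution_global:
  assumes max: "maximal_solution h lam f L \<omega> x" and nt: "nontrivial_on \<omega> x"
  shows "\<omega> = \<infinity>"
proof (rule ccontr)
  assume "\<omega> \<noteq> \<infinity>"
  have sol: "solution_on h lam f L \<omega> x" using max by (simp add: maximal_solution_def)
  then have "0 < \<omega>" by (simp add: solution_on_def)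
  then obtain W where W: "\<omega> = ereal W" "0 < W" using \<open>\<omega> \<noteq> \<infinity>\<close> by (cases \<omega>) auto
  have pos: "0 < x t" if "0 \<le> t" "t < W" for t using solution_positive[OF sol nt] that W by simp
  have nn: "0 \<le> x t" if "- h \<le> t" "t < W" for t using sol that W by (simp add: solution_on_def)
  have xc: "continuous_on {-h..<W} x"
  proof -
    have "{t. -h \<le> t \<and> ereal t < \<omega>} = {-h..<W}" using W by auto
    then show ?thesis using sol by (simp add: solution_on_def)
  qed
  have "continuous_on {-h..0} x" by (rule continuous_on_subset[OF xc]) (use W in auto)
  then obtain B0 where B0: "\<And>v. v \<in> {-h..0} \<Longrightarrow> x v \<le> B0"
    using continuous_attains_sup[OF compact_Icc, of "-h" 0 x] h_pos by fastforce
  \<comment> \<open>Boundedness needs no growth condition: \<open>rhs\<close> is nonpositive for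
    arguments above 1, and for arguments in \<open>[0, 1]\<close> the majorant \<open>m1\<close>
    applies.\<close>
  obtain m1 where m1: "integrable lebesgue m1" "\<And>s. 0 \<le> m1 s" "\<And>s u. s \<in> {0..W} \<Longrightarrow> u \<in> {0..1} \<Longrightarrow> \<bar>rhs s u\<bar> \<le> m1 s"
    by (rule integrable_domination[of 0 W 0 1], rule that, assumption+)
  define B where "B = max B0 (exp (ln (x 0) + integral {0..W} m1))"
  have xB: "x t \<le> B" if t: "- h \<le> t" "t < W" for t
  proof (cases "t \<le> 0")
    case True
    then show ?thesis using B0[of t] t by (simp add: B_def)
  next
    case False
    have "ln (x t) - ln (x 0) \<le> integral {0..t} m1"
    proof (rule has_integral_le[OF solution_ln_has_integral[OF sol]])
      show "(m1 has_integral integral {0..t} m1) {0..t}"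
        using integrable_imp_integrable_on[OF m1(1)] by blast
      show "rhs u (L u (segment h x u)) \<le> m1 u" if u: "u \<in> {0..t}" for u
      proof (cases "L u (segment h x u) \<le> 1")
        case True
        have cu: "continuous_on {u-h..u} x" by (rule continuous_on_subset[OF xc]) (use u t in auto)
        have "0 \<le> L u (segment h x u)"
        proof -
          obtain q where q: "\<And>v. v \<in> {u-h..u} \<Longrightarrow> x v \<le> q"
            using continuous_attains_sup[OF compact_Icc _ cu] h_pos by fastforce
          show ?thesis by (rule solution_L_bounds(1)[OF sol _ _ q]) (use u t W in auto)
        qed
        then show ?thesis using m1(3)[of u "L u (segment h x u)"] u t True by auto
      next
        case False
        then show ?thesis using rhs_sign(1)[of "L u (segment h x u)" u] m1(2)[of u] by linarith
      qed
    qed (use False t W pos in auto)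
    also have "\<dots> \<le> integral {0..W} m1"
      using t m1(2) by (intro integral_subset_le integrable_imp_integrable_on m1) auto
    finally have "ln (x t) \<le> ln (x 0) + integral {0..W} m1" by simp
    then have "x t \<le> exp (ln (x 0) + integral {0..W} m1)"
      using pos[of t] False t by (metis exp_ln exp_le_cancel_iff less_imp_le not_le)
    then show ?thesis by (simp add: B_def)
  qed
  have "0 < B" using pos[of 0] xB[of 0] W h_pos by force
  \<comment> \<open>The unit of room above \<open>B\<close> keeps the continuation below
    \<open>U\<close> for a short time after \<open>W\<close>, so that the clamp is inactive
    there.\<close>
  define U where "U = B + 1"
  obtain m where m: "integrable lebesgue m" "\<And>s. 0 \<le> m s" "\<And>s u. s \<in> {0..W+1} \<Longrightarrow> u \<in> {0..U} \<Longrightarrow> \<bar>rhs s u\<bar> \<le> m s"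
    by (rule integrable_domination[of 0 "W+1" 0 U], rule that, assumption+)
  note mi = integrable_imp_integrable_on[OF m(1)]
  have inc: "\<bar>ln (x t) - ln (x s)\<bar> \<le> integral {s..t} m" if "0 \<le> s" "s \<le> t" "t < W" for s t
  proof (rule solution_ln_abs_le[OF sol that(1,2) _ _ mi])
    show "\<bar>rhs u (L u (segment h x u))\<bar> \<le> m u" if u: "u \<in> {s..t}" for u
      using solution_L_bounds[OF sol, of u B] xB u \<open>0 \<le> s\<close> \<open>t < W\<close> W
      by (intro m(3)) (auto simp: U_def)
  qed (use that W pos in auto)
  define P where "P t = integral {0..t} m" for t
  have Pst: "integral {s..t} m = P t - P s" if "0 \<le> s" "s \<le> t" for s t
    using Henstock_Kurzweil_Integration.integral_combine[OF that mi] by (simp add: P_def)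
  have Pcont: "continuous_on {0..T} P" for T unfolding P_def by (intro indefinite_integral_continuous_1 mi)
  \<comment> \<open>Working with \<open>ln x\<close> rather than \<open>x\<close> yields a limit at
    \<open>W\<close> of the form \<open>exp l\<close>, which is positive.\<close>
  have "uniformly_continuous_on {0..<W} (\<lambda>t. ln (x t))"
    unfolding uniformly_continuous_on_def
  proof (intro allI impI)
    fix e :: real assume "e > 0"
    have "uniformly_continuous_on {0..W} P" by (intro compact_uniformly_continuous Pcont) auto
    then obtain d where d: "d > 0" "\<And>s t. s \<in> {0..W} \<Longrightarrow> t \<in> {0..W} \<Longrightarrow> dist t s < d \<Longrightarrow> dist (P t) (P s) < e"
      unfolding uniformly_continuous_on_def using \<open>e > 0\<close> by metis
    have "dist (ln (x t)) (ln (x s)) < e" if "s \<in> {0..<W}" "t \<in> {0..<W}" "dist t s < d" for s t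
      using d(2)[of s t] inc[of s t] inc[of t s] Pst[of s t] Pst[of t s] that
      by (cases "s \<le> t") (auto simp: dist_real_def abs_minus_commute)
    then show "\<exists>d>0. \<forall>s\<in>{0..<W}. \<forall>t\<in>{0..<W}. dist t s < d \<longrightarrow> dist (ln (x t)) (ln (x s)) < e"
      using d(1) by blast
  qed
  moreover have "W \<in> closure {0..<W}" using W by simp
  ultimately obtain l where l: "((\<lambda>t. ln (x t)) \<longlongrightarrow> l) (at W within {0..<W})"
    by (rule uniformly_continuous_on_extension_at_closure)
  have "at W within {0..<W} = at_left W"
    by (rule at_within_nhd[of _ "{0<..}"]) (use W in auto)
  then have l: "((\<lambda>t. ln (x t)) \<longlongrightarrow> l) (at_left W)" using l by simp
  have ev: "\<forall>\<^sub>F t in at_left W. 0 < t \<and> t < W"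
    using W by (auto simp: eventually_at_left intro!: exI[of _ 0])
  define xb where "xb t = (if t < W then x t else exp l)" for t
  have xb_lim: "(xb \<longlongrightarrow> exp l) (at_left W)"
  proof (rule Lim_transform_eventually)
    show "((\<lambda>t. exp (ln (x t))) \<longlongrightarrow> exp l) (at_left W)" by (intro tendsto_intros l)
    show "\<forall>\<^sub>F t in at_left W. exp (ln (x t)) = xb t"
      using ev by eventually_elim (use pos in \<open>auto simp: xb_def\<close>)
  qed
  have xbc: "continuous_on {-h..W} xb"
    unfolding continuous_on_def
  proof
    fix t assume t: "t \<in> {-h..W}"
    show "(xb \<longlongrightarrow> xb t) (at t within {-h..W})"
    proof (cases "t < W")
      case True
      have "continuous_on {-h..<W} xb"
        using xc by (rule continuous_on_eq) (simp add: xb_def)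
      moreover have "at t within {-h..W} = at t within {-h..<W}"
        by (rule at_within_nhd[of _ "{..<W}"]) (use True in auto)
      ultimately show ?thesis using t True by (simp add: continuous_on_def)
    next
      case False
      then have "t = W" using t by simp
      moreover have "at W within {-h..W} = at_left W" using W h_pos by (intro at_within_Icc_at_left) simp
      ultimately show ?thesis using xb_lim by (simp add: xb_def)
    qed
  qed
  have xbB: "0 \<le> xb t \<and> xb t \<le> B" if "t \<in> {-h..W}" for t
  proof (cases "t < W")
    case True
    then show ?thesis using xB nn that by (simp add: xb_def)
  next
    case False
    have "exp l \<le> B"
    proof (rule tendsto_upperbound[OF xb_lim])
      show "\<forall>\<^sub>F t in at_left W. xb t \<le> B"
        using ev by eventually_elim (use xB h_pos in \<open>auto simp: xb_def\<close>)
    qed simp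
    then show ?thesis using False by (simp add: xb_def)
  qed
  define X where "X t = xb (max (- h) (min t W))" for t
  have clampW: "max (- h) (min t W) \<in> {-h..W}" for t using W h_pos by auto
  have Xc: "continuous_on UNIV X"
    unfolding X_def by (rule continuous_on_compose2[OF xbc]) (use clampW in \<open>auto intro!: continuous_intros\<close>)
  have XB: "0 \<le> X t \<and> X t \<le> B" for t unfolding X_def using xbB[OF clampW] .
  have Xx: "X t = x t" if "- h \<le> t" "t < W" for t using that W by (simp add: X_def xb_def)
  have XW: "X W = exp l" using W h_pos by (simp add: X_def xb_def)
  have hyps: "0 \<le> U" "0 \<le> W" using \<open>0 < B\<close> W by (auto simp: U_def)
  have XU: "0 \<le> X t \<and> X t \<le> U" for t using XB[of t] by (simp add: U_def)
  obtain z where z: "continuous_on UNIV z" "z = tonelli U W X 0 z"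
  proof (rule ex_solution[OF hyps Xc m(1,2)])
    show "\<bar>rhs s u\<bar> \<le> m s" if "s \<in> {0..W+1}" "u \<in> {0..U}" for s u using that by (rule m(3))
    show "0 \<le> X t \<and> X t \<le> U" for t by (rule XU)
  qed (rule that, assumption+)
  have z_eq: "z t = X (min t W) * exp (integral {W..max W (min t (W + 1))} (field U z 0))" for t
    using fun_cong[OF z(2), of t] by (simp add: tonelli_def)
  have zX: "z t = X t" if "t \<le> W" for t using z_eq[of t] that by simp
  have zI: "z t = X W * exp (integral {W..t} (field U z 0))" if "t \<in> {W..W+1}" for t
    using z_eq[of t] that by (auto simp: max_def min_def)
  have z0: "0 \<le> z t" for t using z_eq[of t] XU by (simp add: mult_nonneg_nonneg)
  have "isCont z W" using z(1) by (simp add: continuous_on_eq_continuous_at)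
  then have "\<forall>\<^sub>F t in at W. z t < U"
    unfolding isCont_def by (rule order_tendstoD) (use zX[of W] XB[of W] in \<open>simp add: U_def\<close>)
  then obtain d where d: "d > 0" "\<And>t. t \<noteq> W \<Longrightarrow> dist t W < d \<Longrightarrow> z t < U" by (auto simp: eventually_at)
  define \<epsilon> where "\<epsilon> = min (d / 2) 1"
  have \<epsilon>: "0 < \<epsilon>" "\<epsilon> \<le> 1" "\<epsilon> < d" using d(1) by (auto simp: \<epsilon>_def)
  have zU: "z t \<le> U" if "t \<le> W + \<epsilon>" for t
  proof (cases "t \<le> W")
    case True
    then show ?thesis using zX XU by simp
  next
    case False
    then show ?thesis using d(2)[of t] that \<epsilon> by (simp add: dist_real_def)
  qed
  have field_z: "field U z 0 s = rhs s (L s (segment h z s))" if "s \<in> {W..W+\<epsilon>}" for s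
    using that z0 zU W by (intro field_eq continuous_on_subset[OF z(1)]) auto
  have fai: "field U z 0 absolutely_integrable_on {p..q}" if "{p..q} \<subseteq> {W..W+1}" for p q
    by (rule field_abs_int[OF hyps Xc m(1,2,3) z(1) that])
  have fb: "\<bar>field U z 0 s\<bar> \<le> m s" if "s \<in> {W..W+1}" for s
    by (rule field_bound[OF hyps Xc m(1,2,3) that])
  have fi: "field U z 0 integrable_on {p..q}" if "{p..q} \<subseteq> {W..W+1}" for p q
    using fai[OF that] by (rule set_lebesgue_integral_eq_integral(1))
  \<comment> \<open>One increment bound valid across the junction \<open>W\<close> is what absolute
    continuity of the continued solution requires. It is proved before \<open>W\<close>, extended to
    \<open>W\<close> by closure, proved after \<open>W\<close>, and added up.\<close>
  have zinc: "\<bar>z t - z s\<bar> \<le> U * (P t - P s)" if st: "0 \<le> s" "s \<le> t" "t \<le> W + \<epsilon>" for s t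
  proof -
    have 1: "\<bar>z t - z s\<bar> \<le> U * (P t - P s)" if "0 \<le> s" "s \<le> t" "t < W" for s t
    proof -
      have "\<bar>exp (ln (x t)) - exp (ln (x s))\<bar> \<le> U * \<bar>ln (x t) - ln (x s)\<bar>"
        using that pos[of s] pos[of t] xB[of s] xB[of t] h_pos by (intro abs_exp_diff_le) (auto simp: U_def)
      also have "\<dots> \<le> U * (P t - P s)" using inc[OF that] Pst[OF that(1,2)] hyps by (intro mult_left_mono) auto
      finally show ?thesis
        using pos[of s] pos[of t] zX[of s] zX[of t] Xx[of s] Xx[of t] that h_pos by simp
    qed
    have 2: "\<bar>z W - z s\<bar> \<le> U * (P W - P s)" if "0 \<le> s" "s \<le> W" for s
    proof (cases "s = W")
      case False
      then have "s < W" using that by simp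
      then have cl: "closure {s..<W} = {s..W}" by simp
      have "0 \<le> U * (P W - P s) - \<bar>z W - z s\<bar>"
      proof (rule continuous_ge_on_closure[of "{s..<W}" "\<lambda>t. U * (P t - P s) - \<bar>z t - z s\<bar>"])
        show "continuous_on (closure {s..<W}) (\<lambda>t. U * (P t - P s) - \<bar>z t - z s\<bar>)"
          unfolding cl using that
          by (intro continuous_intros continuous_on_subset[OF z(1)] continuous_on_subset[OF Pcont[of W]]) auto
        show "W \<in> closure {s..<W}" unfolding cl using that by simp
        show "0 \<le> U * (P t - P s) - \<bar>z t - z s\<bar>" if "t \<in> {s..<W}" for t
          using 1[of s t] that \<open>0 \<le> s\<close> by simp
      qed
      then show ?thesis by simp
    qed simp
    have 3: "\<bar>z t - z s\<bar> \<le> U * (P t - P s)" if "W \<le> s" "s \<le> t" "t \<le> W + \<epsilon>" for s t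
    proof -
      let ?I = "\<lambda>t. integral {W..t} (field U z 0)"
      have e: "z u = exp (l + ?I u)" if "u \<in> {W..W+\<epsilon>}" for u
        using zI[of u] that \<epsilon> XW by (simp add: exp_add)
      have "?I s + integral {s..t} (field U z 0) = ?I t"
        using that \<epsilon> by (intro Henstock_Kurzweil_Integration.integral_combine fi) auto
      moreover have "norm (integral {s..t} (field U z 0)) \<le> integral {s..t} m"
        using that \<epsilon> by (intro integral_norm_bound_integral fi mi) (auto intro!: fb)
      ultimately have b: "\<bar>(l + ?I t) - (l + ?I s)\<bar> \<le> P t - P s"
        using Pst[of s t] that W by (simp add: algebra_simps)
      have "\<bar>exp (l + ?I t) - exp (l + ?I s)\<bar> \<le> U * \<bar>(l + ?I t) - (l + ?I s)\<bar>"
        using e[of s] e[of t] zU[of s] zU[of t] that by (intro abs_exp_diff_le) auto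
      also have "\<dots> \<le> U * (P t - P s)" using b hyps by (intro mult_left_mono)
      finally show ?thesis using e[of s] e[of t] that by simp
    qed
    consider "t < W" | "s \<le> W" "W \<le> t" | "W \<le> s" by linarith
    then show ?thesis
    proof cases
      case 2
      have "\<bar>z t - z s\<bar> \<le> \<bar>z t - z W\<bar> + \<bar>z W - z s\<bar>" by simp
      also have "\<dots> \<le> U * (P t - P W) + U * (P W - P s)"
        using \<open>\<And>s. 0 \<le> s \<Longrightarrow> s \<le> W \<Longrightarrow> \<bar>z W - z s\<bar> \<le> U * (P W - P s)\<close>[of s] 3[of W t] 2 st by (intro add_mono) auto
      finally show ?thesis by (simp add: algebra_simps)
    qed (use 1[of s t] 3[of s t] st in auto)
  qed
  have "solution_on h lam f L (ereal (W + \<epsilon>)) z"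
    unfolding solution_on_def
  proof (intro conjI allI impI)
    show "0 < ereal (W + \<epsilon>)" using W \<epsilon> by simp
    show "continuous_on {t. - h \<le> t \<and> ereal t < ereal (W + \<epsilon>)} z" by (rule continuous_on_subset[OF z(1)]) simp
    show "0 \<le> z t" for t by (rule z0)
    show "abs_continuous_on {0..T} z" if T: "0 \<le> T" "ereal T < ereal (W + \<epsilon>)" for T
    proof (rule abs_continuous_on_integral_bound[where k = "\<lambda>u. U * m u"])
      have "integrable lebesgue (\<lambda>u. U * m u)" using m(1) by simp
      from integrable_mult_indicator[OF _ this, of "{0..T}"]
      show "(\<lambda>u. U * m u) absolutely_integrable_on {0..T}"
        by (simp add: set_integrable_def)
      show "0 \<le> U * m t" for t using hyps m(2) by simp
      show "\<bar>z t - z s\<bar> \<le> integral {s..t} (\<lambda>u. U * m u)" if "0 \<le> s" "s \<le> t" "t \<le> T" for s t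
        using zinc[of s t] that T Pst[of s t] by simp
    qed
    have AE1: "AE u in lebesgue. 0 \<le> u \<and> ereal u < \<omega> \<longrightarrow>
        (x has_real_derivative lam u * x u * f u (L u (segment h x u))) (at u)"
      using sol by (simp add: solution_on_def)
    obtain N2 where N2: "negligible N2"
      "\<And>t. t \<in> {W<..<W+1} - N2 \<Longrightarrow> ((\<lambda>t. integral {W..t} (field U z 0)) has_real_derivative field U z 0 t) (at t)"
      by (rule AE_integral_has_derivative[OF fai[OF order_refl]], rule that, assumption+)
    have AE2: "AE u in lebesgue. u \<notin> insert W N2"
      using N2(1) by (intro AE_not_in) (simp add: negligible_iff_null_sets[symmetric])
    from AE1 AE2 show "AE t in lebesgue. 0 \<le> t \<and> ereal t < ereal (W + \<epsilon>) \<longrightarrow>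
        (z has_real_derivative lam t * z t * f t (L t (segment h z t))) (at t)"
    proof (eventually_elim, intro impI)
      fix t assume xd: "0 \<le> t \<and> ereal t < \<omega> \<longrightarrow> (x has_real_derivative lam t * x t * f t (L t (segment h x t))) (at t)"
        and tN: "t \<notin> insert W N2" and t: "0 \<le> t \<and> ereal t < ereal (W + \<epsilon>)"
      show "(z has_real_derivative lam t * z t * f t (L t (segment h z t))) (at t)"
      proof (cases "t < W")
        case True
        have zx: "z u = x u" if "- h \<le> u" "u < W" for u using zX[of u] Xx[of u] that by simp
        have "segment h z t = segment h x t" by (rule segment_cong) (use zx True t in auto)
        moreover have "z t = x t" using zx True t h_pos by simp
        moreover have "(z has_real_derivative lam t * x t * f t (L t (segment h x t))) (at t)"
        proof (rule has_field_derivative_transform_within_open)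
          show "(x has_real_derivative lam t * x t * f t (L t (segment h x t))) (at t)" using xd t True W by simp
          show "open {-h<..<W}" "t \<in> {-h<..<W}" using True t h_pos by auto
          show "x u = z u" if "u \<in> {-h<..<W}" for u using zx that by simp
        qed
        ultimately show ?thesis by simp
      next
        case False
        then have tW: "W < t" "t < W + \<epsilon>" using tN t by auto
        have zd: "(z has_real_derivative X W * (exp (integral {W..t} (field U z 0)) * field U z 0 t)) (at t)"
        proof (rule has_field_derivative_transform_within_open)
          have "((\<lambda>t. integral {W..t} (field U z 0)) has_real_derivative field U z 0 t) (at t)"
            using N2(2)[of t] tN tW \<epsilon> by simp
          then show "((\<lambda>t. X W * exp (integral {W..t} (field U z 0))) has_real_derivative
              X W * (exp (integral {W..t} (field U z 0)) * field U z 0 t)) (at t)"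
            by (intro DERIV_cmult DERIV_fun_exp)
          show "open {W<..<W+1}" "t \<in> {W<..<W+1}" using tW \<epsilon> by auto
          show "X W * exp (integral {W..u} (field U z 0)) = z u" if "u \<in> {W<..<W+1}" for u using zI[of u] that by simp
        qed
        have ze: "X W * exp (integral {W..t} (field U z 0)) = z t" using zI[of t] tW \<epsilon> by simp
        have fe: "field U z 0 t = lam t * f t (L t (segment h z t))"
          using field_z[of t] tW t by (simp add: rhs_def)
        have "X W * (exp (integral {W..t} (field U z 0)) * field U z 0 t) = lam t * z t * f t (L t (segment h z t))"
          unfolding mult.assoc[symmetric] ze fe by simp
        then show ?thesis using zd by (simp only:)
      qed
    qed
  qed
  moreover have "\<omega> < ereal (W + \<epsilon>)" using W \<epsilon> by simp
  moreover have "z t = x t" if "- h \<le> t \<and> ereal t < \<omega>" for t using zX[of t] Xx[of t] that W by simp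
  ultimately show False using max unfolding maximal_solution_def by blast
qed

end

section \<open>Delay inequalities\<close>

text \<open>Continuous induction. It takes the place of a derivative test: each point is compared
  only with points slightly to its right.\<close>

lemma nondecreasing_if_locally_right:
  fixes E :: "real \<Rightarrow> real"
  assumes cont: "continuous_on {a..b} E" and ab: "a \<le> b"
    and loc: "\<And>s. a \<le> s \<Longrightarrow> s < b \<Longrightarrow> \<exists>d>0. \<forall>s'. s < s' \<and> s' < s + d \<and> s' \<le> b \<longrightarrow> E s \<le> E s'"
  shows "E a \<le> E b"
proof -
  define A where "A = {s \<in> {a..b}. E a \<le> E s}"
  have clA: "closed A"
    unfolding A_def by (intro continuous_on_closed_Collect_le continuous_intros cont)
  define c where "c = Sup {t \<in> {a..b}. {a..t} \<subseteq> A}"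
  let ?S = "{t \<in> {a..b}. {a..t} \<subseteq> A}"
  have aS: "a \<in> ?S" using ab by (auto simp: A_def)
  have bdd: "bdd_above ?S" by (rule bdd_aboveI[of _ b]) auto
  have c: "a \<le> c" "c \<le> b"
    unfolding c_def by (rule cSup_upper[OF aS bdd], rule cSup_least) (use aS in auto)
  have lt: "t \<in> A" if "a \<le> t" "t < c" for t
  proof -
    have "?S \<noteq> {}" using aS by blast
    from less_cSupD[OF this, of t] that obtain t' where "t' \<in> ?S" "t < t'"
      unfolding c_def by blast
    then show ?thesis using that by auto
  qed
  have cA: "c \<in> A"
  proof (cases "a = c")
    case True then show ?thesis using aS by auto
  next
    case False
    then have "c \<in> closure {a..<c}" using c by simp
    also have "\<dots> \<subseteq> A" using lt clA by (intro closure_minimal) auto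
    finally show ?thesis .
  qed
  have "c = b"
  proof (rule ccontr)
    assume "c \<noteq> b"
    then have "c < b" using c by simp
    then obtain d where d: "d > 0" "\<And>s'. c < s' \<Longrightarrow> s' < c + d \<Longrightarrow> s' \<le> b \<Longrightarrow> E c \<le> E s'"
      using loc[of c] c by blast
    define t where "t = min b (c + d / 2)"
    have t: "c < t" "t \<le> b" "t < c + d" using d \<open>c < b\<close> by (auto simp: t_def min_def)
    have "s \<in> A" if "s \<in> {a..t}" for s
    proof -
      consider "s < c" | "s = c" | "c < s" by linarith
      then show ?thesis
      proof cases
        case 3
        then have "E c \<le> E s" using d(2)[of s] that t by auto
        then show ?thesis using cA that t by (auto simp: A_def)
      qed (use lt cA that in auto)
    qed
    then have "t \<in> ?S" using t c by auto
    then have "t \<le> c" unfolding c_def by (rule cSup_upper[OF _ bdd])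
    then show False using t by simp
  qed
  then show ?thesis using cA by (simp add: A_def)
qed

text \<open>Replaces a change of variables along the clock \<open>\<sigma>\<close>: neither \<open>z\<close> nor \<open>\<sigma>\<close> need be differentiable.\<close>

lemma comparison_antiderivative:
  fixes z \<sigma> K k :: "real \<Rightarrow> real"
  assumes ab: "a \<le> b" and z: "continuous_on {a..b} z" and \<sigma>: "continuous_on {a..b} \<sigma>"
    and mono: "\<And>s t. a \<le> s \<Longrightarrow> s \<le> t \<Longrightarrow> t \<le> b \<Longrightarrow> \<sigma> s \<le> \<sigma> t"
    and K: "\<And>s. s \<in> {a..b} \<Longrightarrow> (K has_real_derivative k (\<sigma> s)) (at (\<sigma> s) within {\<sigma> a..\<sigma> b})"
    and le: "\<And>s t. a \<le> s \<Longrightarrow> s \<le> t \<Longrightarrow> t \<le> b \<Longrightarrow> z t - z s \<ge> - k (\<sigma> s) * (\<sigma> t - \<sigma> s)"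
  shows "z b - z a \<ge> - (K (\<sigma> b) - K (\<sigma> a))"
proof -
  have \<sigma>ran: "\<sigma> ` {a..b} \<subseteq> {\<sigma> a..\<sigma> b}" using mono by auto
  have ran_eq: "\<sigma> ` {a..b} = {\<sigma> a..\<sigma> b}"
    using \<sigma>ran IVT'[of \<sigma> a _ b] ab \<sigma> by fastforce
  have "continuous_on {\<sigma> a..\<sigma> b} K"
    unfolding ran_eq[symmetric]
    unfolding continuous_on_eq_continuous_within
    by (metis (no_types, lifting) K DERIV_continuous imageE ran_eq)
  then have Kc: "continuous_on {a..b} (\<lambda>s. K (\<sigma> s))"
    by (rule continuous_on_compose2[OF _ \<sigma> \<sigma>ran])
  have eps: "z a - z b \<le> K (\<sigma> b) - K (\<sigma> a) + e * (\<sigma> b - \<sigma> a)" if "e > 0" for e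
  proof -
    \<comment> \<open>The term \<open>e * \<sigma> s\<close> absorbs the remainder in the
      first-order expansion of \<open>K\<close> at \<open>\<sigma> s\<close>; it disappears when
      \<open>e\<close> tends to 0.\<close>
    define E where "E s = z s + K (\<sigma> s) + e * \<sigma> s" for s
    have "E a \<le> E b"
    proof (rule nondecreasing_if_locally_right[OF _ ab])
      show "continuous_on {a..b} E"
        unfolding E_def by (intro continuous_intros z Kc \<sigma>)
      fix s assume s: "a \<le> s" "s < b"
      have "(K has_derivative (\<lambda>h. k (\<sigma> s) * h)) (at (\<sigma> s) within {\<sigma> a..\<sigma> b})"
        using K[of s] s by (simp add: has_field_derivative_def)
      then have "\<exists>d>0. \<forall>y\<in>{\<sigma> a..\<sigma> b}. \<bar>y - \<sigma> s\<bar> < d \<longrightarrow>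
           \<bar>K y - K (\<sigma> s) - k (\<sigma> s) * (y - \<sigma> s)\<bar> \<le> e * \<bar>y - \<sigma> s\<bar>"
        using that unfolding has_derivative_within_alt by simp
      then obtain d where d: "d > 0" "\<And>y. y \<in> {\<sigma> a..\<sigma> b} \<Longrightarrow> \<bar>y - \<sigma> s\<bar> < d \<Longrightarrow>
           \<bar>K y - K (\<sigma> s) - k (\<sigma> s) * (y - \<sigma> s)\<bar> \<le> e * \<bar>y - \<sigma> s\<bar>"
        by blast
      obtain d' where d': "d' > 0" "\<And>t. t \<in> {a..b} \<Longrightarrow> \<bar>t - s\<bar> < d' \<Longrightarrow> \<bar>\<sigma> t - \<sigma> s\<bar> < d"
      proof -
        have "s \<in> {a..b}" using s by simp
        with \<sigma> d(1) show thesis unfolding continuous_on_iff dist_real_def by (blast intro: that)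
      qed
      have "E s \<le> E t" if "s < t" "t < s + d'" "t \<le> b" for t
      proof -
        have "\<bar>\<sigma> t - \<sigma> s\<bar> < d" using d'(2)[of t] that s by auto
        moreover have "\<sigma> t \<in> {\<sigma> a..\<sigma> b}" using mono[of a t] mono[of t b] that s by auto
        ultimately have "\<bar>K (\<sigma> t) - K (\<sigma> s) - k (\<sigma> s) * (\<sigma> t - \<sigma> s)\<bar> \<le> e * \<bar>\<sigma> t - \<sigma> s\<bar>"
          by (intro d(2))
        moreover have "\<sigma> s \<le> \<sigma> t" using mono that s by auto
        moreover have "z t - z s \<ge> - k (\<sigma> s) * (\<sigma> t - \<sigma> s)" using le that s by auto
        ultimately show ?thesis unfolding E_def by (simp add: algebra_simps abs_le_iff)
      qed
      then show "\<exists>d>0. \<forall>s'. s < s' \<and> s' < s + d \<and> s' \<le> b \<longrightarrow> E s \<le> E s'"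
        using d'(1) by blast
    qed
    then show ?thesis by (simp add: E_def algebra_simps)
  qed
  have "z a - z b \<le> K (\<sigma> b) - K (\<sigma> a) + 0 * (\<sigma> b - \<sigma> a)"
  proof (rule tendsto_lowerbound)
    show "((\<lambda>e. K (\<sigma> b) - K (\<sigma> a) + e * (\<sigma> b - \<sigma> a)) \<longlongrightarrow> K (\<sigma> b) - K (\<sigma> a) + 0 * (\<sigma> b - \<sigma> a)) (at_right 0)"
      by (intro tendsto_intros)
    show "\<forall>\<^sub>F e in at_right 0. z a - z b \<le> K (\<sigma> b) - K (\<sigma> a) + e * (\<sigma> b - \<sigma> a)"
      using eps by (auto simp: eventually_at_right_less intro: eventually_mono[OF eventually_at_right_less])
  qed simp
  then show ?thesis by simp
qed

section \<open>Depth of an excursion below zero\<close>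

lemma last_zero:
  fixes z :: "real \<Rightarrow> real"
  assumes z: "continuous_on {u..t} z" and "u \<le> t" "z u > 0" "z t < 0"
  obtains t0 where "u < t0" "t0 < t" "z t0 = 0" "\<And>s. t0 < s \<Longrightarrow> s \<le> t \<Longrightarrow> z s < 0"
proof -
  let ?Z = "{u..t} \<inter> z -` {0}"
  have "compact ?Z"
    using continuous_closed_preimage[OF z closed_atLeastAtMost, of "{0}"]
    by (simp add: compact_eq_bounded_closed bounded_Int)
  moreover have "?Z \<noteq> {}"
    using IVT2'[of z t 0 u] assms by force
  ultimately obtain t0 where t0: "t0 \<in> ?Z" "\<And>s. s \<in> ?Z \<Longrightarrow> s \<le> t0"
    using compact_attains_sup[of ?Z] by blast
  show ?thesis
  proof
    show "u < t0" "t0 < t" "z t0 = 0" using t0(1) assms by (auto simp: less_le)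
    fix s assume s: "t0 < s" "s \<le> t"
    show "z s < 0"
    proof (rule ccontr)
      assume "\<not> z s < 0"
      then have "\<exists>x\<ge>s. x \<le> t \<and> z x = 0"
        using s t0(1) assms by (intro IVT2') (auto intro: continuous_on_subset[OF z])
      then obtain x where "s \<le> x" "x \<le> t" "z x = 0" by blast
      then have "x \<le> t0" using t0(1) s by (intro t0(2)) auto
      then show False using s \<open>s \<le> x\<close> by simp
    qed
  qed
qed

text \<open>The integrated form of a one-sided delay inequality with rate function \<open>r\<close>
  in clock time, meaningful without derivatives. The range \<open>{s-h..t}\<close> collects the
  delay windows of all times between \<open>s\<close> and \<open>t\<close>.\<close>

definition decay_bound :: "real \<Rightarrow> real \<Rightarrow> (real \<Rightarrow> real) \<Rightarrow> (real \<Rightarrow> real) \<Rightarrow> (real \<Rightarrow> real) \<Rightarrow> bool" where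
  "decay_bound h S \<tau> r z \<longleftrightarrow> (\<forall>s t c. S \<le> s - h \<and> s \<le> t \<and> 0 \<le> c \<and> (\<forall>u\<in>{s-h..t}. z u \<le> c) \<longrightarrow>
      z t - z s \<ge> - r c * (\<tau> t - \<tau> s))"

locale delay_clock =
  fixes h S0 \<Lambda> :: real and \<tau> :: "real \<Rightarrow> real"
  assumes h: "h > 0"
    and \<tau>_cont: "continuous_on {S0..} \<tau>"
    and \<tau>_mono: "\<And>s t. S0 \<le> s \<Longrightarrow> s \<le> t \<Longrightarrow> \<tau> s \<le> \<tau> t"
    and \<tau>_window: "\<And>t. S0 \<le> t - h \<Longrightarrow> \<tau> t - \<tau> (t - h) \<le> \<Lambda>"
begin

text \<open>Let \<open>t0\<close> be the last zero before a negative value. At a time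
  \<open>s\<close> in \<open>[t0, t0 + h]\<close> the window reaches back at most
  \<open>\<Lambda> - \<sigma> s\<close> clock units before \<open>t0\<close>, so \<open>z\<close> is
  bounded there by \<open>C (\<Lambda> - \<sigma> s)\<close>. Integrating the resulting rate gives
  at most \<open>K \<Lambda> - K 0\<close>. After \<open>t0 + h\<close> the window contains no
  positive values, and the descent stops because \<open>r 0 = 0\<close>.\<close>

lemma excursion_bound:
  fixes z r C K :: "real \<Rightarrow> real"
  assumes S: "S0 \<le> S" and z: "continuous_on {S0..} z"
    and osc: "\<And>T. \<exists>t\<ge>T. z t > 0"
    and dec: "decay_bound h S \<tau> r z" and r0: "r 0 = 0"
    and C0: "\<And>v. 0 \<le> v \<Longrightarrow> 0 \<le> C v"
    and Cmono: "\<And>v w. 0 \<le> v \<Longrightarrow> v \<le> w \<Longrightarrow> C v \<le> C w"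
    and hist: "\<And>s t. S \<le> s \<Longrightarrow> s \<le> t \<Longrightarrow> z t = 0 \<Longrightarrow> z s \<le> C (\<tau> t - \<tau> s)"
    and K: "\<And>v. v \<in> {0..\<Lambda>} \<Longrightarrow> (K has_real_derivative r (C v)) (at v within {0..\<Lambda>})"
    and rC: "\<And>v. v \<in> {0..\<Lambda>} \<Longrightarrow> 0 \<le> r (C v)"
  shows "\<forall>\<^sub>F t in at_top. z t \<ge> - (K \<Lambda> - K 0)"
proof -
  obtain u where u: "u \<ge> S + h" "z u > 0" using osc by blast
  have \<Lambda>0: "0 \<le> \<Lambda>" using \<tau>_window[of "S0 + h"] \<tau>_mono[of S0 "S0+h"] h by simp
  have Kmono: "K v \<le> K w" if "0 \<le> v" "v \<le> w" "w \<le> \<Lambda>" for v w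
  proof (rule DERIV_nonneg_imp_increasing_open[OF that(2)])
    show "\<exists>y. (K has_real_derivative y) (at x) \<and> 0 \<le> y" if "v < x" "x < w" for x
      using K[of x] rC[of x] that \<open>0 \<le> v\<close> \<open>w \<le> \<Lambda>\<close>
      by (intro exI[of _ "r (C x)"]) (auto simp: at_within_Icc_at)
    have "continuous_on {0..\<Lambda>} K"
      unfolding continuous_on_eq_continuous_within by (meson K DERIV_continuous)
    then show "continuous_on {v..w} K" by (rule continuous_on_subset) (use that in auto)
  qed
  have "z t \<ge> - (K \<Lambda> - K 0)" if t: "t \<ge> u" for t
  proof (cases "z t < 0")
    case False
    then show ?thesis using Kmono[of 0 \<Lambda>] \<Lambda>0 by simp
  next
    case True
    have "continuous_on {u..t} z" by (rule continuous_on_subset[OF z]) (use u S h in auto)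
    from last_zero[OF this t u(2) True]
    obtain t0 where t0: "u < t0" "t0 < t" "z t0 = 0" "\<And>s. t0 < s \<Longrightarrow> s \<le> t \<Longrightarrow> z s < 0"
      by blast
    have t0S: "S \<le> t0 - h" "S0 \<le> t0 - h" using t0 u S by auto
    define t' where "t' = min t (t0 + h)"
    have t': "t0 \<le> t'" "t' \<le> t" "t' \<le> t0 + h" using t0 h by (auto simp: t'_def)
    have neg: "z s \<le> 0" if "t0 \<le> s" "s \<le> t" for s
      using t0(3) t0(4)[of s] that by (cases "s = t0") auto
    have "z t' \<le> z t"
    proof (cases "t \<le> t0 + h")
      case False
      then have "t' = t0 + h" by (simp add: t'_def)
      moreover have "z t - z (t0 + h) \<ge> - r 0 * (\<tau> t - \<tau> (t0 + h))"
        using dec[unfolded decay_bound_def, rule_format, of "t0 + h" t 0] neg False t0S h by auto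
      ultimately show ?thesis by (simp add: r0)
    qed (simp add: t'_def)
    define \<sigma> where "\<sigma> s = \<tau> s - \<tau> t0" for s
    have \<sigma>le: "\<tau> t0 - \<tau> (s - h) \<le> \<Lambda> - \<sigma> s" if "t0 \<le> s" for s
      using \<tau>_window[of s] t0S that by (simp add: \<sigma>_def)
    have \<sigma>0: "0 \<le> \<sigma> s" "\<sigma> s \<le> \<Lambda>" if "t0 \<le> s" "s \<le> t'" for s
      using \<sigma>le[of s] \<tau>_mono[of t0 s] \<tau>_mono[of "s-h" t0] that t' t0S h by (auto simp: \<sigma>_def)
    \<comment> \<open>The reach into the past shrinks as the clock advances, hence the reflected
      antiderivative \<open>- K (\<Lambda> - v)\<close>.\<close>
    have "z t' - z t0 \<ge> - ((- K (\<Lambda> - \<sigma> t')) - (- K (\<Lambda> - \<sigma> t0)))"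
    proof (rule comparison_antiderivative[where \<sigma> = \<sigma> and k = "\<lambda>v. r (C (\<Lambda> - v))" and K = "\<lambda>v. - K (\<Lambda> - v)"])
      show "t0 \<le> t'" by fact
      show "continuous_on {t0..t'} z" "continuous_on {t0..t'} \<sigma>"
        using t0S h by (auto simp: \<sigma>_def intro!: continuous_intros intro: continuous_on_subset[OF z] continuous_on_subset[OF \<tau>_cont])
      show "\<sigma> s \<le> \<sigma> t" if "t0 \<le> s" "s \<le> t" "t \<le> t'" for s t
        using \<tau>_mono[of s t] that t0S h by (simp add: \<sigma>_def)
      show "((\<lambda>v. - K (\<Lambda> - v)) has_real_derivative r (C (\<Lambda> - \<sigma> s))) (at (\<sigma> s) within {\<sigma> t0..\<sigma> t'})"
        if s: "s \<in> {t0..t'}" for s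
      proof -
        have "((\<lambda>v. K (\<Lambda> - v)) has_real_derivative r (C (\<Lambda> - \<sigma> s)) * (- 1)) (at (\<sigma> s) within {\<sigma> t0..\<sigma> t'})"
        proof (rule DERIV_image_chain[of K, unfolded o_def])
          have sub: "(\<lambda>v. \<Lambda> - v) ` {\<sigma> t0..\<sigma> t'} \<subseteq> {0..\<Lambda>}"
            using \<sigma>0[of t'] t' by (auto simp: \<sigma>_def)
          show "(K has_real_derivative r (C (\<Lambda> - \<sigma> s))) (at (\<Lambda> - \<sigma> s) within (\<lambda>v. \<Lambda> - v) ` {\<sigma> t0..\<sigma> t'})"
            by (rule DERIV_subset[OF K sub]) (use \<sigma>0[of s] s in auto)
          show "((\<lambda>v. \<Lambda> - v) has_real_derivative - 1) (at (\<sigma> s) within {\<sigma> t0..\<sigma> t'})"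
            by (auto intro!: derivative_eq_intros)
        qed
        from DERIV_minus[OF this] show ?thesis by simp
      qed
      fix s s' assume s: "t0 \<le> s" "s \<le> s'" "s' \<le> t'"
      have C: "0 \<le> C (\<Lambda> - \<sigma> s)" using C0 \<sigma>0[of s] s by auto
      have "z v \<le> C (\<Lambda> - \<sigma> s)" if v: "v \<in> {s-h..s'}" for v
      proof (cases "v \<le> t0")
        case True
        have "z v \<le> C (\<tau> t0 - \<tau> v)" using hist[of v t0] True v t0S t0(3) s by auto
        also have "\<dots> \<le> C (\<Lambda> - \<sigma> s)"
        proof (rule Cmono)
          show "0 \<le> \<tau> t0 - \<tau> v" using \<tau>_mono[of v t0] True v s t0S by auto
          have "\<tau> (s - h) \<le> \<tau> v" using \<tau>_mono[of "s-h" v] v s t0S by auto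
          then show "\<tau> t0 - \<tau> v \<le> \<Lambda> - \<sigma> s" using \<sigma>le[of s] s by auto
        qed
        finally show ?thesis .
      next
        case False
        then show ?thesis using neg[of v] C v s t' by auto
      qed
      then have "z s' - z s \<ge> - r (C (\<Lambda> - \<sigma> s)) * (\<tau> s' - \<tau> s)"
        using dec[unfolded decay_bound_def, rule_format, of s s' "C (\<Lambda> - \<sigma> s)"] C s t0S by auto
      then show "z s' - z s \<ge> - r (C (\<Lambda> - \<sigma> s)) * (\<sigma> s' - \<sigma> s)" by (simp add: \<sigma>_def)
    qed
    moreover have "K 0 \<le> K (\<Lambda> - \<sigma> t')" using Kmono \<sigma>0[of t'] t' by auto
    ultimately show ?thesis using \<open>z t' \<le> z t\<close> t0(3) by (simp add: \<sigma>_def)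
  qed
  then show ?thesis by (auto simp: eventually_at_top_linorder)
qed

end

section \<open>Elementary bounds for the logarithm\<close>

lemma ln_one_plus_ge:
  fixes v :: real assumes "0 \<le> v"
  shows "2 * v / (2 + v) \<le> ln (1 + v)"
proof -
  have "ln (1 + 0) - 2 * 0 / (2 + 0) \<le> ln (1 + v) - 2 * v / (2 + v)"
  proof (rule DERIV_nonneg_imp_nondecreasing[OF assms])
    fix x :: real assume x: "0 \<le> x" "x \<le> v"
    have "((\<lambda>x. ln (1 + x) - 2 * x / (2 + x)) has_real_derivative x\<^sup>2 / ((1 + x) * (2 + x)\<^sup>2)) (at x)"
    proof -
      have "1 + x > 0" "2 + x \<noteq> 0" using x by auto
      then show ?thesis
        by (auto intro!: derivative_eq_intros) (simp add: divide_simps, simp add: algebra_simps power2_eq_square)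
    qed
    then show "\<exists>y. ((\<lambda>x. ln (1 + x) - 2 * x / (2 + x)) has_real_derivative y) (at x) \<and> 0 \<le> y"
      using x by (intro exI[of _ "x\<^sup>2 / ((1 + x) * (2 + x)\<^sup>2)"] conjI) auto
  qed
  then show ?thesis by simp
qed

text \<open>The lower bound is the Taylor polynomial of degree 3. This precision is needed because
  the margin in the excursion estimates is cubic.\<close>

lemma one_plus_ln_one_plus_ge:
  fixes M :: real assumes "0 \<le> M"
  shows "M + M\<^sup>2 / 2 - M ^ 3 / 6 \<le> (1 + M) * ln (1 + M)"
proof -
  have "(1 + 0) * ln (1 + 0) - (0 + 0\<^sup>2 / 2 - 0 ^ 3 / 6) \<le> (1 + M) * ln (1 + M) - (M + M\<^sup>2 / 2 - M ^ 3 / 6)"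
  proof (rule DERIV_nonneg_imp_nondecreasing[OF assms])
    fix x :: real assume x: "0 \<le> x" "x \<le> M"
    have "((\<lambda>x. (1 + x) * ln (1 + x) - (x + x\<^sup>2 / 2 - x ^ 3 / 6)) has_real_derivative ln (1 + x) - x + x\<^sup>2 / 2) (at x)"
    proof -
      have "1 + x > 0" "1 + x \<noteq> 0" using x by auto
      then show ?thesis by (auto intro!: derivative_eq_intros)
    qed
    moreover have "x - x\<^sup>2 / 2 \<le> 2 * x / (2 + x)"
      using x by (simp add: field_simps power2_eq_square)
    with ln_one_plus_ge[of x] x have "0 \<le> ln (1 + x) - x + x\<^sup>2 / 2" by simp
    ultimately show "\<exists>y. ((\<lambda>x. (1 + x) * ln (1 + x) - (x + x\<^sup>2 / 2 - x ^ 3 / 6)) has_real_derivative y) (at x) \<and> 0 \<le> y"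
      by blast
  qed
  then show ?thesis by simp
qed

text \<open>Again the Taylor polynomial of degree 3; all later coefficients of
  \<open>(1 - m) * ln (1 - m)\<close> are positive.\<close>

lemma one_minus_ln_one_minus_ge:
  fixes m :: real assumes "0 \<le> m" "m < 1"
  shows "- (m - m\<^sup>2 / 2 - m ^ 3 / 6) \<le> (1 - m) * ln (1 - m)"
proof -
  have *: "x + x\<^sup>2 / 2 \<le> - ln (1 - x)" if "0 \<le> x" "x < 1" for x :: real
  proof -
    have "- ln (1 - 0) - (0 + 0\<^sup>2 / 2) \<le> - ln (1 - x) - (x + x\<^sup>2 / 2)"
    proof (rule DERIV_nonneg_imp_nondecreasing[OF that(1)])
      fix y :: real assume y: "0 \<le> y" "y \<le> x"
      have "((\<lambda>x. - ln (1 - x) - (x + x\<^sup>2 / 2)) has_real_derivative y\<^sup>2 / (1 - y)) (at y)"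
      proof -
        have "0 < 1 - y" "1 - y \<noteq> 0" using y that by auto
        then show ?thesis
          by (auto intro!: derivative_eq_intros) (simp add: divide_simps, simp add: algebra_simps power2_eq_square)
      qed
      then show "\<exists>d. ((\<lambda>x. - ln (1 - x) - (x + x\<^sup>2 / 2)) has_real_derivative d) (at y) \<and> 0 \<le> d"
        using y that by (intro exI[of _ "y\<^sup>2 / (1 - y)"] conjI) auto
    qed
    then show ?thesis by simp
  qed
  have "(1 - 0) * ln (1 - 0) + (0 - 0\<^sup>2 / 2 - 0 ^ 3 / 6) \<le> (1 - m) * ln (1 - m) + (m - m\<^sup>2 / 2 - m ^ 3 / 6)"
  proof (rule DERIV_nonneg_imp_nondecreasing[OF assms(1)])
    fix x :: real assume x: "0 \<le> x" "x \<le> m"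
    have "((\<lambda>x. (1 - x) * ln (1 - x) + (x - x\<^sup>2 / 2 - x ^ 3 / 6)) has_real_derivative - ln (1 - x) - x - x\<^sup>2 / 2) (at x)"
    proof -
      have "0 < 1 - x" "1 - x \<noteq> 0" using x assms by auto
      then show ?thesis by (auto intro!: derivative_eq_intros)
    qed
    then show "\<exists>y. ((\<lambda>x. (1 - x) * ln (1 - x) + (x - x\<^sup>2 / 2 - x ^ 3 / 6)) has_real_derivative y) (at x) \<and> 0 \<le> y"
      using *[of x] x assms by (intro exI[of _ "- ln (1 - x) - x - x\<^sup>2 / 2"] conjI) auto
  qed
  then show ?thesis by simp
qed

text \<open>If the infimum of the admissible bounds were positive, continuity would let
  \<open>G\<close> send a bound close to it below it. No contraction rate is required, which matters
  for a map with slope 1 at 0.\<close>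

lemma iterated_bounds_to_zero:
  fixes P :: "real \<Rightarrow> bool" and G :: "real \<Rightarrow> real"
  assumes pos: "\<And>M. P M \<Longrightarrow> 0 < M" and ex: "P M0"
    and step: "\<And>M. P M \<Longrightarrow> P (G M)"
    and cont: "\<And>M. 0 < M \<Longrightarrow> isCont G M" and less: "\<And>M. 0 < M \<Longrightarrow> G M < M"
    and "0 < e"
  obtains M where "P M" "M < e"
proof -
  define m where "m = Inf (Collect P)"
  have ne: "Collect P \<noteq> {}" and bdd: "bdd_below (Collect P)"
    using ex pos by (auto intro!: bdd_belowI[of _ 0] less_imp_le)
  have m0: "0 \<le> m" unfolding m_def using pos ne by (intro cInf_greatest) (auto intro: less_imp_le)
  have "m = 0"
  proof (rule ccontr)
    assume "m \<noteq> 0"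
    then have m: "m > 0" using m0 by simp
    have "\<forall>\<^sub>F M in at m. G M < m"
      using cont[OF m] less[OF m] unfolding isCont_def by (rule order_tendstoD)
    then obtain d where d: "d > 0" "\<And>M. M \<noteq> m \<Longrightarrow> dist M m < d \<Longrightarrow> G M < m"
      by (auto simp: eventually_at)
    have "m < m + d" using d by simp
    then obtain M where M: "P M" "M < m + d"
      using cInf_lessD[OF ne, of "m + d"] unfolding m_def by blast
    have "m \<le> M" unfolding m_def using M(1) by (intro cInf_lower bdd) simp
    then have "G M < m" using d(2)[of M] less[OF m] M(2) by (cases "M = m") (auto simp: dist_real_def)
    moreover have "m \<le> G M" unfolding m_def using step[OF M(1)] by (intro cInf_lower bdd) simp
    ultimately show False by simp
  qed
  then show thesis
    using cInf_lessD[OF ne, of e] \<open>0 < e\<close> that unfolding m_def by auto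
qed

text \<open>The history rises with slope \<open>p\<close> and saturates at \<open>M\<close> when
  \<open>v = M / p\<close>; \<open>F\<close> accounts for the rise, the constant rate
  \<open>r M\<close> for the rest.\<close>

lemma has_integral_ramp:
  fixes r F :: "real \<Rightarrow> real"
  assumes M: "0 < M" and p: "0 < p" and s: "M / p \<le> \<Lambda>"
    and F: "\<And>v. v \<in> {0..M / p} \<Longrightarrow> (F has_real_derivative r (p * v)) (at v within {0..M / p})"
  shows "((\<lambda>v. r (min M (p * v))) has_integral (F (M / p) - F 0 + (\<Lambda> - M / p) * r M)) {0..\<Lambda>}"
proof (rule has_integral_combine[where c = "M / p"])
  show "0 \<le> M / p" "M / p \<le> \<Lambda>" using M p s by auto
  have "((\<lambda>v. r (p * v)) has_integral (F (M / p) - F 0)) {0..M / p}"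
    by (rule fundamental_theorem_of_calculus) (use M p F in \<open>auto simp: has_real_derivative_iff_has_vector_derivative\<close>)
  then show "((\<lambda>v. r (min M (p * v))) has_integral (F (M / p) - F 0)) {0..M / p}"
    by (rule has_integral_eq[rotated]) (use p in \<open>auto simp: field_simps min_def\<close>)
  have "((\<lambda>v. r M) has_integral ((\<Lambda> - M / p) * r M)) {M / p..\<Lambda>}"
    using has_integral_const_real[of "r M" "M / p" \<Lambda>] s by simp
  then show "((\<lambda>v. r (min M (p * v))) has_integral ((\<Lambda> - M / p) * r M)) {M / p..\<Lambda>}"
    by (rule has_integral_eq[rotated]) (use p in \<open>auto simp: field_simps min_def\<close>)
qed

section \<open>Excursions after a bounded history\<close>

lemma decay_bound_later: "decay_bound h S \<tau> r z \<Longrightarrow> S \<le> S' \<Longrightarrow> decay_bound h S' \<tau> r z"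
  unfolding decay_bound_def by (meson order_trans)

context delay_clock
begin

lemma decay_bound_mono:
  assumes "decay_bound h S \<tau> r z" "S0 \<le> S" "\<And>c. 0 \<le> c \<Longrightarrow> r c \<le> r' c"
  shows "decay_bound h S \<tau> r' z"
  unfolding decay_bound_def
proof (intro allI impI, elim conjE)
  fix s t c assume *: "S \<le> s - h" "s \<le> t" "0 \<le> c" "\<forall>u\<in>{s-h..t}. z u \<le> c"
  have "r c * (\<tau> t - \<tau> s) \<le> r' c * (\<tau> t - \<tau> s)"
    using assms(2,3) * \<tau>_mono[of s t] h by (intro mult_right_mono) auto
  moreover have "z t - z s \<ge> - r c * (\<tau> t - \<tau> s)"
    using assms(1) * unfolding decay_bound_def by blast
  ultimately show "z t - z s \<ge> - r' c * (\<tau> t - \<tau> s)" by linarith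
qed

lemma excursion_bound_integral:
  fixes z r C :: "real \<Rightarrow> real"
  assumes S: "S0 \<le> S" and z: "continuous_on {S0..} z"
    and osc: "\<And>T. \<exists>t\<ge>T. z t > 0"
    and dec: "decay_bound h S \<tau> r z" and r0: "r 0 = 0"
    and C0: "\<And>v. 0 \<le> v \<Longrightarrow> 0 \<le> C v"
    and Cmono: "\<And>v w. 0 \<le> v \<Longrightarrow> v \<le> w \<Longrightarrow> C v \<le> C w"
    and hist: "\<And>s t. S \<le> s \<Longrightarrow> s \<le> t \<Longrightarrow> z t = 0 \<Longrightarrow> z s \<le> C (\<tau> t - \<tau> s)"
    and rC: "continuous_on {0..\<Lambda>} (\<lambda>v. r (C v))" "\<And>v. v \<in> {0..\<Lambda>} \<Longrightarrow> 0 \<le> r (C v)"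
    and I: "((\<lambda>v. r (C v)) has_integral I) {0..\<Lambda>}"
  shows "\<forall>\<^sub>F t in at_top. z t \<ge> - I"
proof -
  have "\<forall>\<^sub>F t in at_top. z t \<ge> - (integral {0..\<Lambda>} (\<lambda>v. r (C v)) - integral {0..0} (\<lambda>v. r (C v)))"
    by (rule excursion_bound[OF S z osc dec r0 C0 Cmono hist _ rC(2)])
       (auto intro: integral_has_real_derivative[OF rC(1)])
  then show ?thesis using integral_unique[OF I] by simp
qed

text \<open>An eventual bound \<open>M\<close> limits the history twice: by \<open>M\<close> itself
  and, since the descent to the zero has rate at most \<open>r M\<close>, by \<open>r M\<close>
  times the clock distance to the zero. Hence the ramp \<open>min M (r M * v)\<close>; the condition
  \<open>M / r M \<le> \<Lambda>\<close> says that it saturates inside the window.\<close>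

lemma excursion_bound_ramp:
  fixes z r F :: "real \<Rightarrow> real"
  assumes S: "S0 \<le> S" and z: "continuous_on {S0..} z"
    and osc: "\<And>T. \<exists>t\<ge>T. z t > 0"
    and dec: "decay_bound h S \<tau> r z" and r0: "r 0 = 0"
    and r: "continuous_on {0..M} r" "\<And>c. c \<in> {0..M} \<Longrightarrow> 0 \<le> r c"
    and M: "0 < M" and le: "\<forall>\<^sub>F t in at_top. z t \<le> M" and p: "0 < r M" "M / r M \<le> \<Lambda>"
    and F: "\<And>v. v \<in> {0..M / r M} \<Longrightarrow> (F has_real_derivative r (r M * v)) (at v within {0..M / r M})"
  shows "\<forall>\<^sub>F t in at_top. z t \<ge> - (F (M / r M) - F 0 + (\<Lambda> - M / r M) * r M)"
proof -
  obtain S1 where S1: "\<And>t. t \<ge> S1 \<Longrightarrow> z t \<le> M" using le by (auto simp: eventually_at_top_linorder)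
  \<comment> \<open>The shift by \<open>h\<close> puts the whole delay window where both the decay
    bound and \<open>z \<le> M\<close> are valid.\<close>
  define S2 where "S2 = max S S1 + h"
  have S2: "S \<le> S2" "S0 \<le> S2" "S1 \<le> S2 - h" "S \<le> S2 - h" using S h by (auto simp: S2_def)
  have \<Lambda>0: "0 \<le> \<Lambda>" using p M by (meson divide_nonneg_pos less_imp_le order_trans)
  have rng: "(\<lambda>v. min M (r M * v)) ` {0..\<Lambda>} \<subseteq> {0..M}" using p M by auto
  show ?thesis
  proof (rule excursion_bound_integral[where r = r and S = S2 and C = "\<lambda>v. min M (r M * v)", OF S2(2) z osc
        decay_bound_later[OF dec S2(1)] r0])
    show "continuous_on {0..\<Lambda>} (\<lambda>v. r (min M (r M * v)))"
      by (rule continuous_on_compose2[OF r(1) _ rng]) (intro continuous_intros)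
    show "0 \<le> min M (r M * v)" if "0 \<le> v" for v using that p M by simp
    show "min M (r M * v) \<le> min M (r M * w)" if "0 \<le> v" "v \<le> w" for v w
      using that p by (intro min.mono) auto
    show "0 \<le> r (min M (r M * v))" if "v \<in> {0..\<Lambda>}" for v
      using that rng by (intro r(2)) blast
    show "((\<lambda>v. r (min M (r M * v))) has_integral (F (M / r M) - F 0 + (\<Lambda> - M / r M) * r M)) {0..\<Lambda>}"
      by (rule has_integral_ramp[OF M p F])
    fix s t assume st: "S2 \<le> s" "s \<le> t" "z t = 0"
    have "z t - z s \<ge> - r M * (\<tau> t - \<tau> s)"
      using dec[unfolded decay_bound_def, rule_format, of s t M] st S2 M S1 by auto
    then show "z s \<le> min M (r M * (\<tau> t - \<tau> s))" using S1[of s] st S2 h by auto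
  qed
qed

end

section \<open>The normalised rational inequality\<close>

text \<open>This is the form taken by a multiple of \<open>ln x\<close>. The upper rate has a pole
  at \<open>c = 1\<close>, so it becomes usable only when the minima are known to stay above
  -1.\<close>

locale rational_delay = delay_clock h S0 "3/2" \<tau> for h S0 :: real and \<tau> :: "real \<Rightarrow> real" +
  fixes z :: "real \<Rightarrow> real"
  assumes z: "continuous_on {S0..} z"
    and lower: "decay_bound h S0 \<tau> (\<lambda>c. c / (1 + c)) z"
    and upper: "\<And>s t c. \<lbrakk>S0 \<le> s - h; s \<le> t; 0 \<le> c; c < 1; \<forall>u\<in>{s-h..t}. - c \<le> z u\<rbrakk>
        \<Longrightarrow> z t - z s \<le> c / (1 - c) * (\<tau> t - \<tau> s)"
    and osc_pos: "\<And>T. \<exists>t\<ge>T. z t > 0" and osc_neg: "\<And>T. \<exists>t\<ge>T. z t < 0"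
begin

text \<open>No upper bound is known yet, but the rate of descent is always below 1, so before a zero
  \<open>z\<close> is at most the clock distance to it. This yields
  \<open>3/2 - ln (5/2) \<le> 9/14\<close>, and 9/14 < 1 makes the upper rate available.\<close>

lemma eventually_lower: "\<forall>\<^sub>F t in at_top. z t \<ge> - (9/14)"
proof -
  have "\<forall>\<^sub>F t in at_top. z t \<ge> - ((3/2 - ln (1 + 3/2)) - (0 - ln (1 + 0)))"
  proof (rule excursion_bound[where S = "S0 + h" and r = "\<lambda>c. c / (1 + c)" and C = "\<lambda>v. v" and K = "\<lambda>v. v - ln (1 + v)", OF _ z osc_pos])
    show "decay_bound h (S0 + h) \<tau> (\<lambda>c. c / (1 + c)) z" using decay_bound_later[OF lower] h by simp
    show "((\<lambda>v. v - ln (1 + v)) has_real_derivative v / (1 + v)) (at v within {0..3/2})" if "v \<in> {0..3/2}" for v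
      using that by (auto intro!: derivative_eq_intros simp: field_simps)
    fix s t assume st: "S0 + h \<le> s" "s \<le> t" "z t = 0"
    have "compact (z ` {s-h..t})"
      by (intro compact_continuous_image continuous_on_subset[OF z]) (use st in auto)
    \<comment> \<open>The size of this local bound is irrelevant; it only makes the rate
      \<open>B / (1 + B)\<close> available, which is less than 1.\<close>
    then obtain B where B: "\<And>u. u \<in> {s-h..t} \<Longrightarrow> \<bar>z u\<bar> \<le> B"
      using compact_imp_bounded by (force simp: bounded_iff)
    have B0: "0 \<le> B" using B[of t] st h by simp
    have "z t - z s \<ge> - (B / (1 + B)) * (\<tau> t - \<tau> s)"
    proof (rule lower[unfolded decay_bound_def, rule_format], intro conjI ballI)
      show "z u \<le> B" if "u \<in> {s-h..t}" for u using B[OF that] by simp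
    qed (use st B0 in auto)
    moreover have "B / (1 + B) * (\<tau> t - \<tau> s) \<le> 1 * (\<tau> t - \<tau> s)"
      using B0 \<tau>_mono[of s t] st h by (intro mult_right_mono) auto
    ultimately show "z s \<le> \<tau> t - \<tau> s" using st by simp
  qed (use h in auto)
  moreover have "6/7 \<le> ln (1 + 3/2 :: real)" using ln_one_plus_ge[of "3/2"] by simp
  ultimately show ?thesis by (elim eventually_mono) (simp add: field_simps)
qed

text \<open>Truncation at \<open>m\<close> keeps the rate away from its pole and defines it for
  every \<open>c\<close>. It costs nothing, as eventually \<open>- z\<close> does not exceed
  \<open>m\<close>.\<close>

lemma decay_bound_upper:
  assumes m: "0 \<le> m" "m < 1" and le: "\<forall>\<^sub>F t in at_top. - m \<le> z t"
  obtains S where "S0 \<le> S" "decay_bound h S \<tau> (\<lambda>c. min c m / (1 - min c m)) (\<lambda>t. - z t)"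
proof -
  obtain S1 where S1: "\<And>t. t \<ge> S1 \<Longrightarrow> - m \<le> z t" using le by (auto simp: eventually_at_top_linorder)
  have "decay_bound h (max S0 S1) \<tau> (\<lambda>c. min c m / (1 - min c m)) (\<lambda>t. - z t)"
    unfolding decay_bound_def
  proof (intro allI impI, elim conjE)
    fix s t c assume *: "max S0 S1 \<le> s - h" "s \<le> t" "0 \<le> c" "\<forall>u\<in>{s-h..t}. - z u \<le> c"
    have "- min c m \<le> z u" if "u \<in> {s-h..t}" for u
      using *(4)[rule_format, OF that] S1[of u] that *(1) by auto
    then have "z t - z s \<le> min c m / (1 - min c m) * (\<tau> t - \<tau> s)"
      using * m by (intro upper) auto
    then show "- z t - - z s \<ge> - (min c m / (1 - min c m)) * (\<tau> t - \<tau> s)" by simp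
  qed
  then show thesis by (intro that[of "max S0 S1"]) auto
qed

text \<open>A crude estimate with constant history: the rate
  \<open>(9/14) / (1 - 9/14) = 9/5\<close> over the clock length 3/2 gives 27/10. Its size is
  immaterial; it only starts the improvement of bounds.\<close>

lemma eventually_upper: "\<forall>\<^sub>F t in at_top. z t \<le> 27/10"
proof -
  obtain S where S: "S0 \<le> S" "decay_bound h S \<tau> (\<lambda>c. min c (9/14) / (1 - min c (9/14))) (\<lambda>t. - z t)"
    using decay_bound_upper[of "9/14"] eventually_lower by auto
  obtain S1 where S1: "\<And>t. t \<ge> S1 \<Longrightarrow> - (9/14) \<le> z t" using eventually_lower by (auto simp: eventually_at_top_linorder)
  have "\<forall>\<^sub>F t in at_top. - z t \<ge> - (9/5 * (3/2) - 9/5 * 0)"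
  proof (rule excursion_bound[where S = "max S S1" and r = "\<lambda>c. min c (9/14) / (1 - min c (9/14))" and C = "\<lambda>v. 9/14" and K = "\<lambda>v. 9/5 * v"])
    show "decay_bound h (max S S1) \<tau> (\<lambda>c. min c (9/14) / (1 - min c (9/14))) (\<lambda>t. - z t)"
      by (rule decay_bound_later[OF S(2)]) simp
    show "\<exists>t\<ge>T. 0 < - z t" for T using osc_neg[of T] by auto
    show "((\<lambda>v. 9/5 * v) has_real_derivative min (9/14) (9/14) / (1 - min (9/14) (9/14))) (at v within {0..3/2})" for v :: real
      by (auto intro!: derivative_eq_intros)
    show "- z s \<le> 9/14" if "max S S1 \<le> s" for s using S1[of s] that by simp
  qed (use S z in \<open>auto intro!: continuous_intros\<close>)
  then show ?thesis by (elim eventually_mono) simp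
qed

text \<open>The bound \<open>\<phi> M = 3 M / (3 + 4 M)\<close> agrees with the exact excursion bound to second order at 0,
  and \<open>M \<mapsto> - \<phi> M\<close> extends to an involution. The bound obtained in the opposite
  direction lies strictly below the inverse of \<open>\<phi>\<close>, so the composition lies strictly below the identity.\<close>

lemma lower_from_upper:
  assumes M: "0 < M" and le: "\<forall>\<^sub>F t in at_top. z t \<le> M"
  shows "\<forall>\<^sub>F t in at_top. z t \<ge> - (3 * M / (3 + 4 * M))"
\<comment> \<open>The ramp of slope \<open>M / (1 + M)\<close> saturates at clock distance
  \<open>1 + M\<close>, which fits into the window of length 3/2 exactly when
  \<open>M \<le> 1/2\<close>.\<close>
proof (cases "M \<le> 1/2")
  case True
  define p where "p = M / (1 + M)"
  have p: "p > 0" "M / p = 1 + M" using M by (auto simp: p_def)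
  have pv: "0 \<le> p * v" if "v \<ge> 0" for v using p that by simp
  have "\<forall>\<^sub>F t in at_top. z t \<ge> - ((M / p - ln (1 + p * (M / p)) / p) - (0 - ln (1 + p * 0) / p) + (3/2 - M / p) * p)"
    unfolding p_def
  proof (rule excursion_bound_ramp[where r = "\<lambda>c. c / (1 + c)" and S = S0 and F = "\<lambda>v. v - ln (1 + M / (1 + M) * v) / (M / (1 + M))", OF _ z osc_pos lower])
    show "continuous_on {0..M} (\<lambda>c. c / (1 + c))" by (intro continuous_intros) auto
    show "((\<lambda>v. v - ln (1 + M / (1 + M) * v) / (M / (1 + M))) has_real_derivative M / (1 + M) * v / (1 + M / (1 + M) * v)) (at v within {0..M / (M / (1 + M))})"
      if "v \<in> {0..M / (M / (1 + M))}" for v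
    proof -
      have "0 < 1 + p * v" "1 + p * v \<noteq> 0" using pv[of v] that by auto
      then have "((\<lambda>v. v - ln (1 + p * v) / p) has_real_derivative p * v / (1 + p * v)) (at v within {0..M / p})"
        using p by (auto intro!: derivative_eq_intros) (simp add: divide_simps)
      then show ?thesis by (simp only: p_def)
    qed
  qed (use M True le in \<open>auto simp: field_simps\<close>)
  moreover have "(M / p - ln (1 + p * (M / p)) / p) - (0 - ln (1 + p * 0) / p) + (3/2 - M / p) * p \<le> 3 * M / (3 + 4 * M)"
  proof -
    have "(M / p - ln (1 + p * (M / p)) / p) - (0 - ln (1 + p * 0) / p) + (3/2 - M / p) * p
       = (1 + M) - (1 + M) * ln (1 + M) / M + (1/2 - M) * (M / (1 + M))"
    proof -
      have 1: "p * (M / p) = M" using p(1) by simp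
      have 2: "ln (1 + M) / p = (1 + M) * ln (1 + M) / M" by (simp add: p_def)
      show ?thesis unfolding 1 2 unfolding p(2) by (simp add: p_def algebra_simps)
    qed
    also have "\<dots> \<le> (1 + M) - (M + M\<^sup>2 / 2 - M ^ 3 / 6) / M + (1/2 - M) * (M / (1 + M))"
      using one_plus_ln_one_plus_ge[of M] M by (intro add_mono diff_left_mono divide_right_mono) auto
    also have "\<dots> = M - (M / 2 - M\<^sup>2 / 6) + (1/2 - M) * (M / (1 + M))"
    proof -
      have "(M + M\<^sup>2 / 2 - M ^ 3 / 6) / M = 1 + M / 2 - M\<^sup>2 / 6"
        using M by (simp add: divide_simps) (simp add: algebra_simps power2_eq_square power3_eq_cube)
      then show ?thesis by simp
    qed
    also have "\<dots> \<le> 3 * M / (3 + 4 * M)"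
    proof -
      \<comment> \<open>Terms of first and second order cancel; the cubic remainder is nonnegative
        for \<open>M \<le> 1/2\<close>.\<close>
      have "3 * M / (3 + 4 * M) - (M - (M / 2 - M\<^sup>2 / 6) + (1/2 - M) * (M / (1 + M)))
        = M ^ 3 * (5/6 - 2/3 * M) / ((3 + 4 * M) * (1 + M))"
        using M by (simp add: divide_simps) (simp add: algebra_simps power2_eq_square power3_eq_cube)
      moreover have "0 \<le> M ^ 3 * (5/6 - 2/3 * M) / ((3 + 4 * M) * (1 + M))"
        using M True by (intro divide_nonneg_pos mult_nonneg_nonneg) auto
      ultimately show ?thesis by linarith
    qed
    finally show ?thesis .
  qed
  ultimately show ?thesis by (elim eventually_mono) linarith
next
  case False
  \<comment> \<open>The ramp no longer saturates within the window, so the history bound is linear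
    throughout. Here \<open>p \<ge> 1/3\<close> makes the factor \<open>3 * p - 1\<close> below
    nonnegative.\<close>
  define p where "p = M / (1 + M)"
  have p: "1/3 \<le> p" "p \<le> 1" using M False by (simp_all add: p_def pos_le_divide_eq)
  obtain S1 where S1: "\<And>t. t \<ge> S1 \<Longrightarrow> z t \<le> M" using le by (auto simp: eventually_at_top_linorder)
  have "\<forall>\<^sub>F t in at_top. z t \<ge> - ((3/2 - ln (1 + p * (3/2)) / p) - (0 - ln (1 + p * 0) / p))"
  proof (rule excursion_bound[where S = "max S0 S1 + h" and r = "\<lambda>c. c / (1 + c)" and C = "\<lambda>v. p * v" and K = "\<lambda>v. v - ln (1 + p * v) / p", OF _ z osc_pos])
    show "decay_bound h (max S0 S1 + h) \<tau> (\<lambda>c. c / (1 + c)) z" using decay_bound_later[OF lower] h by simp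
    show "((\<lambda>v. v - ln (1 + p * v) / p) has_real_derivative p * v / (1 + p * v)) (at v within {0..3/2})" if "v \<in> {0..3/2}" for v
    proof -
      have "0 \<le> p * v" using p that by simp
      then have "0 < 1 + p * v" "1 + p * v \<noteq> 0" by auto
      then show ?thesis using p by (auto intro!: derivative_eq_intros) (simp add: divide_simps)
    qed
    fix s t assume st: "max S0 S1 + h \<le> s" "s \<le> t" "z t = 0"
    have "z t - z s \<ge> - p * (\<tau> t - \<tau> s)"
      unfolding p_def
    proof (rule lower[unfolded decay_bound_def, rule_format], intro conjI ballI)
      show "z u \<le> M" if "u \<in> {s-h..t}" for u using that st by (intro S1) auto
    qed (use st M in auto)
    then show "z s \<le> p * (\<tau> t - \<tau> s)" using st by simp
  qed (use h p in \<open>auto intro: mult_left_mono\<close>)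
  moreover have "(3/2 - ln (1 + p * (3/2)) / p) - (0 - ln (1 + p * 0) / p) \<le> 3 * M / (3 + 4 * M)"
  proof -
    have "6 * p / (4 + 3 * p) \<le> ln (1 + p * (3/2))"
      using ln_one_plus_ge[of "p * (3/2)"] p by (simp add: field_simps)
    then have "6 / (4 + 3 * p) \<le> ln (1 + p * (3/2)) / p"
      using p by (simp add: field_simps)
    moreover have "3/2 - 6 / (4 + 3 * p) \<le> 3 * p / (3 + p)"
    proof -
      have "3 * p / (3 + p) - (3/2 - 6 / (4 + 3 * p)) = (3/2) * p * (3 * p - 1) / ((3 + p) * (4 + 3 * p))"
        using p by (simp add: divide_simps) (simp add: algebra_simps)
      moreover have "0 \<le> (3/2) * p * (3 * p - 1) / ((3 + p) * (4 + 3 * p))" using p by simp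
      ultimately show ?thesis by linarith
    qed
    moreover have "3 * p / (3 + p) = 3 * M / (3 + 4 * M)"
    proof -
      have "3 + p = (3 + 4 * M) / (1 + M)" using M by (simp add: p_def add_divide_eq_iff)
      then show ?thesis using M by (simp add: p_def)
    qed
    ultimately show ?thesis by simp
  qed
  ultimately show ?thesis by (elim eventually_mono) linarith
qed

text \<open>The ramp saturates at \<open>m / p = 1 - m\<close>, always inside the window, so no case
  distinction arises. The bound agrees to second order with \<open>3 * m / (3 - 4 * m)\<close>, the
  inverse of \<open>M \<mapsto> 3 * M / (3 + 4 * M)\<close>.\<close>

lemma upper_from_lower:
  assumes m: "0 < m" "m < 1" and le: "\<forall>\<^sub>F t in at_top. - m \<le> z t"
  shows "\<forall>\<^sub>F t in at_top. z t \<le> m * (1 + m / 3 + m\<^sup>2 / 6) / (1 - m)"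
proof -
  define p where "p = m / (1 - m)"
  have p: "p > 0" "m / p = 1 - m" "p * (m / p) = m" using m by (auto simp: p_def)
  define r where "r c = min c m / (1 - min c m)" for c
  have rm: "r m = p" by (simp add: r_def p_def)
  obtain S where S: "S0 \<le> S" "decay_bound h S \<tau> r (\<lambda>t. - z t)"
    unfolding r_def using decay_bound_upper[of m] le m by auto
  have "\<forall>\<^sub>F t in at_top. - z t \<ge> - ((- (m / p) - ln (1 - p * (m / p)) / p) - (- 0 - ln (1 - p * 0) / p) + (3/2 - m / p) * p)"
    unfolding rm[symmetric]
  proof (rule excursion_bound_ramp[where r = r and F = "\<lambda>v. - v - ln (1 - r m * v) / r m" and S = S])
    show "continuous_on {0..m} r" unfolding r_def using m by (intro continuous_intros) auto
    show "\<exists>t\<ge>T. 0 < - z t" for T using osc_neg[of T] by auto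
    show "((\<lambda>v. - v - ln (1 - r m * v) / r m) has_real_derivative r (r m * v)) (at v within {0..m / r m})"
      if "v \<in> {0..m / r m}" for v
    proof -
      have "v \<le> m / p" using that by (simp add: rm)
      then have pv: "p * v \<le> m" using p(1) by (simp add: pos_le_divide_eq mult.commute)
      then have "0 < 1 - p * v" "1 - p * v \<noteq> 0" using m by auto
      then have "((\<lambda>v. - v - ln (1 - p * v) / p) has_real_derivative p * v / (1 - p * v)) (at v within {0..m / p})"
        using p by (auto intro!: derivative_eq_intros) (simp add: divide_simps)
      then show ?thesis using pv by (simp add: r_def[of "p * v"] rm min_def)
    qed
    show "m / r m \<le> 3/2" using p m by (simp add: rm)
    show "0 < r m" using p by (simp add: rm)
    show "r 0 = 0" using m by (simp add: r_def)
    show "0 \<le> r c" if "c \<in> {0..m}" for c using that m by (simp add: r_def)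
    show "\<forall>\<^sub>F t in at_top. - z t \<le> m" using le by (elim eventually_mono) simp
  qed (use S m z in \<open>auto intro!: continuous_intros\<close>)
  moreover have "(- (m / p) - ln (1 - p * (m / p)) / p) - (- 0 - ln (1 - p * 0) / p) + (3/2 - m / p) * p
      \<le> m * (1 + m / 3 + m\<^sup>2 / 6) / (1 - m)"
  proof -
    have "(- (m / p) - ln (1 - p * (m / p)) / p) - (- 0 - ln (1 - p * 0) / p) + (3/2 - m / p) * p
       = - (1 - m) + (- ((1 - m) * ln (1 - m))) / m + (1/2 + m) * (m / (1 - m))"
    proof -
      have "ln (1 - m) / p = (1 - m) * ln (1 - m) / m" by (simp add: p_def)
      then show ?thesis unfolding p(3) unfolding p(2) by (simp add: p_def algebra_simps diff_divide_distrib)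
    qed
    also have "\<dots> \<le> - (1 - m) + (m - m\<^sup>2 / 2 - m ^ 3 / 6) / m + (1/2 + m) * (m / (1 - m))"
      using one_minus_ln_one_minus_ge[of m] m by (intro add_mono divide_right_mono) auto
    also have "\<dots> = m * (1 + m / 3 + m\<^sup>2 / 6) / (1 - m)"
      using m by (simp add: divide_simps) (simp add: algebra_simps power2_eq_square power3_eq_cube)
    finally show ?thesis .
  qed
  ultimately show ?thesis by (elim eventually_mono) linarith
qed

lemma tendsto_zero: "(z \<longlongrightarrow> 0) at_top"
proof -
  define \<phi> where "\<phi> M = 3 * M / (3 + 4 * M)" for M :: real
  define B where "B m = m * (1 + m / 3 + m\<^sup>2 / 6) / (1 - m)" for m :: real
  have \<phi>: "0 < \<phi> M" "\<phi> M < 3/4" "\<phi> M < M" if "0 < M" for M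
    using that by (auto simp: \<phi>_def field_simps)
  have B0: "0 < B m" if "0 < m" "m < 3/4" for m
    using that by (auto simp: B_def intro!: divide_pos_pos mult_pos_pos add_pos_nonneg)
  have less: "B (\<phi> M) < M" if M: "0 < M" for M
  proof -
    define m where "m = \<phi> M"
    have m: "0 < m" "m < 3/4" using \<phi>[OF M] by (auto simp: m_def)
    \<comment> \<open>Inverting \<open>\<phi>\<close> expresses the comparison in \<open>m\<close>
      alone. The margin is cubic, so the composed map has slope 1 at 0.\<close>
    have Mm: "M = 3 * m / (3 - 4 * m)" using M by (simp add: m_def \<phi>_def field_simps)
    have "3 * m / (3 - 4 * m) - B m = m ^ 3 * (5/6 + 2/3 * m) / ((3 - 4 * m) * (1 - m))"
      using m by (simp add: B_def divide_simps) (simp add: algebra_simps power2_eq_square power3_eq_cube)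
    moreover have "0 < m ^ 3 * (5/6 + 2/3 * m) / ((3 - 4 * m) * (1 - m))"
      using m by (intro divide_pos_pos mult_pos_pos) auto
    ultimately have "B m < M" using Mm by linarith
    then show ?thesis by (simp only: m_def)
  qed
  have cont: "isCont (\<lambda>M. B (\<phi> M)) M" if M: "0 < M" for M
  proof -
    have "1 - \<phi> M \<noteq> 0" "3 + 4 * M \<noteq> 0" using \<phi>[OF M] M by auto
    then show ?thesis unfolding B_def \<phi>_def by (intro continuous_intros) (auto simp: \<phi>_def)
  qed
  have "\<forall>\<^sub>F t in at_top. \<bar>z t\<bar> < e" if "0 < e" for e
  proof -
    obtain M where M: "0 < M \<and> (\<forall>\<^sub>F t in at_top. z t \<le> M)" "M < e"
    proof (rule iterated_bounds_to_zero[where P = "\<lambda>M. 0 < M \<and> (\<forall>\<^sub>F t in at_top. z t \<le> M)" and G = "\<lambda>M. B (\<phi> M)"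
          and ?M0.0 = "27/10", OF _ _ _ cont less \<open>0 < e\<close>])
      show "0 < (27/10::real) \<and> (\<forall>\<^sub>F t in at_top. z t \<le> 27/10)" using eventually_upper by simp
      fix M assume M: "0 < M \<and> (\<forall>\<^sub>F t in at_top. z t \<le> M)"
      then have "\<forall>\<^sub>F t in at_top. z t \<ge> - \<phi> M" unfolding \<phi>_def by (intro lower_from_upper) auto
      then have "\<forall>\<^sub>F t in at_top. z t \<le> B (\<phi> M)"
        unfolding B_def using \<phi>[of M] M by (intro upper_from_lower) auto
      then show "0 < B (\<phi> M) \<and> (\<forall>\<^sub>F t in at_top. z t \<le> B (\<phi> M))" using B0 \<phi>[of M] M by simp
    qed auto
    then have "\<forall>\<^sub>F t in at_top. z t \<ge> - \<phi> M" unfolding \<phi>_def by (intro lower_from_upper) auto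
    moreover have "\<forall>\<^sub>F t in at_top. z t \<le> M" using M by simp
    ultimately show ?thesis by eventually_elim (use \<phi>[of M] M in auto)
  qed
  then show ?thesis by (simp add: tendsto_iff dist_real_def)
qed

end

section \<open>The linear inequality\<close>

context delay_clock
begin

text \<open>With rate \<open>c\<close> the ramp saturates after one clock unit, hence
  \<open>1 \<le> \<Lambda>\<close>, and an excursion has depth at most
  \<open>M / 2 + (\<Lambda> - 1) * M = (\<Lambda> - 1/2) * M\<close>, a contraction for
  \<open>\<Lambda> < 3/2\<close>. The cap 2 on the rate yields the initial bound, since
  \<open>2 * \<Lambda> \<le> 3\<close>.\<close>

lemma linear_delay_tendsto_zero:
  fixes z :: "real \<Rightarrow> real"
  assumes \<Lambda>: "1 \<le> \<Lambda>" "\<Lambda> < 3/2" and z: "continuous_on {S0..} z"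
    and dec: "decay_bound h S0 \<tau> (\<lambda>c. min c 2) z" "decay_bound h S0 \<tau> (\<lambda>c. min c 2) (\<lambda>t. - z t)"
    and osc: "\<And>T. \<exists>t\<ge>T. z t > 0" "\<And>T. \<exists>t\<ge>T. z t < 0"
  shows "(z \<longlongrightarrow> 0) at_top"
proof -
  have bounded: "\<forall>\<^sub>F t in at_top. w t \<ge> - 3"
    if w: "continuous_on {S0..} w" "decay_bound h S0 \<tau> (\<lambda>c. min c 2) w" "\<And>T. \<exists>t\<ge>T. w t > 0" for w
  proof -
    have ci: "continuous_on {0..\<Lambda>} (\<lambda>v. min (2 * v) 2 :: real)" by (intro continuous_intros)
    have "\<forall>\<^sub>F t in at_top. w t \<ge> - integral {0..\<Lambda>} (\<lambda>v. min (2 * v) 2)"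
    proof (rule excursion_bound_integral[where S = "S0 + h" and r = "\<lambda>c. min c 2" and C = "\<lambda>v. 2 * v", OF _ w(1,3)])
      show "decay_bound h (S0 + h) \<tau> (\<lambda>c. min c 2) w" using decay_bound_later[OF w(2)] h by simp
      show "((\<lambda>v. min (2 * v) 2) has_integral integral {0..\<Lambda>} (\<lambda>v. min (2 * v) 2)) {0..\<Lambda>}"
        using integrable_continuous_real[OF ci] by blast
      fix s t assume st: "S0 + h \<le> s" "s \<le> t" "w t = 0"
      have "compact (w ` {s-h..t})"
        by (intro compact_continuous_image continuous_on_subset[OF w(1)]) (use st in auto)
      then obtain B where B: "\<And>u. u \<in> {s-h..t} \<Longrightarrow> \<bar>w u\<bar> \<le> B"
        using compact_imp_bounded by (force simp: bounded_iff)
      have B0: "0 \<le> B" using B[of t] st h by simp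
      have "w t - w s \<ge> - (min B 2) * (\<tau> t - \<tau> s)"
      proof (rule w(2)[unfolded decay_bound_def, rule_format], intro conjI ballI)
        show "w u \<le> B" if "u \<in> {s-h..t}" for u using B[OF that] by simp
      qed (use st B0 in auto)
      moreover have "min B 2 * (\<tau> t - \<tau> s) \<le> 2 * (\<tau> t - \<tau> s)"
        using \<tau>_mono[of s t] st h by (intro mult_right_mono) auto
      ultimately show "w s \<le> 2 * (\<tau> t - \<tau> s)" using st by simp
    qed (use h ci in auto)
    moreover have "integral {0..\<Lambda>} (\<lambda>v. min (2 * v) 2) \<le> integral {0..\<Lambda>} (\<lambda>v. 2 :: real)"
      by (intro integral_le integrable_continuous_real ci) auto
    ultimately show ?thesis using \<Lambda> by (elim eventually_mono) auto
  qed
  have step: "\<forall>\<^sub>F t in at_top. w t \<ge> - ((\<Lambda> - 1/2) * M)"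
    if w: "continuous_on {S0..} w" "decay_bound h S0 \<tau> (\<lambda>c. min c 2) w" "\<And>T. \<exists>t\<ge>T. w t > 0"
      and M: "0 < M" "\<forall>\<^sub>F t in at_top. w t \<le> M" for w M
  proof -
    have d: "decay_bound h S0 \<tau> (\<lambda>c. c) w" by (rule decay_bound_mono[OF w(2)]) auto
    have "\<forall>\<^sub>F t in at_top. w t \<ge> - (M * (M / M)\<^sup>2 / 2 - M * 0\<^sup>2 / 2 + (\<Lambda> - M / M) * M)"
    proof (rule excursion_bound_ramp[where r = "\<lambda>c. c" and S = S0 and F = "\<lambda>v. M * v\<^sup>2 / 2", OF _ w(1,3) d])
      show "((\<lambda>v. M * v\<^sup>2 / 2) has_real_derivative M * v) (at v within {0..M / M})" for v
        by (auto intro!: derivative_eq_intros)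
    qed (use M \<Lambda> in auto)
    then show ?thesis using M by (elim eventually_mono) (simp add: field_simps)
  qed
  have zm: "continuous_on {S0..} (\<lambda>t. - z t)" "\<And>T. \<exists>t\<ge>T. - z t > 0"
    using z osc by (auto intro!: continuous_intros)
  have "\<forall>\<^sub>F t in at_top. \<bar>z t\<bar> < e" if "0 < e" for e
  proof -
    obtain M where M: "0 < M \<and> (\<forall>\<^sub>F t in at_top. \<bar>z t\<bar> \<le> M)" "M < e"
    proof (rule iterated_bounds_to_zero[where P = "\<lambda>M. 0 < M \<and> (\<forall>\<^sub>F t in at_top. \<bar>z t\<bar> \<le> M)" and G = "\<lambda>M. (\<Lambda> - 1/2) * M"
          and ?M0.0 = 3, OF _ _ _ _ _ \<open>0 < e\<close>])
      have "\<forall>\<^sub>F t in at_top. \<bar>z t\<bar> \<le> 3"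
        using bounded[OF z dec(1) osc(1)] bounded[OF zm(1) dec(2) zm(2)] by eventually_elim auto
      then show "0 < (3::real) \<and> (\<forall>\<^sub>F t in at_top. \<bar>z t\<bar> \<le> 3)" by simp
      show "isCont (\<lambda>M. (\<Lambda> - 1/2) * M) M" for M by (intro continuous_intros)
      show "(\<Lambda> - 1/2) * M < M" if "0 < M" for M using that \<Lambda> by simp
      fix M assume M: "0 < M \<and> (\<forall>\<^sub>F t in at_top. \<bar>z t\<bar> \<le> M)"
      then have b: "0 < M" "\<forall>\<^sub>F t in at_top. z t \<le> M" "\<forall>\<^sub>F t in at_top. - z t \<le> M"
        by (auto elim!: eventually_mono)
      have "\<forall>\<^sub>F t in at_top. \<bar>z t\<bar> \<le> (\<Lambda> - 1/2) * M"
        using step[OF z dec(1) osc(1) b(1,2)] step[OF zm(1) dec(2) zm(2) b(1,3)] by eventually_elim auto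
      then show "0 < (\<Lambda> - 1/2) * M \<and> (\<forall>\<^sub>F t in at_top. \<bar>z t\<bar> \<le> (\<Lambda> - 1/2) * M)" using M \<Lambda> by simp
    qed auto
    show ?thesis using conjunct2[OF M(1)] by (rule eventually_mono) (use M(2) in simp)
  qed
  then show ?thesis by (simp add: tendsto_iff dist_real_def)
qed

end

section \<open>Convergence of solutions\<close>

lemma Pade_exp_le:
  fixes c :: real
  assumes "0 \<le> c"
  shows "exp c * (2 - c) \<le> 2 + c"
proof -
  have mono: "exp x * (1 - x) \<le> 1" for x :: real
  proof -
    have "exp x * (1 - x) \<le> exp x * exp (- x)"
      using exp_ge_add_one_self[of "- x"] by (intro mult_left_mono) auto
    then show ?thesis by (simp add: exp_minus)
  qed
  have "2 + 0 - exp 0 * (2 - 0) \<le> 2 + c - exp c * (2 - c)"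
  proof (rule DERIV_nonneg_imp_nondecreasing[OF assms])
    fix x :: real
    have "((\<lambda>x. 2 + x - exp x * (2 - x)) has_real_derivative 1 - exp x * (1 - x)) (at x)"
      by (auto intro!: derivative_eq_intros simp: algebra_simps)
    then show "\<exists>y. ((\<lambda>x. 2 + x - exp x * (2 - x)) has_real_derivative y) (at x) \<and> 0 \<le> y"
      using mono[of x] by (intro exI[of _ "1 - exp x * (1 - x)"]) auto
  qed
  then show ?thesis by simp
qed

text \<open>In the logarithmic variable the comparison function \<open>x / (1 + b x)\<close> becomes
  \<open>1 / ((b - 1/2) + coth (y/2) / 2)\<close>, which is dominated by a function of the same rational type
  with parameter \<open>b - 1/2\<close>.\<close>

lemma rational_exp_le:
  fixes b c :: real
  assumes b: "0 \<le> b" and c: "0 \<le> c" and \<beta>: "0 < 1 + (b - 1/2) * c"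
  shows "(exp c - 1) / (1 + b * (exp c - 1)) \<le> c / (1 + (b - 1/2) * c)"
proof -
  have "0 \<le> b * (exp c - 1)" using b c by simp
  then have pos: "0 < 1 + b * (exp c - 1)" by simp
  \<comment> \<open>Cross-multiplication cancels every term containing \<open>b\<close>; only the
    Pade inequality remains.\<close>
  have eq: "c * (1 + b * (exp c - 1)) - (exp c - 1) * (1 + (b - 1/2) * c) = (2 + c - exp c * (2 - c)) / 2"
    by (simp add: field_simps)
  have "0 \<le> c * (1 + b * (exp c - 1)) - (exp c - 1) * (1 + (b - 1/2) * c)"
    unfolding eq using Pade_exp_le[OF c] by simp
  then have "(exp c - 1) * (1 + (b - 1/2) * c) \<le> c * (1 + b * (exp c - 1))"
    by (rule diff_ge_0_iff_ge[THEN iffD1])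
  then show ?thesis
    by (subst pos_divide_le_eq[OF pos], subst times_divide_eq_left, subst pos_le_divide_eq[OF \<beta>])
qed

text \<open>The Pade inequality multiplied by \<open>exp (- c)\<close>. Here positivity of the
  original denominator is a conclusion: it follows from that of the rational one and will make
  condition (6) applicable.\<close>

lemma rational_exp_minus_le:
  fixes b c :: real
  assumes c: "0 \<le> c" and \<beta>: "0 < 1 - (b - 1/2) * c"
  shows "0 < 1 - b * (1 - exp (- c))"
    "(1 - exp (- c)) / (1 - b * (1 - exp (- c))) \<le> c / (1 - (b - 1/2) * c)"
proof -
  define E where "E = 1 - exp (- c)"
  have "exp (- c) * (exp c * (2 - c)) \<le> exp (- c) * (2 + c)"
    using Pade_exp_le[OF c] by (intro mult_left_mono) auto
  then have "2 - c \<le> exp (- c) * (2 + c)" by (simp add: exp_minus flip: mult.assoc)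
  then have E: "(2 + c) * E \<le> 2 * c" by (simp add: E_def algebra_simps)
  then have le: "E * (1 - (b - 1/2) * c) \<le> c * (1 - b * E)" by (simp add: algebra_simps)
  have pos: "0 < 1 - b * E"
  proof (cases "c = 0")
    case False
    then have "0 < E" using c by (simp add: E_def)
    then have "0 < c * (1 - b * E)" using le \<beta> by (meson less_le_trans mult_pos_pos)
    then show ?thesis using c by (simp add: zero_less_mult_iff)
  qed (simp add: E_def)
  then show "0 < 1 - b * (1 - exp (- c))" by (simp add: E_def)
  show "(1 - exp (- c)) / (1 - b * (1 - exp (- c))) \<le> c / (1 - (b - 1/2) * c)"
    unfolding E_def[symmetric]
    by (subst pos_divide_le_eq[OF pos], subst times_divide_eq_left, subst pos_le_divide_eq[OF \<beta>]) (rule le)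
qed

section \<open>Nonoscillating solutions\<close>

lemma convergent_imp_bounded_real:
  fixes F :: "real \<Rightarrow> real"
  assumes F: "continuous_on {p..} F" and lim: "(F \<longlongrightarrow> c) at_top"
  obtains D where "\<And>v. p \<le> v \<Longrightarrow> \<bar>F v - c\<bar> \<le> D"
proof -
  have "\<forall>\<^sub>F v in at_top. dist (F v) c < 1" using lim by (simp add: tendsto_iff)
  then obtain q where q: "\<And>v. q \<le> v \<Longrightarrow> \<bar>F v - c\<bar> < 1" by (auto simp: eventually_at_top_linorder dist_real_def)
  have "compact ((\<lambda>v. F v - c) ` {p..q})"
    by (intro compact_continuous_image continuous_intros continuous_on_subset[OF F]) auto
  then obtain B where B: "\<And>v. v \<in> {p..q} \<Longrightarrow> \<bar>F v - c\<bar> \<le> B"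
    using compact_imp_bounded by (force simp: bounded_iff)
  show thesis
  proof (rule that[of "max B 1"])
    show "\<bar>F v - c\<bar> \<le> max B 1" if "p \<le> v" for v
      using B[of v] q[of v] that by (cases "v \<le> q") auto
  qed
qed

lemma nonincreasing_bounded_tendsto:
  fixes F :: "real \<Rightarrow> real"
  assumes mono: "\<And>s t. T \<le> s \<Longrightarrow> s \<le> t \<Longrightarrow> F t \<le> F s" and B: "\<And>t. T \<le> t \<Longrightarrow> B \<le> F t"
  obtains c where "(F \<longlongrightarrow> c) at_top" "B \<le> c" "c \<le> F T"
proof -
  define c where "c = Inf (F ` {T..})"
  have bdd: "bdd_below (F ` {T..})" using B by (auto intro!: bdd_belowI[of _ B])
  have le: "c \<le> F t" if "T \<le> t" for t unfolding c_def using that by (intro cInf_lower bdd) auto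
  have "B \<le> c" unfolding c_def using B by (intro cInf_greatest) auto
  moreover have "(F \<longlongrightarrow> c) at_top"
  proof (rule order_tendstoI)
    fix a assume "a < c"
    then have "a < F t" if "T \<le> t" for t using le[OF that] by simp
    then show "\<forall>\<^sub>F t in at_top. a < F t" unfolding eventually_at_top_linorder by blast
  next
    fix a assume "c < a"
    then obtain t where t: "T \<le> t" "F t < a" unfolding c_def using cInf_lessD[of "F ` {T..}" a] by auto
    have "F s < a" if "t \<le> s" for s using mono[OF t(1) that] t(2) by simp
    then show "\<forall>\<^sub>F t in at_top. F t < a" unfolding eventually_at_top_linorder by blast
  qed
  ultimately show thesis using le[OF order_refl] by (intro that)
qed

context delay_equation
begin

lemma rhs_ge_1: "1 \<le> u \<Longrightarrow> rhs s u \<le> 0"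
  using rhs_sign(1)[of u s] f_one[of s] by (cases "u = 1") (auto simp: rhs_def)

context
  fixes x :: "real \<Rightarrow> real"
  assumes sol: "solution_on h lam f L \<infinity> x" and nt: "nontrivial_on \<infinity> x"
begin

lemma x_pos: "0 \<le> t \<Longrightarrow> 0 < x t"
  using solution_positive[OF sol nt] by simp

lemma x_cont: "continuous_on {-h..} x"
proof -
  have "{t. -h \<le> t \<and> ereal t < \<infinity>} = {-h..}" by auto
  then show ?thesis using sol by (simp add: solution_on_def)
qed

lemma ln_x_cont: "continuous_on {0..} (\<lambda>t. ln (x t))"
  by (intro continuous_on_ln continuous_on_subset[OF x_cont]) (use h_pos x_pos in \<open>force+\<close>)

lemma ln_x_has_integral:
  "0 \<le> s \<Longrightarrow> s \<le> t \<Longrightarrow> ((\<lambda>u. rhs u (L u (segment h x u))) has_integral (ln (x t) - ln (x s))) {s..t}"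
  by (rule solution_ln_has_integral[OF sol]) (auto intro: x_pos)

lemma L_x_bounds:
  assumes "0 \<le> t" "\<And>u. u \<in> {t-h..t} \<Longrightarrow> p \<le> x u" "\<And>u. u \<in> {t-h..t} \<Longrightarrow> x u \<le> q"
  shows "p \<le> L t (segment h x t)" "L t (segment h x t) \<le> q"
  using L_bounds[of t t x p q] assms continuous_on_subset[OF x_cont, of "{t-h..t}"] by auto

lemma L_x_le: "0 \<le> t \<Longrightarrow> (\<And>u. u \<in> {t-h..t} \<Longrightarrow> x u \<le> q) \<Longrightarrow> L t (segment h x t) \<le> q"
  using solution_L_bounds(2)[OF sol, of t q] by simp

lemma L_x_ge:
  assumes t: "0 \<le> t" and p: "\<And>u. u \<in> {t-h..t} \<Longrightarrow> p \<le> x u"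
  shows "p \<le> L t (segment h x t)"
proof -
  have c: "continuous_on {t-h..t} x" by (rule continuous_on_subset[OF x_cont]) (use t in auto)
  obtain q where "\<And>v. v \<in> {t-h..t} \<Longrightarrow> x v \<le> q"
    using continuous_attains_sup[OF compact_Icc _ c] h_pos by fastforce
  then show ?thesis using L_x_bounds(1)[OF t p] by blast
qed

lemma L_x_pos:
  assumes t: "h \<le> t"
  shows "0 < L t (segment h x t)"
proof -
  have c: "continuous_on {t-h..t} x" by (rule continuous_on_subset[OF x_cont]) (use t h_pos in auto)
  obtain u where u: "u \<in> {t-h..t}" "\<And>v. v \<in> {t-h..t} \<Longrightarrow> x u \<le> x v"
    using continuous_attains_inf[OF compact_Icc _ c] h_pos by fastforce
  have "0 < x u" using x_pos u(1) t by simp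
  also have "\<dots> \<le> L t (segment h x t)" by (rule L_x_ge) (use u t h_pos in auto)
  finally show ?thesis .
qed

text \<open>For a right-hand side of one sign, convergence of \<open>ln x\<close> means absolute
  integrability along the solution, and this is what survives the passage to a continuous argument.
  The factor \<open>\<sigma>\<close> treats both signs at once.\<close>

lemma one_signed_limit:
  assumes \<sigma>: "\<sigma> = 1 \<or> \<sigma> = -1" and T: "0 \<le> T"
    and sign: "\<And>s. T \<le> s \<Longrightarrow> 0 \<le> \<sigma> * rhs s (L s (segment h x s))"
    and lim: "(x \<longlongrightarrow> c) at_top" and c: "0 < c"
  shows "c = 1"
proof (rule ccontr)
  assume "c \<noteq> 1"
  \<comment> \<open>Extended as a constant to the left of \<open>- h\<close>, because measurability
    of the feedback was shown for functions continuous on the whole line.\<close>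
  define X where "X t = x (max (- h) t)" for t
  have Xc: "continuous_on UNIV X" unfolding X_def
    by (rule continuous_on_compose2[OF x_cont]) (auto intro!: continuous_intros)
  define u where "u = feedback X 0"
  have um: "u \<in> borel_measurable lebesgue" unfolding u_def by (rule feedback_meas[OF Xc])
  have u: "u s = L s (segment h x s)" if "0 \<le> s" for s
  proof -
    have "segment h X s = segment h x s" by (rule segment_cong) (use that in \<open>auto simp: X_def\<close>)
    then show ?thesis using that by (simp add: u_def feedback_def)
  qed
  obtain D where D: "\<And>v. - h \<le> v \<Longrightarrow> \<bar>x v - c\<bar> \<le> D"
    by (rule convergent_imp_bounded_real[OF x_cont lim], rule that, assumption+)
  \<comment> \<open>Histories seen at times in \<open>(k, k + 1)\<close> reach back at most to
    \<open>k - h\<close>, so \<open>d k\<close> bounds the distance of the feedback from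
    \<open>c\<close> there.\<close>
  define d where "d k = (SUP v\<in>{real k - h..}. \<bar>x v - c\<bar>)" for k
  have bdd: "bdd_above ((\<lambda>v. \<bar>x v - c\<bar>) ` {real k - h..})" for k
    using D by (auto intro!: bdd_aboveI[of _ D])
  have d_ge: "\<bar>x v - c\<bar> \<le> d k" if "real k - h \<le> v" for v k
    unfolding d_def using that by (intro cSUP_upper bdd) auto
  have d_lim: "d \<longlonglongrightarrow> 0"
  proof (rule LIMSEQ_I)
    fix e :: real assume "e > 0"
    then have "0 < e / 2" by simp
    then have "\<forall>\<^sub>F v in at_top. dist (x v) c < e / 2" using lim unfolding tendsto_iff by blast
    then obtain q where q: "\<And>v. q \<le> v \<Longrightarrow> \<bar>x v - c\<bar> < e / 2" by (auto simp: eventually_at_top_linorder dist_real_def)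
    obtain n where n: "q + h \<le> real n" using real_arch_simple by blast
    have "norm (d k - 0) < e" if "n \<le> k" for k
    proof -
      have "d k \<le> e / 2" unfolding d_def
        using q n that by (intro cSUP_least) (auto intro!: less_imp_le)
      moreover have "0 \<le> d k" using d_ge[of k "real k"] h_pos by simp
      ultimately show ?thesis using \<open>e > 0\<close> by simp
    qed
    then show "\<exists>n. \<forall>k\<ge>n. norm (d k - 0) < e" by blast
  qed
  have uc: "\<bar>u s - c\<bar> \<le> d k" if s: "s \<in> {real k<..<real k + 1}" for k s
  proof -
    have s0: "0 \<le> s" using s by simp
    have "c - d k \<le> x v \<and> x v \<le> c + d k" if "v \<in> {s-h..s}" for v
      using d_ge[of k v] that s by (auto simp: abs_le_iff)
    then have "c - d k \<le> L s (segment h x s)" "L s (segment h x s) \<le> c + d k"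
      using L_x_bounds[OF s0, of "c - d k" "c + d k"] by auto
    then show ?thesis using u[OF s0] by (simp add: abs_le_iff)
  qed
  have ln_lim: "((\<lambda>t. ln (x t)) \<longlongrightarrow> ln c) at_top" using lim c by (intro tendsto_ln) auto
  have "continuous_on {T..} (\<lambda>t. ln (x t))" by (rule continuous_on_subset[OF ln_x_cont]) (use T in auto)
  then obtain K where K: "\<And>v. T \<le> v \<Longrightarrow> \<bar>ln (x v) - ln c\<bar> \<le> K"
    by (rule convergent_imp_bounded_real[OF _ ln_lim], blast)
  \<comment> \<open>Before \<open>T\<close> the sign is not controlled; a majorant covers this
    initial piece.\<close>
  obtain m where m: "integrable lebesgue m" "\<And>s. 0 \<le> m s" "\<And>s v. s \<in> {0..T} \<Longrightarrow> v \<in> {0..c + D} \<Longrightarrow> \<bar>rhs s v\<bar> \<le> m s"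
    by (rule integrable_domination[of 0 T 0 "c + D"], rule that, assumption+)
  have usm: "(\<lambda>s. rhs s (u s)) \<in> borel_measurable lebesgue" by (rule g_superposition[OF um])
  have tail: "(\<integral>\<^sup>+ s. ennreal \<bar>rhs s (u s)\<bar> * indicator {T..t} s \<partial>lebesgue) \<le> ennreal (2 * K)" if "T \<le> t" for t
  proof -
    have "((\<lambda>s. \<sigma> * rhs s (L s (segment h x s))) has_integral \<sigma> * (ln (x t) - ln (x T))) {T..t}"
      using ln_x_has_integral[OF T that] by (rule has_integral_mult_right)
    then have "integral\<^sup>N lborel (\<lambda>s. ennreal (\<sigma> * rhs s (L s (segment h x s))) * indicator {T..t} s)
        = ennreal (\<sigma> * (ln (x t) - ln (x T)))"
      by (intro nn_integral_has_integral_lebesgue') (auto intro: sign)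
    also have "\<dots> \<le> ennreal (2 * K)"
      using K[OF order_refl] K[OF that] \<sigma> by (intro ennreal_leI) (auto simp: abs_le_iff)
    also have "integral\<^sup>N lborel (\<lambda>s. ennreal (\<sigma> * rhs s (L s (segment h x s))) * indicator {T..t} s)
       = (\<integral>\<^sup>+ s. ennreal \<bar>rhs s (u s)\<bar> * indicator {T..t} s \<partial>lebesgue)"
      unfolding nn_integral_completion
    proof (rule nn_integral_cong)
      fix s
      show "ennreal (\<sigma> * rhs s (L s (segment h x s))) * indicator {T..t} s = ennreal \<bar>rhs s (u s)\<bar> * indicator {T..t} s"
      proof (cases "s \<in> {T..t}")
        case True
        then have "0 \<le> \<sigma> * rhs s (L s (segment h x s))" "u s = L s (segment h x s)" using sign[of s] u[of s] T by auto
        then have "\<bar>rhs s (u s)\<bar> = \<sigma> * rhs s (L s (segment h x s))" using \<sigma> by auto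
        then show ?thesis by simp
      qed simp
    qed
    finally show ?thesis .
  qed
  define C where "C = (LINT s|lebesgue. m s) + 2 * K"
  have C: "(\<integral>\<^sup>+ s. ennreal \<bar>rhs s (u s)\<bar> * indicator {0..real n} s \<partial>lebesgue) \<le> ennreal C" for n
  proof -
    have K0: "0 \<le> K" using K[OF order_refl] by (meson abs_ge_zero order_trans)
    have meas: "(\<lambda>s. ennreal \<bar>rhs s (u s)\<bar> * indicator {T..max T (real n)} s) \<in> borel_measurable lebesgue"
      by (intro borel_measurable_times_ennreal borel_measurable_indicator measurable_compose[OF _ measurable_ennreal] borel_measurable_abs usm) simp
    have "(\<integral>\<^sup>+ s. ennreal \<bar>rhs s (u s)\<bar> * indicator {0..real n} s \<partial>lebesgue)
      \<le> (\<integral>\<^sup>+ s. ennreal (m s) + ennreal \<bar>rhs s (u s)\<bar> * indicator {T..max T (real n)} s \<partial>lebesgue)"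
    proof (rule nn_integral_mono)
      fix s
      show "ennreal \<bar>rhs s (u s)\<bar> * indicator {0..real n} s
        \<le> ennreal (m s) + ennreal \<bar>rhs s (u s)\<bar> * indicator {T..max T (real n)} s"
      proof (cases "s \<in> {0..real n} \<and> s < T")
        case True
        have "0 \<le> x v \<and> x v \<le> c + D" if "- h \<le> v" for v
          using D[OF that] sol that by (auto simp: solution_on_def abs_le_iff)
        then have "u s \<in> {0..c + D}" using L_x_bounds[of s 0 "c + D"] u[of s] True by auto
        then have "\<bar>rhs s (u s)\<bar> \<le> m s" using True by (intro m(3)) auto
        then have "ennreal \<bar>rhs s (u s)\<bar> \<le> ennreal (m s)" by (rule ennreal_leI)
        then show ?thesis using True by simp
      next
        case False
        then show ?thesis by (auto simp: indicator_def)
      qed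
    qed
    also have "\<dots> = (\<integral>\<^sup>+ s. ennreal (m s) \<partial>lebesgue) + (\<integral>\<^sup>+ s. ennreal \<bar>rhs s (u s)\<bar> * indicator {T..max T (real n)} s \<partial>lebesgue)"
      using m(1) meas by (intro nn_integral_add) auto
    also have "\<dots> \<le> ennreal (LINT s|lebesgue. m s) + ennreal (2 * K)"
      using nn_integral_eq_integral[OF m(1)] m(2) tail[of "max T (real n)"] by (intro add_mono) auto
    also have "\<dots> = ennreal C" using m(2) K0 by (simp add: C_def)
    finally show ?thesis .
  qed
  obtain w where w: "continuous_on UNIV w" "(w \<longlongrightarrow> c) at_top" "set_integrable lebesgue {0..} (\<lambda>s. rhs s (w s))"
    by (rule continuous_perturbation[OF um d_lim uc C], assumption, rule that, assumption+)
  have "improper_integral_diverges (\<lambda>s. lam s * f s (w s))"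
    using w c \<open>c \<noteq> 1\<close> by (intro f_div[of w c]) (auto intro: continuous_on_subset)
  moreover have "((\<lambda>T. LINT s|lebesgue_on {0..T}. lam s * f s (w s)) \<longlongrightarrow> (LINT s:{0..}|lebesgue. rhs s (w s))) at_top"
  proof (rule Lim_transform_eventually[OF tendsto_set_lebesgue_integral_at_top[OF _ w(3)]])
    have "(LINT s:{0..T}|lebesgue. rhs s (w s)) = (LINT s|lebesgue_on {0..T}. lam s * f s (w s))" for T
      unfolding set_lebesgue_integral_def
      by (subst integral_restrict_space, simp, rule Bochner_Integration.integral_cong) (auto simp: rhs_def indicator_def)
    then show "\<forall>\<^sub>F T in at_top. (LINT s:{0..T}|lebesgue. rhs s (w s)) = (LINT s|lebesgue_on {0..T}. lam s * f s (w s))"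
      by simp
  qed simp
  ultimately show False by (auto simp: improper_integral_diverges_def)
qed

lemma nonoscillating_limit:
  assumes no: "\<not> ((\<forall>T. \<exists>t\<ge>T. 0 < ln (x t)) \<and> (\<forall>T. \<exists>t\<ge>T. ln (x t) < 0))"
  shows "(x \<longlongrightarrow> 1) at_top"
proof -
  have I: "ln (x t) - ln (x s) = integral {s..t} (\<lambda>u. rhs u (L u (segment h x u)))"
    "(\<lambda>u. rhs u (L u (segment h x u))) integrable_on {s..t}" if "0 \<le> s" "s \<le> t" for s t
    using integral_unique[OF ln_x_has_integral[OF that]] ln_x_has_integral[OF that] by auto
  have "(\<exists>T. \<forall>t\<ge>T. ln (x t) \<le> 0) \<or> (\<exists>T. \<forall>t\<ge>T. 0 \<le> ln (x t))"
    using no unfolding not_less[symmetric] by blast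
  then consider T where "\<And>t. T \<le> t \<Longrightarrow> ln (x t) \<le> 0" | T where "\<And>t. T \<le> t \<Longrightarrow> 0 \<le> ln (x t)"
    by blast
  then show ?thesis
  proof cases
    case 1
    \<comment> \<open>From \<open>S\<close> on the entire delay window lies beyond \<open>T\<close>
      and in nonnegative times.\<close>
    define S where "S = max T 0 + h"
    have S: "0 \<le> S" "h \<le> S" "T \<le> S - h" "0 \<le> S - h" using h_pos by (auto simp: S_def)
    have le1: "x t \<le> 1" if "S - h \<le> t" for t
      using 1[of t] x_pos[of t] S that by simp
    have sg: "0 \<le> rhs s (L s (segment h x s))" if "S \<le> s" for s
    proof (rule rhs_sign(2))
      show "0 < L s (segment h x s)" using L_x_pos S that by simp
      show "L s (segment h x s) \<le> 1" by (rule L_x_le) (use le1 S that in auto)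
    qed
    have mono: "x s \<le> x t" if "S \<le> s" "s \<le> t" for s t
    proof -
      have "0 \<le> ln (x t) - ln (x s)"
        using I[of s t] that S sg by (auto intro!: integral_nonneg)
      then show ?thesis using x_pos[of s] x_pos[of t] that S by simp
    qed
    obtain c where c: "((\<lambda>t. - x t) \<longlongrightarrow> c) at_top" "- 1 \<le> c" "c \<le> - x S"
      by (rule nonincreasing_bounded_tendsto[of S "\<lambda>t. - x t" "-1"]) (use mono le1 h_pos in auto)
    have lim: "(x \<longlongrightarrow> - c) at_top" using tendsto_minus[OF c(1)] by simp
    have "- c = 1"
      by (rule one_signed_limit[of 1 S, OF _ S(1) _ lim]) (use sg c x_pos[OF S(1)] in auto)
    then show ?thesis using lim by simp
  next
    case 2
    define S where "S = max T 0 + h"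
    have S: "0 \<le> S" "h \<le> S" "T \<le> S - h" "0 \<le> S - h" using h_pos by (auto simp: S_def)
    have ge1: "1 \<le> x t" if "S - h \<le> t" for t
      using 2[of t] x_pos[of t] S that by (simp add: ln_ge_zero_iff)
    have sg: "rhs s (L s (segment h x s)) \<le> 0" if "S \<le> s" for s
      by (rule rhs_ge_1, rule L_x_ge) (use ge1 S that in auto)
    have mono: "x t \<le> x s" if "S \<le> s" "s \<le> t" for s t
    proof -
      have "0 \<le> integral {s..t} (\<lambda>u. - rhs u (L u (segment h x u)))"
        using I(2)[of s t] that S sg by (intro integral_nonneg integrable_neg) auto
      then have "ln (x t) - ln (x s) \<le> 0" using I(1)[of s t] that S by simp
      then show ?thesis using x_pos[of s] x_pos[of t] that S by simp
    qed
    obtain c where c: "(x \<longlongrightarrow> c) at_top" "1 \<le> c" "c \<le> x S"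
      by (rule nonincreasing_bounded_tendsto[of S x 1]) (use mono ge1 h_pos in auto)
    have "c = 1"
      by (rule one_signed_limit[of "-1" S, OF _ S(1) _ c(1)]) (use sg c(2) in auto)
    then show ?thesis using c(1) by simp
  qed
qed

end

end

section \<open>The clock and the inequalities for the logarithm of a solution\<close>

text \<open>The products \<open>b * x * y\<close> cancel on cross-multiplication, so
  \<open>b\<close> may have either sign; a negative parameter occurs for values of the solution
  below 1.\<close>

lemma divide_one_plus_mono:
  fixes x y b :: real
  assumes "x \<le> y" "0 < 1 + b * x" "0 < 1 + b * y"
  shows "x / (1 + b * x) \<le> y / (1 + b * y)"
  by (subst pos_divide_le_eq[OF assms(2)], subst times_divide_eq_left, subst pos_le_divide_eq[OF assms(3)])
     (use assms(1) in \<open>simp add: algebra_simps\<close>)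

text \<open>As \<open>\<alpha>\<close> is positive, a bound on the extended supremum excludes
  infinite window integrals and can be restated with real ones.\<close>

lemma (in delay_equation) window_integral:
  assumes T: "0 \<le> T" and t: "T \<le> t" and \<theta>: "0 \<le> \<theta>" and \<alpha>: "0 < \<alpha>"
    and bound: "ennreal \<alpha> * Lambda_sup h lam T \<le> ennreal \<theta>"
  shows "lam integrable_on {t-h..t}" "\<alpha> * integral {t-h..t} lam \<le> \<theta>"
proof -
  define I where "I = (\<integral>\<^sup>+ s. ennreal (lam s) \<partial>lebesgue_on {t-h..t})"
  have "I \<le> Lambda_sup h lam T" unfolding Lambda_sup_def I_def using t by (intro SUP_upper) simp
  then have le: "ennreal \<alpha> * I \<le> ennreal \<theta>" using bound by (meson mult_left_mono order_trans zero_le)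
  have fin: "I < \<infinity>"
  proof (rule ccontr)
    assume "\<not> I < \<infinity>"
    then have "ennreal \<alpha> * I = \<infinity>" using \<alpha> by (simp add: ennreal_mult_eq_top_iff less_top[symmetric])
    then show False using le by (simp add: top_unique)
  qed
  have m: "lam \<in> borel_measurable (lebesgue_on {t-h..t})"
    by (rule measurable_restrict_mono[OF lam_meas]) (use T t in auto)
  have nn: "0 \<le> lam s" if "s \<in> {t-h..t}" for s using lam_pos[of s] T t that by simp
  have i: "integrable (lebesgue_on {t-h..t}) lam"
    by (rule integrableI_nonneg[OF m]) (use fin nn in \<open>auto simp: I_def intro!: AE_I2\<close>)
  show "lam integrable_on {t-h..t}" by (rule integrable_on_lebesgue_on[OF i]) simp
  have "I = ennreal (integral {t-h..t} lam)"
    unfolding I_def using nn lebesgue_integral_eq_integral[OF i]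
    by (subst nn_integral_eq_integral[OF i]) (auto intro!: AE_I2)
  moreover have "0 \<le> integral {t-h..t} lam"
    by (rule integral_nonneg[OF integrable_on_lebesgue_on[OF i]]) (use nn in auto)
  ultimately show "\<alpha> * integral {t-h..t} lam \<le> \<theta>"
    using le \<alpha> \<theta> by (simp flip: ennreal_mult)
qed

text \<open>\<open>\<theta>\<close> bounds the clock length of a delay window. Keeping it free
  serves both regimes: 3/2 for \<open>b \<noteq> 1/2\<close> and a number in \<open>[1, 3/2)\<close>
  for \<open>b = 1/2\<close>.\<close>

locale rational_feedback = delay_equation +
  fixes a b T \<theta> :: real
  assumes a_neg: "a < 0" and b_nonneg: "b \<ge> 0"
    and f_r: "\<And>t x. t \<ge> 0 \<Longrightarrow> x > -1 \<Longrightarrow> (b \<noteq> 0 \<Longrightarrow> x > - (1 / b)) \<Longrightarrow>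
          x * (f t (x + 1) - a * x / (1 + b * x)) \<ge> 0"
    and T_pos: "T > 0" and \<theta>_nonneg: "0 \<le> \<theta>"
    and \<Lambda>_le: "ennreal \<bar>a\<bar> * Lambda_sup h lam T \<le> ennreal \<theta>"
begin

definition \<tau> :: "real \<Rightarrow> real" where
  "\<tau> t = \<bar>a\<bar> * integral {T..t} lam"

lemma lam_window: "T \<le> t \<Longrightarrow> lam integrable_on {t-h..t}" "T \<le> t \<Longrightarrow> \<bar>a\<bar> * integral {t-h..t} lam \<le> \<theta>"
  using window_integral[of T t \<theta> "\<bar>a\<bar>"] T_pos \<theta>_nonneg \<Lambda>_le a_neg by auto

lemma lam_integrable:
  assumes "T \<le> s"
  shows "lam integrable_on {s..t}"
proof -
  have *: "lam integrable_on {T..T + real n * h}" for n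
  proof (induction n)
    case 0
    show ?case using integrable_on_refl[of lam T] by simp
  next
    case (Suc n)
    have i: "lam integrable_on {T + real n * h..T + real (Suc n) * h}"
      using lam_window(1)[of "T + real (Suc n) * h"] h_pos by (simp add: algebra_simps)
    show ?case
      by (rule Henstock_Kurzweil_Integration.integrable_combine[OF _ _ Suc i]) (use h_pos in \<open>simp_all add: algebra_simps\<close>)
  qed
  obtain n where n: "t - T \<le> real n * h" using reals_Archimedean3[OF h_pos] by (meson less_imp_le)
  show ?thesis by (rule integrable_on_subinterval[OF *[of n]]) (use assms n in auto)
qed

lemma \<tau>_diff:
  assumes "T \<le> s" "s \<le> t"
  shows "\<tau> t - \<tau> s = \<bar>a\<bar> * integral {s..t} lam"
proof -
  have "integral {T..s} lam + integral {s..t} lam = integral {T..t} lam"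
    by (rule Henstock_Kurzweil_Integration.integral_combine[OF assms lam_integrable[OF order_refl]])
  then show ?thesis unfolding \<tau>_def by (metis add_diff_cancel_left' right_diff_distrib)
qed

lemma clock: "delay_clock h T \<theta> \<tau>"
proof
  show "0 < h" by (rule h_pos)
  show "continuous_on {T..} \<tau>"
    unfolding continuous_on_def
  proof
    fix t assume t: "t \<in> {T..}"
    have "continuous_on {T..t+1} \<tau>"
      unfolding \<tau>_def by (intro continuous_intros indefinite_integral_continuous_1 lam_integrable order_refl)
    then have "(\<tau> \<longlongrightarrow> \<tau> t) (at t within {T..t+1})" using t by (simp add: continuous_on_def)
    moreover have "at t within {T..} = at t within {T..t+1}"
      by (rule at_within_nhd[of _ "{..<t+1}"]) (use t in auto)
    ultimately show "(\<tau> \<longlongrightarrow> \<tau> t) (at t within {T..})" by simp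
  qed
  show "\<tau> s \<le> \<tau> t" if "T \<le> s" "s \<le> t" for s t
  proof -
    have "0 \<le> integral {s..t} lam"
    proof (rule integral_nonneg[OF lam_integrable[OF that(1)]])
      show "0 \<le> lam u" if "u \<in> {s..t}" for u
        using lam_pos[of u] that \<open>T \<le> s\<close> T_pos h_pos by auto
    qed
    then have "0 \<le> \<bar>a\<bar> * integral {s..t} lam" by simp
    then show ?thesis using \<tau>_diff[OF that] by simp
  qed
  show "\<tau> t - \<tau> (t - h) \<le> \<theta>" if "T \<le> t - h" for t
    using \<tau>_diff[OF that] lam_window(2)[of t] that h_pos by simp
qed

text \<open>Condition (6) is needed only for \<open>v > 1\<close>, where
  \<open>x / (1 + b * x)\<close> increases with \<open>x\<close>, so that \<open>v = exp c\<close>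
  is the worst case. For \<open>v \<le> 1\<close> the sign of \<open>rhs\<close> suffices.\<close>

lemma rhs_lower:
  assumes s: "0 \<le> s" and v: "0 < v" "v \<le> exp c" and c: "0 \<le> c"
  shows "- (\<bar>a\<bar> * ((exp c - 1) / (1 + b * (exp c - 1)))) * lam s \<le> rhs s v"
proof (cases "v \<le> 1")
  case True
  have "0 \<le> \<bar>a\<bar> * ((exp c - 1) / (1 + b * (exp c - 1))) * lam s"
    using c b_nonneg lam_pos[of s] s h_pos by (intro mult_nonneg_nonneg divide_nonneg_nonneg add_nonneg_nonneg) auto
  then show ?thesis using rhs_sign(2)[OF v(1) True, of s] by simp
next
  case False
  define x where "x = v - 1"
  have x: "0 < x" "x \<le> exp c - 1" using False v by (auto simp: x_def)
  have "0 \<le> b * x" "0 \<le> b * (exp c - 1)"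
    using b_nonneg x c by simp_all
  then have d: "0 < 1 + b * x" "0 < 1 + b * (exp c - 1)" by auto
  have "0 \<le> x * (f s (x + 1) - a * x / (1 + b * x))"
    using x b_nonneg by (intro f_r s) (auto simp: less_le_trans[of _ 0])
  then have "a * x / (1 + b * x) \<le> f s v" using x(1) by (simp add: zero_le_mult_iff x_def)
  moreover have "x / (1 + b * x) \<le> (exp c - 1) / (1 + b * (exp c - 1))"
    by (rule divide_one_plus_mono[OF x(2) d])
  then have "a * ((exp c - 1) / (1 + b * (exp c - 1))) \<le> a * (x / (1 + b * x))"
    using a_neg by (intro mult_left_mono_neg) auto
  ultimately have "a * ((exp c - 1) / (1 + b * (exp c - 1))) \<le> f s v" by simp
  then have "lam s * (a * ((exp c - 1) / (1 + b * (exp c - 1)))) \<le> lam s * f s v"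
    using lam_pos[of s] s h_pos by (intro mult_left_mono) auto
  then show ?thesis using s a_neg by (simp add: rhs_def mult.commute)
qed

text \<open>Positivity of the denominator places \<open>v - 1\<close> above
  \<open>- (1 / b)\<close>, where condition (6) is available.\<close>

lemma rhs_upper:
  assumes s: "0 \<le> s" and v: "exp (- c) \<le> v" and c: "0 \<le> c" and d: "0 < 1 - b * (1 - exp (- c))"
  shows "rhs s v \<le> \<bar>a\<bar> * ((1 - exp (- c)) / (1 - b * (1 - exp (- c)))) * lam s"
proof (cases "1 \<le> v")
  case True
  have "0 \<le> \<bar>a\<bar> * ((1 - exp (- c)) / (1 - b * (1 - exp (- c)))) * lam s"
    using c d lam_pos[of s] s h_pos by (intro mult_nonneg_nonneg divide_nonneg_nonneg) auto
  then show ?thesis using rhs_ge_1[OF True, of s] by simp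
next
  case False
  define x where "x = 1 - v"
  have x: "0 < x" "x \<le> 1 - exp (- c)" "x < 1" using False v by (auto simp: x_def intro: less_le_trans[OF exp_gt_zero])
  have "b * x \<le> b * (1 - exp (- c))" using b_nonneg x by (intro mult_left_mono) auto
  then have d': "0 < 1 - b * x" using d by simp
  have "0 \<le> (- x) * (f s (- x + 1) - a * (- x) / (1 + b * (- x)))"
  proof (intro f_r s)
    assume "b \<noteq> 0"
    then show "- (1 / b) < - x" using d' b_nonneg by (simp add: field_simps)
  qed (use x in auto)
  then have "f s v \<le> a * (- x) / (1 + b * (- x))" using x(1) by (simp add: mult_le_0_iff zero_le_mult_iff x_def)
  then have "f s v \<le> \<bar>a\<bar> * (x / (1 - b * x))" using a_neg by simp
  moreover have "x / (1 - b * x) \<le> (1 - exp (- c)) / (1 - b * (1 - exp (- c)))"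
    using divide_one_plus_mono[of x "1 - exp (- c)" "- b"] x d d' by simp
  then have "\<bar>a\<bar> * (x / (1 - b * x)) \<le> \<bar>a\<bar> * ((1 - exp (- c)) / (1 - b * (1 - exp (- c))))"
    by (intro mult_left_mono) auto
  ultimately have "f s v \<le> \<bar>a\<bar> * ((1 - exp (- c)) / (1 - b * (1 - exp (- c))))" by linarith
  then have "lam s * f s v \<le> lam s * (\<bar>a\<bar> * ((1 - exp (- c)) / (1 - b * (1 - exp (- c)))))"
    using lam_pos[of s] s h_pos by (intro mult_left_mono) auto
  then show ?thesis using s by (simp add: rhs_def mult.commute)
qed

context
  fixes x :: "real \<Rightarrow> real"
  assumes sol: "solution_on h lam f L \<infinity> x" and nt: "nontrivial_on \<infinity> x"
begin

text \<open>\<open>L\<close> lies between the extremes of its window, so the bound on the history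
  passes to the feedback; integration of the pointwise estimate produces clock increments.\<close>

lemma ln_lower:
  assumes st: "T \<le> s - h" "s \<le> t" and c: "0 \<le> c" and hist: "\<And>u. u \<in> {s-h..t} \<Longrightarrow> ln (x u) \<le> c"
  shows "ln (x t) - ln (x s) \<ge> - ((exp c - 1) / (1 + b * (exp c - 1))) * (\<tau> t - \<tau> s)"
proof -
  let ?k = "- (\<bar>a\<bar> * ((exp c - 1) / (1 + b * (exp c - 1))))"
  have s: "0 \<le> s" "T \<le> s" "h \<le> s" using st T_pos h_pos by auto
  have "?k * integral {s..t} lam \<le> ln (x t) - ln (x s)"
  proof (rule has_integral_le[OF _ ln_x_has_integral[OF sol nt s(1) st(2)]])
    show "((\<lambda>u. ?k * lam u) has_integral ?k * integral {s..t} lam) {s..t}"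
      by (intro has_integral_mult_right integrable_integral lam_integrable s)
    fix u assume u: "u \<in> {s..t}"
    have "x v \<le> exp c" if "v \<in> {u-h..u}" for v
    proof -
      have "0 < x v" using x_pos[OF sol nt, of v] that u st T_pos by auto
      moreover have "ln (x v) \<le> c" using that u by (intro hist) auto
      ultimately show ?thesis by (metis exp_le_cancel_iff exp_ln)
    qed
    then have "L u (segment h x u) \<le> exp c" by (intro L_x_le[OF sol nt]) (use u s in auto)
    then show "?k * lam u \<le> rhs u (L u (segment h x u))"
      by (intro rhs_lower c L_x_pos[OF sol nt]) (use u s in auto)
  qed
  then show ?thesis using \<tau>_diff[OF s(2) st(2)] by (simp add: mult_ac)
qed

lemma ln_upper:
  assumes st: "T \<le> s - h" "s \<le> t" and c: "0 \<le> c" and d: "0 < 1 - b * (1 - exp (- c))"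
    and hist: "\<And>u. u \<in> {s-h..t} \<Longrightarrow> - c \<le> ln (x u)"
  shows "ln (x t) - ln (x s) \<le> ((1 - exp (- c)) / (1 - b * (1 - exp (- c)))) * (\<tau> t - \<tau> s)"
proof -
  let ?k = "\<bar>a\<bar> * ((1 - exp (- c)) / (1 - b * (1 - exp (- c))))"
  have s: "0 \<le> s" "T \<le> s" using st T_pos h_pos by auto
  have "ln (x t) - ln (x s) \<le> ?k * integral {s..t} lam"
  proof (rule has_integral_le[OF ln_x_has_integral[OF sol nt s(1) st(2)]])
    show "((\<lambda>u. ?k * lam u) has_integral ?k * integral {s..t} lam) {s..t}"
      by (intro has_integral_mult_right integrable_integral lam_integrable s)
    fix u assume u: "u \<in> {s..t}"
    have "exp (- c) \<le> x v" if "v \<in> {u-h..u}" for v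
    proof -
      have "0 < x v" using x_pos[OF sol nt, of v] that u st T_pos by auto
      moreover have "- c \<le> ln (x v)" using that u by (intro hist) auto
      ultimately show ?thesis by (simp add: ln_ge_iff)
    qed
    then have "exp (- c) \<le> L u (segment h x u)" by (intro L_x_ge[OF sol nt]) (use u s in auto)
    then show "rhs u (L u (segment h x u)) \<le> ?k * lam u"
      by (intro rhs_upper c d) (use u s in auto)
  qed
  then show ?thesis using \<tau>_diff[OF s(2) st(2)] by (simp add: mult_ac)
qed

lemma ln_lower_rational:
  assumes st: "T \<le> s - h" "s \<le> t" and c: "0 \<le> c" "0 < 1 + (b - 1/2) * c"
    and hist: "\<And>u. u \<in> {s-h..t} \<Longrightarrow> ln (x u) \<le> c"
  shows "ln (x t) - ln (x s) \<ge> - (c / (1 + (b - 1/2) * c)) * (\<tau> t - \<tau> s)"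
proof -
  interpret delay_clock h T \<theta> \<tau> by (rule clock)
  have "(exp c - 1) / (1 + b * (exp c - 1)) * (\<tau> t - \<tau> s) \<le> c / (1 + (b - 1/2) * c) * (\<tau> t - \<tau> s)"
    using \<tau>_mono[of s t] st h_pos by (intro mult_right_mono rational_exp_le b_nonneg c) auto
  then show ?thesis using ln_lower[OF st c(1) hist] by linarith
qed

lemma ln_upper_rational:
  assumes st: "T \<le> s - h" "s \<le> t" and c: "0 \<le> c" "0 < 1 - (b - 1/2) * c"
    and hist: "\<And>u. u \<in> {s-h..t} \<Longrightarrow> - c \<le> ln (x u)"
  shows "ln (x t) - ln (x s) \<le> c / (1 - (b - 1/2) * c) * (\<tau> t - \<tau> s)"
proof -
  interpret delay_clock h T \<theta> \<tau> by (rule clock)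
  have "(1 - exp (- c)) / (1 - b * (1 - exp (- c))) * (\<tau> t - \<tau> s) \<le> c / (1 - (b - 1/2) * c) * (\<tau> t - \<tau> s)"
    using \<tau>_mono[of s t] st h_pos by (intro mult_right_mono rational_exp_minus_le(2) c) auto
  then show ?thesis using ln_upper[OF st c(1) rational_exp_minus_le(1)[OF c] hist] by linarith
qed

lemma ln_x_cont_T: "continuous_on {T..} (\<lambda>t. ln (x t))"
  by (rule continuous_on_subset[OF ln_x_cont[OF sol nt]]) (use T_pos in auto)

section \<open>Oscillating solutions\<close>

text \<open>A bound \<open>c\<close> for \<open>z\<close> corresponds to \<open>c / \<beta>\<close>
  for \<open>ln x\<close>, and after multiplication by \<open>\<beta>\<close> the rate is free of
  \<open>b\<close>. For \<open>\<beta> < 0\<close> the scaling reverses the order: the lower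
  inequality for \<open>z\<close> comes from the upper one for \<open>ln x\<close> and conversely.
  One normal form thus serves both signs.\<close>

lemma oscillating_limit:
  assumes b: "b \<noteq> 1/2" and \<theta>: "\<theta> = 3/2"
    and osc: "\<And>S. \<exists>t\<ge>S. 0 < ln (x t)" "\<And>S. \<exists>t\<ge>S. ln (x t) < 0"
  shows "((\<lambda>t. ln (x t)) \<longlongrightarrow> 0) at_top"
proof -
  define \<beta> where "\<beta> = b - 1/2"
  define z where "z t = \<beta> * ln (x t)" for t
  have \<beta>0: "\<beta> \<noteq> 0" using b by (simp add: \<beta>_def)
  have scale: "(b - 1/2) * (c / \<beta>) = c" and scale': "(b - 1/2) * (- c / \<beta>) = - c" for c
    using \<beta>0 unfolding \<beta>_def[symmetric] by simp_all
  have z_diff: "\<beta> * (ln (x t) - ln (x s)) = z t - z s" for s t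
    by (simp add: z_def right_diff_distrib)
  have "rational_delay h T \<tau> z"
  proof (intro rational_delay.intro rational_delay_axioms.intro)
    show "delay_clock h T (3/2) \<tau>" using clock \<theta> by simp
    show "continuous_on {T..} z" unfolding z_def by (intro continuous_intros ln_x_cont_T)
    show "\<exists>t\<ge>S. 0 < z t" for S
      using osc(1)[of S] osc(2)[of S] \<beta>0 by (cases "0 < \<beta>") (auto simp: z_def zero_less_mult_iff)
    show "\<exists>t\<ge>S. z t < 0" for S
      using osc(1)[of S] osc(2)[of S] \<beta>0 by (cases "0 < \<beta>") (auto simp: z_def mult_less_0_iff)
    show "decay_bound h T \<tau> (\<lambda>c. c / (1 + c)) z"
      unfolding decay_bound_def
    proof (intro allI impI, elim conjE)
      fix s t c assume st: "T \<le> s - h" "s \<le> t" and c: "0 \<le> c" and hist: "\<forall>u\<in>{s-h..t}. z u \<le> c"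
      show "- (c / (1 + c)) * (\<tau> t - \<tau> s) \<le> z t - z s"
      proof (cases "0 < \<beta>")
        case True
        have "- (c / \<beta> / (1 + (b - 1/2) * (c / \<beta>))) * (\<tau> t - \<tau> s) \<le> ln (x t) - ln (x s)"
        proof (rule ln_lower_rational[OF st])
          show "0 < 1 + (b - 1/2) * (c / \<beta>)" unfolding scale using c by simp
          show "ln (x u) \<le> c / \<beta>" if "u \<in> {s-h..t}" for u
            using hist that True by (simp add: z_def pos_le_divide_eq mult.commute)
        qed (use c True in simp)
        then have "\<beta> * (- (c / \<beta> / (1 + c)) * (\<tau> t - \<tau> s)) \<le> \<beta> * (ln (x t) - ln (x s))"
          unfolding scale using True by (intro mult_left_mono) auto
        moreover have "\<beta> * (- (c / \<beta> / (1 + c)) * (\<tau> t - \<tau> s)) = - (c / (1 + c)) * (\<tau> t - \<tau> s)"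
          using \<beta>0 by simp
        ultimately show ?thesis by (simp only: z_diff)
      next
        case False
        then have neg: "\<beta> < 0" using \<beta>0 by simp
        have "ln (x t) - ln (x s) \<le> - c / \<beta> / (1 - (b - 1/2) * (- c / \<beta>)) * (\<tau> t - \<tau> s)"
        proof (rule ln_upper_rational[OF st])
          show "0 < 1 - (b - 1/2) * (- c / \<beta>)" unfolding scale' using c by simp
          show "- (- c / \<beta>) \<le> ln (x u)" if "u \<in> {s-h..t}" for u
            using hist that neg by (simp add: z_def neg_divide_le_eq mult.commute)
        qed (use c neg in \<open>simp add: divide_nonneg_neg\<close>)
        then have "\<beta> * (- c / \<beta> / (1 - - c) * (\<tau> t - \<tau> s)) \<le> \<beta> * (ln (x t) - ln (x s))"
          unfolding scale' using neg by (intro mult_left_mono_neg) auto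
        moreover have "\<beta> * (- c / \<beta> / (1 - - c) * (\<tau> t - \<tau> s)) = - (c / (1 + c)) * (\<tau> t - \<tau> s)"
          using \<beta>0 by simp
        ultimately show ?thesis by (simp only: z_diff)
      qed
    qed
    fix s t c assume st: "T \<le> s - h" "s \<le> t" and c: "0 \<le> c" "c < 1" and hist: "\<forall>u\<in>{s-h..t}. - c \<le> z u"
    show "z t - z s \<le> c / (1 - c) * (\<tau> t - \<tau> s)"
    proof (cases "0 < \<beta>")
      case True
      have "ln (x t) - ln (x s) \<le> c / \<beta> / (1 - (b - 1/2) * (c / \<beta>)) * (\<tau> t - \<tau> s)"
      proof (rule ln_upper_rational[OF st])
        show "0 < 1 - (b - 1/2) * (c / \<beta>)" unfolding scale using c by simp
        have "- c / \<beta> \<le> ln (x u)" if "u \<in> {s-h..t}" for u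
          using hist that True by (simp only: pos_divide_le_eq) (simp add: z_def mult.commute)
        then show "- (c / \<beta>) \<le> ln (x u)" if "u \<in> {s-h..t}" for u using that by simp
      qed (use c True in simp)
      then have "\<beta> * (ln (x t) - ln (x s)) \<le> \<beta> * (c / \<beta> / (1 - c) * (\<tau> t - \<tau> s))"
        unfolding scale using True by (intro mult_left_mono) auto
      moreover have "\<beta> * (c / \<beta> / (1 - c) * (\<tau> t - \<tau> s)) = c / (1 - c) * (\<tau> t - \<tau> s)"
        using \<beta>0 by simp
      ultimately show ?thesis by (simp only: z_diff)
    next
      case False
      then have neg: "\<beta> < 0" using \<beta>0 by simp
      have "- (- c / \<beta> / (1 + (b - 1/2) * (- c / \<beta>))) * (\<tau> t - \<tau> s) \<le> ln (x t) - ln (x s)"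
      proof (rule ln_lower_rational[OF st])
        show "0 < 1 + (b - 1/2) * (- c / \<beta>)" unfolding scale' using c by simp
        show "ln (x u) \<le> - c / \<beta>" if "u \<in> {s-h..t}" for u
          using hist that neg by (simp only: neg_le_divide_eq) (simp add: z_def mult.commute)
      qed (use c neg in \<open>simp add: divide_nonneg_neg\<close>)
      then have "\<beta> * (ln (x t) - ln (x s)) \<le> \<beta> * (- (- c / \<beta> / (1 + - c)) * (\<tau> t - \<tau> s))"
        unfolding scale' using neg by (intro mult_left_mono_neg) auto
      moreover have "\<beta> * (- (- c / \<beta> / (1 + - c)) * (\<tau> t - \<tau> s)) = c / (1 - c) * (\<tau> t - \<tau> s)"
        using \<beta>0 by simp
      ultimately show ?thesis by (simp only: z_diff)
    qed
  qed
  then have "(z \<longlongrightarrow> 0) at_top" by (rule rational_delay.tendsto_zero)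
  then have "((\<lambda>t. z t / \<beta>) \<longlongrightarrow> 0 / \<beta>) at_top" using \<beta>0 by (intro tendsto_divide) auto
  then show ?thesis using \<beta>0 by (simp add: z_def)
qed

text \<open>For \<open>b = 1/2\<close> both comparison rates equal \<open>2 * tanh (c / 2)\<close>.
  The bound by \<open>c\<close> gives the contraction, the bound by 2 the initial estimate.\<close>

lemma oscillating_limit_half:
  assumes b: "b = 1/2" and \<theta>: "1 \<le> \<theta>" "\<theta> < 3/2"
    and osc: "\<And>S. \<exists>t\<ge>S. 0 < ln (x t)" "\<And>S. \<exists>t\<ge>S. ln (x t) < 0"
  shows "((\<lambda>t. ln (x t)) \<longlongrightarrow> 0) at_top"
proof -
  interpret delay_clock h T \<theta> \<tau> by (rule clock)
  have b_half: "b - 1/2 = 0" using b by simp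
  show ?thesis
  proof (rule linear_delay_tendsto_zero[OF \<theta> ln_x_cont_T _ _ osc])
    show "decay_bound h T \<tau> (\<lambda>c. min c 2) (\<lambda>t. ln (x t))"
      unfolding decay_bound_def
    proof (intro allI impI, elim conjE)
      fix s t c assume st: "T \<le> s - h" "s \<le> t" and c: "0 \<le> c" and hist: "\<forall>u\<in>{s-h..t}. ln (x u) \<le> c"
      have "1 + b * (exp c - 1) = (1 + exp c) / 2" unfolding b by (simp add: field_simps)
      moreover have "0 < (1 + exp c) / 2" by (simp add: add_pos_pos)
      ultimately have d: "0 < 1 + b * (exp c - 1)" by (simp only:)
      have "(exp c - 1) / (1 + b * (exp c - 1)) \<le> 2"
        by (subst pos_divide_le_eq[OF d]) (simp add: b field_simps)
      moreover have "(exp c - 1) / (1 + b * (exp c - 1)) \<le> c"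
        using rational_exp_le[OF b_nonneg c] by (simp add: b_half)
      ultimately have "(exp c - 1) / (1 + b * (exp c - 1)) \<le> min c 2" by simp
      then have "(exp c - 1) / (1 + b * (exp c - 1)) * (\<tau> t - \<tau> s) \<le> min c 2 * (\<tau> t - \<tau> s)"
        using \<tau>_mono[of s t] st h_pos by (intro mult_right_mono) auto
      then show "- min c 2 * (\<tau> t - \<tau> s) \<le> ln (x t) - ln (x s)"
        using ln_lower[OF st c] hist by fastforce
    qed
    show "decay_bound h T \<tau> (\<lambda>c. min c 2) (\<lambda>t. - ln (x t))"
      unfolding decay_bound_def
    proof (intro allI impI, elim conjE)
      fix s t c assume st: "T \<le> s - h" "s \<le> t" and c: "0 \<le> c" and hist: "\<forall>u\<in>{s-h..t}. - ln (x u) \<le> c"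
      have hist': "- c \<le> ln (x u)" if "u \<in> {s-h..t}" for u using hist that by fastforce
      have "1 - b * (1 - exp (- c)) = (1 + exp (- c)) / 2" unfolding b by (simp add: field_simps)
      moreover have "0 < (1 + exp (- c)) / 2" by (simp add: add_pos_pos)
      ultimately have d: "0 < 1 - b * (1 - exp (- c))" by (simp only:)
      have "(1 - exp (- c)) / (1 - b * (1 - exp (- c))) \<le> 2"
        by (subst pos_divide_le_eq[OF d]) (simp add: b field_simps)
      moreover have "(1 - exp (- c)) / (1 - b * (1 - exp (- c))) \<le> c"
        using rational_exp_minus_le(2)[OF c, of b] by (simp add: b_half)
      ultimately have "(1 - exp (- c)) / (1 - b * (1 - exp (- c))) \<le> min c 2" by simp
      then have "(1 - exp (- c)) / (1 - b * (1 - exp (- c))) * (\<tau> t - \<tau> s) \<le> min c 2 * (\<tau> t - \<tau> s)"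
        using \<tau>_mono[of s t] st h_pos by (intro mult_right_mono) auto
      then show "- min c 2 * (\<tau> t - \<tau> s) \<le> - ln (x t) - - ln (x s)"
        using ln_upper[OF st c d hist'] by simp
    qed
  qed
qed

lemma solution_tendsto_1:
  assumes "b \<noteq> 1/2 \<and> \<theta> = 3/2 \<or> b = 1/2 \<and> 1 \<le> \<theta> \<and> \<theta> < 3/2"
  shows "(x \<longlongrightarrow> 1) at_top"
proof (cases "(\<forall>S. \<exists>t\<ge>S. 0 < ln (x t)) \<and> (\<forall>S. \<exists>t\<ge>S. ln (x t) < 0)")
  case True
  then have "((\<lambda>t. ln (x t)) \<longlongrightarrow> 0) at_top"
    using oscillating_limit oscillating_limit_half assms by blast
  then have "((\<lambda>t. exp (ln (x t))) \<longlongrightarrow> exp 0) at_top" by (rule tendsto_exp)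
  moreover have "\<forall>\<^sub>F t in at_top. exp (ln (x t)) = x t"
    unfolding eventually_at_top_linorder using x_pos[OF sol nt] by (intro exI[of _ 0]) auto
  ultimately show ?thesis by (auto elim: Lim_transform_eventually)
next
  case False
  then show ?thesis by (rule nonoscillating_limit[OF sol nt])
qed

end

lemma solutions_tend_to_1:
  assumes "b \<noteq> 1/2 \<and> \<theta> = 3/2 \<or> b = 1/2 \<and> 1 \<le> \<theta> \<and> \<theta> < 3/2"
  shows "nontrivial_solutions_tend_to_1 h lam f L"
  unfolding nontrivial_solutions_tend_to_1_def
proof (intro allI impI, elim conjE)
  fix \<omega> x assume max: "maximal_solution h lam f L \<omega> x" and nt: "nontrivial_on \<omega> x"
  have \<omega>: "\<omega> = \<infinity>" by (rule maximal_solution_global[OF max nt])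
  moreover have "solution_on h lam f L \<omega> x" using max by (simp add: maximal_solution_def)
  ultimately show "\<omega> = \<infinity> \<and> (x \<longlongrightarrow> 1) at_top"
    using solution_tendsto_1[OF _ _ assms] nt by simp
qed

end

theorem theorem3:
  fixes h a b :: real
    and lam :: "real \<Rightarrow> real"
    and f :: "real \<Rightarrow> real \<Rightarrow> real"
    and L :: "real \<Rightarrow> (real \<Rightarrow> real) \<Rightarrow> real"
  assumes h_pos: "h > 0"
    and lam_pos: "\<forall>t\<ge>-h. lam t > 0"
    and lam_meas: "lam \<in> borel_measurable (lebesgue_on {-h..})"
    and lam_div: "(\<integral>\<^sup>+ s. ennreal (lam s) \<partial>lebesgue_on {0..}) = \<infinity>"
    and lam_sup: "Lambda_sup h lam 0 < \<infinity>"
    and f_car: "caratheodory euclideanreal f"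
    and L_car: "caratheodory (mtopology_of (hist_space h)) L"
    and L_between: "\<forall>t\<ge>0. \<forall>\<phi>\<in>mspace (hist_space h).
          Inf (\<phi> ` {-h..0}) \<le> L t \<phi> \<and> L t \<phi> \<le> Sup (\<phi> ` {-h..0})"
    and f_one: "\<forall>t\<ge>0. f t 1 = 0"
    and f_div: "\<forall>w c. continuous_on {0..} w \<and> (w \<longlongrightarrow> c) at_top \<and> c > 0 \<and> c \<noteq> 1 \<longrightarrow>
          improper_integral_diverges (\<lambda>s. lam s * f s (w s))"
    and f_sign: "\<forall>t\<ge>0. \<forall>x>-1. x \<noteq> 0 \<longrightarrow> x * f t (1 + x) < 0"
    and a_neg: "a < 0"
    and b_nonneg: "b \<ge> 0"
    and f_r: "\<forall>t\<ge>0. \<forall>x. x > -1 \<and> (b \<noteq> 0 \<longrightarrow> x > - (1 / b)) \<longrightarrow>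
          x * (f t (x + 1) - a * x / (1 + b * x)) \<ge> 0"
  shows "(b \<noteq> 1/2 \<longrightarrow> (\<exists>T>0. ennreal \<bar>a\<bar> * Lambda_sup h lam T \<le> ennreal (3/2)) \<longrightarrow>
            nontrivial_solutions_tend_to_1 h lam f L) \<and>
         (b = 1/2 \<longrightarrow> (\<exists>T>0. ennreal \<bar>a\<bar> * Lambda_sup h lam T < ennreal (3/2)) \<longrightarrow>
            nontrivial_solutions_tend_to_1 h lam f L)"
proof -
  interpret delay_equation h lam f L
    by unfold_locales (use assms in auto)
  have main: "nontrivial_solutions_tend_to_1 h lam f L"
    if "T > 0" "0 \<le> \<theta>" "ennreal \<bar>a\<bar> * Lambda_sup h lam T \<le> ennreal \<theta>"
      "b \<noteq> 1/2 \<and> \<theta> = 3/2 \<or> b = 1/2 \<and> 1 \<le> \<theta> \<and> \<theta> < 3/2" for T \<theta>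
  proof -
    interpret rational_feedback h lam f L a b T \<theta>
      by unfold_locales (use that a_neg b_nonneg f_r in auto)
    show ?thesis by (rule solutions_tend_to_1[OF that(4)])
  qed
  show ?thesis
  proof (intro conjI impI; elim exE conjE)
    fix T :: real assume "b \<noteq> 1/2" "T > 0" "ennreal \<bar>a\<bar> * Lambda_sup h lam T \<le> ennreal (3/2)"
    then show "nontrivial_solutions_tend_to_1 h lam f L" by (intro main[of T "3/2"]) auto
  next
    fix T :: real assume *: "b = 1/2" "T > 0" "ennreal \<bar>a\<bar> * Lambda_sup h lam T < ennreal (3/2)"
    define q where "q = enn2real (ennreal \<bar>a\<bar> * Lambda_sup h lam T)"
    have q: "ennreal \<bar>a\<bar> * Lambda_sup h lam T = ennreal q"
      unfolding q_def using *(3) by (intro ennreal_enn2real[symmetric]) (auto intro: less_trans)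
    have "0 \<le> q" by (simp add: q_def)
    then have "q < 3/2" using *(3) unfolding q by (simp add: ennreal_less_iff)
    \<comment> \<open>Raising the window bound to at least 1 lets the ramp of the linear case fit
      into the window, while it stays below 3/2.\<close>
    then show "nontrivial_solutions_tend_to_1 h lam f L"
      using * q \<open>0 \<le> q\<close> by (intro main[of T "max 1 q"]) (auto intro!: ennreal_leI)
  qed
qed

end
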